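(* For every standard $k\ge 1$, $\mathsf{RCA}_0 \vdash \mathsf{TS}(k+1) \rightarrow \mathsf{DNR}[0^{(k)}]$.
   Context: $\mathsf{RCA}_0$ is the usual base system of reverse mathematics (second-order arithmetic with $\Delta^0_1$-comprehension and $\Sigma^0_1$-induction). $[A]^k$ denotes the set of strictly increasing $k$-tuples of elements of $A$. For $f:[\mathbb{N}]^k\to\mathbb{N}$, a set $A$ is thin for $f$ if $f([A]^k)\neq\mathbb{N}$. $\mathsf{TS}(k)$ is the statement "every function $f:[\mathbb{N}]^k\to\mathbb{N}$ has an infinite set thin for $f$". A function $f:\mathbb{N}\to\mathbb{N}$ is diagonally non-computable (d.n.c.) relative to $Y$ if $f(e)\neq\Phi^Y_e(e)$ for every $e$ (vacuously when $\Phi^Y_e(e)$ diverges). $\mathsf{DNR}[0^{(k)}]$ is the statement "for every set $X$ there is a function d.n.c. relative to $X^{(k)}$", where $X^{(k)}$ is the $k$-th Turing jump of $X$ (in $\mathsf{RCA}_0$, computations relative to $X^{(k)}$ are expressed by formulas in the usual way). *)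

theory Defs
  imports Main
begin

section \<open>The language of second-order arithmetic\<close>

text \<open>
  Number variables and set variables are two independent families of de Bruijn indices:
  \<open>Forall\<close> binds the number index 0 and \<open>ForallS\<close> binds the set index 0.
  There is no equality between sets.
\<close>

datatype tm =
    Var nat
  | Zero  ("\<^bold>0")
  | One  ("\<^bold>1")
  | Plus tm tm  (infixl "\<^bold>+" 65)
  | Times tm tm  (infixl "\<^bold>*" 70)

datatype fm =
    Eq tm tm  (infix "\<^bold>=" 50)
  | Lt tm tm  (infix "\<^bold><" 50)
  | Mem tm nat  (infix "\<^bold>\<in>" 50)
  | Bot
  | Imp fm fm  (infixr "\<^bold>\<longrightarrow>" 25)
  | Forall fm
  | ForallS fm

definition Neg :: "fm \<Rightarrow> fm"  ("\<^bold>\<not> _" [40] 40)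
  where "(\<^bold>\<not> \<phi>) = (\<phi> \<^bold>\<longrightarrow> Bot)"

definition Top :: fm
  where "Top = (\<^bold>\<not> Bot)"

definition And :: "fm \<Rightarrow> fm \<Rightarrow> fm"  (infixr "\<^bold>\<and>" 35)
  where "(\<phi> \<^bold>\<and> \<psi>) = (\<^bold>\<not> (\<phi> \<^bold>\<longrightarrow> \<^bold>\<not> \<psi>))"

definition Or :: "fm \<Rightarrow> fm \<Rightarrow> fm"  (infixr "\<^bold>\<or>" 30)
  where "(\<phi> \<^bold>\<or> \<psi>) = (\<^bold>\<not> \<phi> \<^bold>\<longrightarrow> \<psi>)"

definition Iff :: "fm \<Rightarrow> fm \<Rightarrow> fm"  (infix "\<^bold>\<longleftrightarrow>" 25)
  where "(\<phi> \<^bold>\<longleftrightarrow> \<psi>) = ((\<phi> \<^bold>\<longrightarrow> \<psi>) \<^bold>\<and> (\<psi> \<^bold>\<longrightarrow> \<phi>))"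

definition Exists :: "fm \<Rightarrow> fm"
  where "Exists \<phi> = (\<^bold>\<not> Forall (\<^bold>\<not> \<phi>))"

definition ExistsS :: "fm \<Rightarrow> fm"
  where "ExistsS \<phi> = (\<^bold>\<not> ForallS (\<^bold>\<not> \<phi>))"

subsection \<open>Substitution\<close>

primrec subst_tm :: "(nat \<Rightarrow> tm) \<Rightarrow> tm \<Rightarrow> tm" where
  "subst_tm \<sigma> (Var i) = \<sigma> i"
| "subst_tm \<sigma> \<^bold>0 = \<^bold>0"
| "subst_tm \<sigma> \<^bold>1 = \<^bold>1"
| "subst_tm \<sigma> (s \<^bold>+ t) = subst_tm \<sigma> s \<^bold>+ subst_tm \<sigma> t"
| "subst_tm \<sigma> (s \<^bold>* t) = subst_tm \<sigma> s \<^bold>* subst_tm \<sigma> t"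

text \<open>\<open>t \<up> n\<close> is the term \<open>t\<close> moved under \<open>n\<close> additional number quantifiers.\<close>

definition lift :: "tm \<Rightarrow> nat \<Rightarrow> tm"  (infixl "\<up>" 80)
  where "t \<up> n = subst_tm (\<lambda>i. Var (i + n)) t"

primrec subst :: "(nat \<Rightarrow> tm) \<Rightarrow> fm \<Rightarrow> fm" where
  "subst \<sigma> (s \<^bold>= t) = (subst_tm \<sigma> s \<^bold>= subst_tm \<sigma> t)"
| "subst \<sigma> (s \<^bold>< t) = (subst_tm \<sigma> s \<^bold>< subst_tm \<sigma> t)"
| "subst \<sigma> (t \<^bold>\<in> X) = (subst_tm \<sigma> t \<^bold>\<in> X)"
| "subst \<sigma> Bot = Bot"
| "subst \<sigma> (\<phi> \<^bold>\<longrightarrow> \<psi>) = (subst \<sigma> \<phi> \<^bold>\<longrightarrow> subst \<sigma> \<psi>)"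
| "subst \<sigma> (Forall \<phi>) = Forall (subst (case_nat (Var 0) (\<lambda>i. \<sigma> i \<up> 1)) \<phi>)"
| "subst \<sigma> (ForallS \<phi>) = ForallS (subst \<sigma> \<phi>)"

text \<open>Set terms are just set variables, so that substitution for them is renaming.\<close>

primrec rename :: "(nat \<Rightarrow> nat) \<Rightarrow> fm \<Rightarrow> fm" where
  "rename \<rho> (s \<^bold>= t) = (s \<^bold>= t)"
| "rename \<rho> (s \<^bold>< t) = (s \<^bold>< t)"
| "rename \<rho> (t \<^bold>\<in> X) = (t \<^bold>\<in> \<rho> X)"
| "rename \<rho> Bot = Bot"
| "rename \<rho> (\<phi> \<^bold>\<longrightarrow> \<psi>) = (rename \<rho> \<phi> \<^bold>\<longrightarrow> rename \<rho> \<psi>)"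
| "rename \<rho> (Forall \<phi>) = Forall (rename \<rho> \<phi>)"
| "rename \<rho> (ForallS \<phi>) = ForallS (rename (case_nat 0 (\<lambda>i. Suc (\<rho> i))) \<phi>)"

text \<open>Replace the number index 0 by a term, respectively the set index 0 by a set variable.\<close>

definition inst :: "tm \<Rightarrow> fm \<Rightarrow> fm"
  where "inst t = subst (case_nat t Var)"

definition instS :: "nat \<Rightarrow> fm \<Rightarrow> fm"
  where "instS X = rename (case_nat X (\<lambda>i. i))"

definition wk :: "fm \<Rightarrow> fm"
  where "wk = subst (\<lambda>i. Var (Suc i))"

definition wkS :: "fm \<Rightarrow> fm"
  where "wkS = rename Suc"

subsection \<open>Universal closure\<close>

primrec bound_tm :: "tm \<Rightarrow> nat" where
  "bound_tm (Var i) = Suc i"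
| "bound_tm \<^bold>0 = 0"
| "bound_tm \<^bold>1 = 0"
| "bound_tm (s \<^bold>+ t) = max (bound_tm s) (bound_tm t)"
| "bound_tm (s \<^bold>* t) = max (bound_tm s) (bound_tm t)"

text \<open>\<open>bound \<phi>\<close> and \<open>boundS \<phi>\<close> are strict upper bounds for the free indices of \<open>\<phi>\<close>.\<close>

primrec bound :: "fm \<Rightarrow> nat" where
  "bound (s \<^bold>= t) = max (bound_tm s) (bound_tm t)"
| "bound (s \<^bold>< t) = max (bound_tm s) (bound_tm t)"
| "bound (t \<^bold>\<in> X) = bound_tm t"
| "bound Bot = 0"
| "bound (\<phi> \<^bold>\<longrightarrow> \<psi>) = max (bound \<phi>) (bound \<psi>)"
| "bound (Forall \<phi>) = bound \<phi> - 1"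
| "bound (ForallS \<phi>) = bound \<phi>"

primrec boundS :: "fm \<Rightarrow> nat" where
  "boundS (s \<^bold>= t) = 0"
| "boundS (s \<^bold>< t) = 0"
| "boundS (t \<^bold>\<in> X) = Suc X"
| "boundS Bot = 0"
| "boundS (\<phi> \<^bold>\<longrightarrow> \<psi>) = max (boundS \<phi>) (boundS \<psi>)"
| "boundS (Forall \<phi>) = boundS \<phi>"
| "boundS (ForallS \<phi>) = boundS \<phi> - 1"

definition univ_closure :: "fm \<Rightarrow> fm"
  where "univ_closure \<phi> = (ForallS ^^ boundS \<phi>) ((Forall ^^ bound \<phi>) \<phi>)"

section \<open>Provability\<close>

text \<open>Natural deduction for classical two-sorted logic, with equality on the number sort.\<close>

inductive proves :: "fm set \<Rightarrow> fm \<Rightarrow> bool"  (infix "\<turnstile>" 20) where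
  Assm: "\<phi> \<in> \<Gamma> \<Longrightarrow> \<Gamma> \<turnstile> \<phi>"
| ImpI: "insert \<phi> \<Gamma> \<turnstile> \<psi> \<Longrightarrow> \<Gamma> \<turnstile> \<phi> \<^bold>\<longrightarrow> \<psi>"
| ImpE: "\<Gamma> \<turnstile> \<phi> \<^bold>\<longrightarrow> \<psi> \<Longrightarrow> \<Gamma> \<turnstile> \<phi> \<Longrightarrow> \<Gamma> \<turnstile> \<psi>"
| Raa: "insert (\<^bold>\<not> \<phi>) \<Gamma> \<turnstile> Bot \<Longrightarrow> \<Gamma> \<turnstile> \<phi>"
| ForallI: "wk ` \<Gamma> \<turnstile> \<phi> \<Longrightarrow> \<Gamma> \<turnstile> Forall \<phi>"
| ForallE: "\<Gamma> \<turnstile> Forall \<phi> \<Longrightarrow> \<Gamma> \<turnstile> inst t \<phi>"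
| ForallSI: "wkS ` \<Gamma> \<turnstile> \<phi> \<Longrightarrow> \<Gamma> \<turnstile> ForallS \<phi>"
| ForallSE: "\<Gamma> \<turnstile> ForallS \<phi> \<Longrightarrow> \<Gamma> \<turnstile> instS X \<phi>"
| EqRefl: "\<Gamma> \<turnstile> t \<^bold>= t"
| EqSubst: "\<Gamma> \<turnstile> s \<^bold>= t \<Longrightarrow> \<Gamma> \<turnstile> inst s \<phi> \<Longrightarrow> \<Gamma> \<turnstile> inst t \<phi>"

section \<open>The system $\mathsf{RCA}_0$\<close>

text \<open>Bounded quantifiers; the bounding term does not contain the quantified variable.\<close>

definition BForall :: "tm \<Rightarrow> fm \<Rightarrow> fm"
  where "BForall t \<phi> = Forall (Var 0 \<^bold>< t \<up> 1 \<^bold>\<longrightarrow> \<phi>)"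

definition BExists :: "tm \<Rightarrow> fm \<Rightarrow> fm"
  where "BExists t \<phi> = (\<^bold>\<not> BForall t (\<^bold>\<not> \<phi>))"

inductive Delta0 :: "fm \<Rightarrow> bool" where
  "Delta0 (s \<^bold>= t)"
| "Delta0 (s \<^bold>< t)"
| "Delta0 (t \<^bold>\<in> X)"
| "Delta0 Bot"
| "Delta0 \<phi> \<Longrightarrow> Delta0 \<psi> \<Longrightarrow> Delta0 (\<phi> \<^bold>\<longrightarrow> \<psi>)"
| "Delta0 \<phi> \<Longrightarrow> Delta0 (BForall t \<phi>)"

definition Sigma1 :: "fm \<Rightarrow> bool"
  where "Sigma1 \<phi> \<longleftrightarrow> (\<exists>\<theta>. Delta0 \<theta> \<and> \<phi> = Exists \<theta>)"

definition Pi1 :: "fm \<Rightarrow> bool"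
  where "Pi1 \<phi> \<longleftrightarrow> (\<exists>\<theta>. Delta0 \<theta> \<and> \<phi> = Forall \<theta>)"

definition basic_axioms :: "fm set"
  where "basic_axioms =
   {\<^bold>\<not> Var 0 \<^bold>+ \<^bold>1 \<^bold>= \<^bold>0,
    Var 1 \<^bold>+ \<^bold>1 \<^bold>= Var 0 \<^bold>+ \<^bold>1 \<^bold>\<longrightarrow> Var 1 \<^bold>= Var 0,
    Var 0 \<^bold>+ \<^bold>0 \<^bold>= Var 0,
    Var 1 \<^bold>+ (Var 0 \<^bold>+ \<^bold>1) \<^bold>= (Var 1 \<^bold>+ Var 0) \<^bold>+ \<^bold>1,
    Var 0 \<^bold>* \<^bold>0 \<^bold>= \<^bold>0,
    Var 1 \<^bold>* (Var 0 \<^bold>+ \<^bold>1) \<^bold>= Var 1 \<^bold>* Var 0 \<^bold>+ Var 1,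
    \<^bold>\<not> Var 0 \<^bold>< \<^bold>0,
    Var 1 \<^bold>< Var 0 \<^bold>+ \<^bold>1 \<^bold>\<longleftrightarrow> (Var 1 \<^bold>< Var 0 \<^bold>\<or> Var 1 \<^bold>= Var 0)}"

text \<open>In the two schemes the distinguished variable of \<open>\<phi>\<close> (and \<open>\<psi>\<close>) is the number index 0;
  all other free variables are parameters.\<close>

definition induction_axiom :: "fm \<Rightarrow> fm"
  where "induction_axiom \<phi> =
    (inst \<^bold>0 \<phi> \<^bold>\<and> Forall (\<phi> \<^bold>\<longrightarrow> subst (case_nat (Var 0 \<^bold>+ \<^bold>1) (\<lambda>i. Var (Suc i))) \<phi>)
      \<^bold>\<longrightarrow> Forall \<phi>)"

definition comprehension_axiom :: "fm \<Rightarrow> fm \<Rightarrow> fm"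
  where "comprehension_axiom \<phi> \<psi> =
    (Forall (\<phi> \<^bold>\<longleftrightarrow> \<psi>) \<^bold>\<longrightarrow> ExistsS (Forall (Var 0 \<^bold>\<in> 0 \<^bold>\<longleftrightarrow> wkS \<phi>)))"

definition RCA0 :: "fm set"
  where "RCA0 = univ_closure `
    (basic_axioms
      \<union> {induction_axiom \<phi> |\<phi>. Sigma1 \<phi>}
      \<union> {comprehension_axiom \<phi> \<psi> |\<phi> \<psi>. Sigma1 \<phi> \<and> Pi1 \<psi>})"

section \<open>Thin sets\<close>

text \<open>
  Pairs are coded by \<open>(s + t)\<^sup>2 + s\<close>, which is injective.
  Inside \<open>k\<close> quantifiers, the tuple \<open>x\<^sub>1, \<dots>, x\<^sub>k\<close> consists of the variables
  \<open>Var (k-1), \<dots>, Var 0\<close>, outermost first, and is coded by iterated pairing.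
\<close>

definition pr :: "tm \<Rightarrow> tm \<Rightarrow> tm"
  where "pr s t = (s \<^bold>+ t) \<^bold>* (s \<^bold>+ t) \<^bold>+ s"

fun tuple :: "nat \<Rightarrow> tm" where
  "tuple 0 = \<^bold>0"
| "tuple (Suc 0) = Var 0"
| "tuple (Suc (Suc k)) = pr (Var (Suc k)) (tuple (Suc k))"

fun increasing :: "nat \<Rightarrow> fm" where
  "increasing (Suc (Suc k)) = (Var (Suc k) \<^bold>< Var k \<^bold>\<and> increasing (Suc k))"
| "increasing k = Top"

primrec all_in :: "nat \<Rightarrow> nat \<Rightarrow> fm" where
  "all_in 0 A = Top"
| "all_in (Suc k) A = (Var k \<^bold>\<in> A \<^bold>\<and> all_in k A)"

text \<open>\<open>F\<close> is (the graph of) a function $[\mathbb{N}]^k \to \mathbb{N}$.\<close>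

definition is_function :: "nat \<Rightarrow> nat \<Rightarrow> fm"
  where "is_function k F =
    (Forall (Var 0 \<^bold>\<in> F \<^bold>\<longrightarrow>
        (Exists ^^ k) (increasing k \<^bold>\<and> Exists (Var (k + 1) \<^bold>= pr (tuple k \<up> 1) (Var 0))))
     \<^bold>\<and> (Forall ^^ k) (increasing k \<^bold>\<longrightarrow>
        Exists (pr (tuple k \<up> 1) (Var 0) \<^bold>\<in> F
          \<^bold>\<and> Forall (pr (tuple k \<up> 2) (Var 0) \<^bold>\<in> F \<^bold>\<longrightarrow> Var 0 \<^bold>= Var 1))))"

definition infinite_set :: "nat \<Rightarrow> fm"
  where "infinite_set A = Forall (Exists (Var 1 \<^bold>< Var 0 \<^bold>\<and> Var 0 \<^bold>\<in> A))"

definition thin :: "nat \<Rightarrow> nat \<Rightarrow> nat \<Rightarrow> fm"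
  where "thin k F A =
    Exists ((Forall ^^ k) (increasing k \<^bold>\<and> all_in k A \<^bold>\<longrightarrow> \<^bold>\<not> pr (tuple k) (Var k) \<^bold>\<in> F))"

definition TS :: "nat \<Rightarrow> fm"
  where "TS k = ForallS (is_function k 0 \<^bold>\<longrightarrow> ExistsS (infinite_set 0 \<^bold>\<and> thin k 1 0))"

section \<open>Relative computations\<close>

text \<open>
  A number \<open>c = (l, (m, n))\<close> codes the finite set of all \<open>i < l\<close> such that \<open>m (i + 1) + 1\<close>
  divides \<open>n\<close>. Every finite set has such a code.
\<close>

primrec BExists_block :: "nat \<Rightarrow> tm \<Rightarrow> fm \<Rightarrow> fm" where
  "BExists_block 0 t \<phi> = \<phi>"
| "BExists_block (Suc n) t \<phi> = BExists t (BExists_block n (t \<up> 1) \<phi>)"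

definition in_code :: "tm \<Rightarrow> tm \<Rightarrow> fm"
  where "in_code i c =
    BExists_block 3 (c \<^bold>+ \<^bold>1)
      (c \<up> 3 \<^bold>= pr (Var 2) (pr (Var 1) (Var 0))
       \<^bold>\<and> i \<up> 3 \<^bold>< Var 2
       \<^bold>\<and> BExists (Var 0 \<^bold>+ \<^bold>1) (Var 0 \<^bold>* (Var 2 \<^bold>* (i \<up> 4 \<^bold>+ \<^bold>1) \<^bold>+ \<^bold>1) \<^bold>= Var 1))"

primrec numeral_tm :: "nat \<Rightarrow> tm" where
  "numeral_tm 0 = \<^bold>0"
| "numeral_tm (Suc n) = numeral_tm n \<^bold>+ \<^bold>1"

definition index_tm :: "nat \<Rightarrow> tm \<Rightarrow> tm"
  where "index_tm i a = pr (numeral_tm i) a"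

text \<open>
  Partial recursive functions of one argument, with an oracle, are indexed by numbers
  as in Kleene's definition; binary functions take a pair as argument.
  The indices \<open>(i, 0)\<close> for \<open>i = 0, \<dots>, 5\<close> denote zero, successor, identity,
  the two projections (defined on pairs only) and the characteristic function of the oracle.
  \<open>(6, (a, b))\<close> is the composition of \<open>a\<close> after \<open>b\<close>,
  \<open>(7, (a, b))\<close> maps \<open>x\<close> to the pair of the values of \<open>a\<close> and \<open>b\<close> at \<open>x\<close>,
  \<open>(8, (a, b))\<close> is primitive recursion on the second component of the argument, and
  \<open>(9, a)\<close> is minimization. All other indices denote the nowhere defined function.

  A computation is a finite set \<open>d\<close> of triples \<open>(e, (x, y))\<close>, each stating that the function
  with index \<open>e\<close> has value \<open>y\<close> at \<open>x\<close>, in which every triple is justified by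
  a defining clause and other triples of \<open>d\<close>. The justification is well-founded since it refers
  to indices smaller than \<open>e\<close>, or to \<open>e\<close> with a smaller recursion argument.
\<close>

definition value_in :: "tm \<Rightarrow> tm \<Rightarrow> tm \<Rightarrow> tm \<Rightarrow> fm"
  where "value_in d e x y = in_code (pr e (pr x y)) d"

text \<open>\<open>h\<close> codes the finite part of the oracle.\<close>

definition justified :: "tm \<Rightarrow> tm \<Rightarrow> tm \<Rightarrow> tm \<Rightarrow> tm \<Rightarrow> fm"
  where "justified h d e x y =
    ((e \<^bold>= index_tm 0 \<^bold>0 \<^bold>\<and> y \<^bold>= \<^bold>0)
   \<^bold>\<or> (e \<^bold>= index_tm 1 \<^bold>0 \<^bold>\<and> y \<^bold>= x \<^bold>+ \<^bold>1)
   \<^bold>\<or> (e \<^bold>= index_tm 2 \<^bold>0 \<^bold>\<and> y \<^bold>= x)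
   \<^bold>\<or> (e \<^bold>= index_tm 3 \<^bold>0 \<^bold>\<and> BExists d (x \<up> 1 \<^bold>= pr (y \<up> 1) (Var 0)))
   \<^bold>\<or> (e \<^bold>= index_tm 4 \<^bold>0 \<^bold>\<and> BExists d (x \<up> 1 \<^bold>= pr (Var 0) (y \<up> 1)))
   \<^bold>\<or> (e \<^bold>= index_tm 5 \<^bold>0 \<^bold>\<and> ((in_code x h \<^bold>\<and> y \<^bold>= \<^bold>1) \<^bold>\<or> (\<^bold>\<not> in_code x h \<^bold>\<and> y \<^bold>= \<^bold>0)))
   \<^bold>\<or> BExists_block 3 d
       (e \<up> 3 \<^bold>= index_tm 6 (pr (Var 2) (Var 1))
        \<^bold>\<and> value_in (d \<up> 3) (Var 1) (x \<up> 3) (Var 0)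
        \<^bold>\<and> value_in (d \<up> 3) (Var 2) (Var 0) (y \<up> 3))
   \<^bold>\<or> BExists_block 4 d
       (e \<up> 4 \<^bold>= index_tm 7 (pr (Var 3) (Var 2))
        \<^bold>\<and> y \<up> 4 \<^bold>= pr (Var 1) (Var 0)
        \<^bold>\<and> value_in (d \<up> 4) (Var 3) (x \<up> 4) (Var 1)
        \<^bold>\<and> value_in (d \<up> 4) (Var 2) (x \<up> 4) (Var 0))
   \<^bold>\<or> BExists_block 3 d
       (e \<up> 3 \<^bold>= index_tm 8 (pr (Var 2) (Var 1))
        \<^bold>\<and> ((x \<up> 3 \<^bold>= pr (Var 0) \<^bold>0 \<^bold>\<and> value_in (d \<up> 3) (Var 2) (Var 0) (y \<up> 3))
          \<^bold>\<or> BExists_block 2 (d \<up> 3)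
              (x \<up> 5 \<^bold>= pr (Var 2) (Var 1 \<^bold>+ \<^bold>1)
               \<^bold>\<and> value_in (d \<up> 5) (e \<up> 5) (pr (Var 2) (Var 1)) (Var 0)
               \<^bold>\<and> value_in (d \<up> 5) (Var 3) (pr (Var 2) (pr (Var 1) (Var 0))) (y \<up> 5))))
   \<^bold>\<or> BExists d
       (e \<up> 1 \<^bold>= index_tm 9 (Var 0)
        \<^bold>\<and> value_in (d \<up> 1) (Var 0) (pr (x \<up> 1) (y \<up> 1)) \<^bold>0
        \<^bold>\<and> BForall (y \<up> 1)
            (BExists (d \<up> 2)
              (value_in (d \<up> 3) (Var 2) (pr (x \<up> 3) (Var 1)) (Var 0 \<^bold>+ \<^bold>1)))))"

definition computation :: "tm \<Rightarrow> tm \<Rightarrow> fm"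
  where "computation h d =
    BForall d (BForall (d \<up> 1) (BForall (d \<up> 2)
      (value_in (d \<up> 3) (Var 2) (Var 1) (Var 0)
        \<^bold>\<longrightarrow> justified (h \<up> 3) (d \<up> 3) (Var 2) (Var 1) (Var 0))))"

text \<open>
  \<open>Phi Y e x y\<close> states that the \<open>e\<close>-th function partial recursive in \<open>Y\<close> has value \<open>y\<close> at \<open>x\<close>:
  there are a number \<open>s\<close>, a code \<open>h\<close> of \<open>Y\<close> restricted to numbers below \<open>s\<close>,
  and a computation \<open>d < s\<close> from \<open>h\<close> that yields this value. As \<open>d < s\<close>, all numbers occurring
  in \<open>d\<close>, in particular all oracle queries, are below \<open>s\<close>.
  The oracle is given by a formula \<open>Y t\<close> expressing membership of \<open>t\<close>, without other free
  number variables, because it need not exist as a set in $\mathsf{RCA}_0$.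
\<close>

definition Phi :: "(tm \<Rightarrow> fm) \<Rightarrow> tm \<Rightarrow> tm \<Rightarrow> tm \<Rightarrow> fm"
  where "Phi Y e x y =
    Exists (Exists (Exists
      (BForall (Var 2) (in_code (Var 0) (Var 2) \<^bold>\<longleftrightarrow> Y (Var 0))
       \<^bold>\<and> Var 0 \<^bold>< Var 2
       \<^bold>\<and> computation (Var 1) (Var 0)
       \<^bold>\<and> value_in (Var 0) (e \<up> 3) (x \<up> 3) (y \<up> 3))))"

text \<open>\<open>jump k X t\<close> states that \<open>t\<close> belongs to the \<open>k\<close>-th Turing jump of the set \<open>X\<close>.\<close>

primrec jump :: "nat \<Rightarrow> nat \<Rightarrow> tm \<Rightarrow> fm" where
  "jump 0 X = (\<lambda>t. t \<^bold>\<in> X)"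
| "jump (Suc k) X = (\<lambda>t. Exists (Phi (jump k X) (t \<up> 1) (t \<up> 1) (Var 0)))"

definition dnc :: "nat \<Rightarrow> (tm \<Rightarrow> fm) \<Rightarrow> fm"
  where "dnc F Y =
    Forall (Forall (pr (Var 1) (Var 0) \<^bold>\<in> F \<^bold>\<longrightarrow> \<^bold>\<not> Phi Y (Var 1) (Var 1) (Var 0)))"

definition DNR_jump :: "nat \<Rightarrow> fm"
  where "DNR_jump k = ForallS (ExistsS (is_function 1 0 \<^bold>\<and> dnc 0 (jump k 1)))"

end

(*
By completeness it suffices to argue in an arbitrary model of RCA0. Let A be thin for a coloring f of (k+1)-tuples,
omitting the color i. A function g is obtained by letting g(e) code the first suitable sequence of (e, i) + 1
distinct elements of A. For this f is built such that, whenever the e-th function relative to the k-th jump sends e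
to a sequence of (e, i) + 1 distinct numbers, some value x of it satisfies f(x, x_1, ..., x_k) = i for
all sufficiently large x_1, all sufficiently large x_2, and so on. Here f evaluates the functions relative to the k-th
jump by means of its approximation from x_1, ..., x_k, and since a sequence is longer than the number of requirements of
higher priority, the colors can be assigned without conflict.

That the iterated approximation converges needs bounding for Sigma_k formulas, which RCA0 does not prove. In its
place we use that initial segments of the jumps are coded: a computation only exists relative to a coded initial
segment of its oracle that is longer than the computed value. So if the k-th jump is not coded below b, then
the constant function b is diagonally non-computable; and if a lower jump is not coded below b, then the next
one is bounded by b. If initial segments of Y and of its jump are coded, then the jump of Y decides bounded parts
of sets that are Sigma_1 in Y, because enough functions have indices, and bounding follows by induction.
*)
theory Submission
  imports Defs "HOL-Library.Countable_Set"
begin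

section \<open>Completeness of the deduction system\<close>

text \<open>Requirements are pairs \<open>(e, i)\<close> because the omitted color is known only
  after the coloring is fixed. The requirement with code \<open>r\<close> asks for
  \<open>r + 1\<close> distinct values, while at most \<open>r\<close> values are taken by those
  before it. Two restrictions of RCA0 shape everything else. The coloring has to be a set: the color
  of \<open>(x, x_1, ..., x_k)\<close> looks only at requirements and computations below
  \<open>x_1\<close>, where \<open>x_1\<close> bounds the search for the top jump,
  \<open>x_2\<close> that for the jump below it, and so on. And only Sigma_1 induction is available,
  also for counting, for coding finite sets and for running computations; so each such induction
  carries a code as its existential witness and bounds all other quantifiers. A jump need not be a
  set, so it enters these formulas only through codes of its initial segments. When a jump lacks
  such codes but the next one has them, the next one is a bounded set and replaces \<open>X\<close>;
  hence the number \<open>j\<close> of jumps to approximate may be smaller than \<open>k\<close>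
  while the coloring keeps \<open>k + 1\<close> arguments.\<close>

instance tm :: countable by countable_datatype
text \<open>The Henkin construction treats all formulas one by one along this enumeration.\<close>

instance fm :: countable by countable_datatype

section \<open>Calculus of substitution and renaming\<close>

abbreviation up :: "(nat \<Rightarrow> tm) \<Rightarrow> nat \<Rightarrow> tm"
  where "up \<sigma> \<equiv> case_nat (Var 0) (\<lambda>i. \<sigma> i \<up> 1)"

abbreviation upS :: "(nat \<Rightarrow> nat) \<Rightarrow> nat \<Rightarrow> nat"
  where "upS \<rho> \<equiv> case_nat 0 (\<lambda>i. Suc (\<rho> i))"

lemma subst_tm_comp: "subst_tm \<sigma> (subst_tm \<tau> t) = subst_tm (\<lambda>i. subst_tm \<sigma> (\<tau> i)) t"
  by (induction t) auto

lemma subst_tm_Var [simp]: "subst_tm Var t = t"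
  by (induction t) auto

lemma subst_tm_up_lift: "subst_tm (up \<sigma>) (t \<up> 1) = subst_tm \<sigma> t \<up> 1"
  by (simp add: lift_def subst_tm_comp)

lemma up_comp: "(\<lambda>i. subst_tm (up \<sigma>) (up \<tau> i)) = up (\<lambda>i. subst_tm \<sigma> (\<tau> i))"
  by (rule ext) (simp add: subst_tm_up_lift[simplified] split: nat.split)

lemma subst_comp: "subst \<sigma> (subst \<tau> \<phi>) = subst (\<lambda>i. subst_tm \<sigma> (\<tau> i)) \<phi>"
proof (induction \<phi> arbitrary: \<sigma> \<tau>)
  case (Forall \<phi>)
  then show ?case by (simp only: subst.simps up_comp)
qed (auto simp: subst_tm_comp)

lemma up_Var: "up Var = Var"
  by (rule ext) (simp add: lift_def split: nat.split)

lemma subst_Var [simp]: "subst Var \<phi> = \<phi>"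
  by (induction \<phi>) (simp_all only: subst.simps up_Var subst_tm_Var)

lemma upS_comp: "upS \<rho> \<circ> upS \<tau> = upS (\<rho> \<circ> \<tau>)"
  by (rule ext) (simp split: nat.split)

lemma rename_comp: "rename \<rho> (rename \<tau> \<phi>) = rename (\<rho> \<circ> \<tau>) \<phi>"
proof (induction \<phi> arbitrary: \<rho> \<tau>)
  case (ForallS \<phi>)
  then show ?case by (simp only: rename.simps upS_comp)
qed auto

lemma subst_rename: "subst \<sigma> (rename \<rho> \<phi>) = rename \<rho> (subst \<sigma> \<phi>)"
  by (induction \<phi> arbitrary: \<sigma> \<rho>) auto

lemma subst_inst: "subst \<sigma> (inst t \<phi>) = inst (subst_tm \<sigma> t) (subst (up \<sigma>) \<phi>)"
  unfolding inst_def subst_comp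
  by (rule arg_cong2[of _ _ _ _ subst])
    (auto simp: lift_def subst_tm_comp fun_eq_iff split: nat.split)

lemma subst_wk: "subst (up \<sigma>) (wk \<phi>) = wk (subst \<sigma> \<phi>)"
  by (simp add: wk_def subst_comp lift_def)

lemma rename_instS: "rename \<rho> (instS X \<phi>) = instS (\<rho> X) (rename (upS \<rho>) \<phi>)"
  unfolding instS_def rename_comp
  by (rule arg_cong2[of _ _ _ _ rename]) (auto simp: fun_eq_iff split: nat.split)

lemma rename_wkS: "rename (upS \<rho>) (wkS \<phi>) = wkS (rename \<rho> \<phi>)"
  by (simp add: wkS_def rename_comp comp_def)

lemma subst_wkS: "subst \<sigma> (wkS \<phi>) = wkS (subst \<sigma> \<phi>)"
  by (simp add: wkS_def subst_rename)

lemma rename_wk: "rename \<rho> (wk \<phi>) = wk (rename \<rho> \<phi>)"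
  by (simp add: wk_def subst_rename)

lemma subst_instS: "subst \<sigma> (instS X \<phi>) = instS X (subst \<sigma> \<phi>)"
  by (simp add: instS_def subst_rename)

lemma rename_inst: "rename \<rho> (inst t \<phi>) = inst t (rename \<rho> \<phi>)"
  by (simp add: inst_def subst_rename)

lemma subst_Neg [simp]: "subst \<sigma> (\<^bold>\<not> \<phi>) = (\<^bold>\<not> subst \<sigma> \<phi>)"
  by (simp add: Neg_def)

lemma rename_Neg [simp]: "rename \<rho> (\<^bold>\<not> \<phi>) = (\<^bold>\<not> rename \<rho> \<phi>)"
  by (simp add: Neg_def)

section \<open>Structural properties of derivations\<close>

lemma weakening: "\<Gamma> \<turnstile> \<phi> \<Longrightarrow> \<Gamma> \<subseteq> \<Delta> \<Longrightarrow> \<Delta> \<turnstile> \<phi>"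
proof (induction arbitrary: \<Delta> rule: proves.induct)
  case (ImpI \<phi> \<Gamma> \<psi>)
  then show ?case by (meson insert_mono proves.ImpI)
next
  case (Raa \<phi> \<Gamma>)
  then show ?case by (meson insert_mono proves.Raa)
next
  case (ForallI \<Gamma> \<phi>)
  then show ?case by (meson image_mono proves.ForallI)
next
  case (ForallSI \<Gamma> \<phi>)
  then show ?case by (meson image_mono proves.ForallSI)
qed (blast intro: proves.intros)+

text \<open>Applying one substitution to the context and the conclusion lets the induction pass
  through \<open>ForallI\<close>: there \<open>up \<sigma>\<close> is used, and it commutes with the
  shift \<open>wk\<close> of the context. The lemma later renames a fresh variable to index
  0.\<close>

lemma proves_subst: "\<Gamma> \<turnstile> \<phi> \<Longrightarrow> subst \<sigma> ` \<Gamma> \<turnstile> subst \<sigma> \<phi>"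
proof (induction arbitrary: \<sigma> rule: proves.induct)
  case (ImpI \<phi> \<Gamma> \<psi>)
  from ImpI.IH[of \<sigma>] show ?case by (simp add: proves.ImpI)
next
  case (Raa \<phi> \<Gamma>)
  from Raa.IH[of \<sigma>] show ?case by (simp add: proves.Raa)
next
  case (ForallI \<Gamma> \<phi>)
  from ForallI.IH[of "up \<sigma>"] have "wk ` subst \<sigma> ` \<Gamma> \<turnstile> subst (up \<sigma>) \<phi>"
    by (simp only: image_image subst_wk)
  then show ?case by (simp add: proves.ForallI)
next
  case (ForallSI \<Gamma> \<phi>)
  from ForallSI.IH[of \<sigma>] have "wkS ` subst \<sigma> ` \<Gamma> \<turnstile> subst \<sigma> \<phi>"
    by (simp add: image_image subst_wkS)
  then show ?case by (simp add: proves.ForallSI)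
next
  case (ForallE \<Gamma> \<phi> t)
  from ForallE.IH[of \<sigma>] show ?case by (simp only: subst_inst subst.simps proves.ForallE)
next
  case (ForallSE \<Gamma> \<phi> X)
  from ForallSE.IH[of \<sigma>] show ?case by (simp only: subst_instS subst.simps proves.ForallSE)
next
  case (EqSubst \<Gamma> s t \<phi>)
  from EqSubst.IH[of \<sigma>] show ?case unfolding subst_inst subst.simps by (rule proves.EqSubst)
qed (auto intro: proves.intros)

lemma proves_rename: "\<Gamma> \<turnstile> \<phi> \<Longrightarrow> rename \<rho> ` \<Gamma> \<turnstile> rename \<rho> \<phi>"
proof (induction arbitrary: \<rho> rule: proves.induct)
  case (ImpI \<phi> \<Gamma> \<psi>)
  from ImpI.IH[of \<rho>] show ?case by (simp add: proves.ImpI)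
next
  case (Raa \<phi> \<Gamma>)
  from Raa.IH[of \<rho>] show ?case by (simp add: proves.Raa)
next
  case (ForallI \<Gamma> \<phi>)
  from ForallI.IH[of \<rho>] have "wk ` rename \<rho> ` \<Gamma> \<turnstile> rename \<rho> \<phi>"
    by (simp only: image_image rename_wk)
  then show ?case by (simp add: proves.ForallI)
next
  case (ForallSI \<Gamma> \<phi>)
  from ForallSI.IH[of "upS \<rho>"] have "wkS ` rename \<rho> ` \<Gamma> \<turnstile> rename (upS \<rho>) \<phi>"
    by (simp only: image_image rename_wkS)
  then show ?case by (simp add: proves.ForallSI)
next
  case (ForallE \<Gamma> \<phi> t)
  from ForallE.IH[of \<rho>] show ?case by (simp only: rename_inst rename.simps proves.ForallE)
next
  case (ForallSE \<Gamma> \<phi> X)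
  from ForallSE.IH[of \<rho>] show ?case by (simp only: rename_instS rename.simps proves.ForallSE)
next
  case (EqSubst \<Gamma> s t \<phi>)
  from EqSubst.IH[of \<rho>] show ?case unfolding rename_inst rename.simps by (rule proves.EqSubst)
qed (auto intro: proves.intros)

lemma proves_finite: "\<Gamma> \<turnstile> \<phi> \<Longrightarrow> \<exists>\<Delta>\<subseteq>\<Gamma>. finite \<Delta> \<and> (\<Delta> \<turnstile> \<phi>)"
proof (induction rule: proves.induct)
  case (Assm \<phi> \<Gamma>)
  then show ?case by (intro exI[of _ "{\<phi>}"]) (simp add: proves.Assm)
next
  case (ImpI \<phi> \<Gamma> \<psi>)
  then obtain \<Delta> where "\<Delta> \<subseteq> insert \<phi> \<Gamma>" "finite \<Delta>" "\<Delta> \<turnstile> \<psi>" by blast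
  moreover have "insert \<phi> (\<Delta> - {\<phi>}) \<turnstile> \<psi>" by (rule weakening[OF \<open>\<Delta> \<turnstile> \<psi>\<close>]) auto
  ultimately show ?case by (intro exI[of _ "\<Delta> - {\<phi>}"]) (auto intro: proves.ImpI)
next
  case (ImpE \<Gamma> \<phi> \<psi>)
  then obtain \<Delta> \<Delta>' where "\<Delta> \<subseteq> \<Gamma>" "finite \<Delta>" "\<Delta> \<turnstile> \<phi> \<^bold>\<longrightarrow> \<psi>" "\<Delta>' \<subseteq> \<Gamma>" "finite \<Delta>'" "\<Delta>' \<turnstile> \<phi>"
    by blast
  then show ?case
    by (intro exI[of _ "\<Delta> \<union> \<Delta>'"])
      (auto intro!: proves.ImpE[of "\<Delta> \<union> \<Delta>'" \<phi> \<psi>] intro: weakening[OF _ Un_upper1] weakening[OF _ Un_upper2])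
next
  case (Raa \<phi> \<Gamma>)
  then obtain \<Delta> where "\<Delta> \<subseteq> insert (\<^bold>\<not> \<phi>) \<Gamma>" "finite \<Delta>" "\<Delta> \<turnstile> Bot" by blast
  moreover have "insert (\<^bold>\<not> \<phi>) (\<Delta> - {\<^bold>\<not> \<phi>}) \<turnstile> Bot" by (rule weakening[OF \<open>\<Delta> \<turnstile> Bot\<close>]) auto
  ultimately show ?case by (intro exI[of _ "\<Delta> - {\<^bold>\<not> \<phi>}"]) (auto intro: proves.Raa)
next
  case (ForallI \<Gamma> \<phi>)
  then obtain \<Delta> where "\<Delta> \<subseteq> wk ` \<Gamma>" "finite \<Delta>" "\<Delta> \<turnstile> \<phi>" by blast
  then show ?case by (metis finite_subset_image proves.ForallI)
next
  case (ForallSI \<Gamma> \<phi>)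
  then obtain \<Delta> where "\<Delta> \<subseteq> wkS ` \<Gamma>" "finite \<Delta>" "\<Delta> \<turnstile> \<phi>" by blast
  then show ?case by (metis finite_subset_image proves.ForallSI)
next
  case (EqSubst \<Gamma> s t \<phi>)
  then obtain \<Delta> \<Delta>' where "\<Delta> \<subseteq> \<Gamma>" "finite \<Delta>" "\<Delta> \<turnstile> s \<^bold>= t" "\<Delta>' \<subseteq> \<Gamma>" "finite \<Delta>'" "\<Delta>' \<turnstile> inst s \<phi>"
    by blast
  then show ?case
    by (intro exI[of _ "\<Delta> \<union> \<Delta>'"])
      (auto intro!: proves.EqSubst[of "\<Delta> \<union> \<Delta>'" s t \<phi>] intro: weakening[OF _ Un_upper1] weakening[OF _ Un_upper2])
next
  case (ForallE \<Gamma> \<phi> t)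
  then show ?case by (meson proves.ForallE)
next
  case (ForallSE \<Gamma> \<phi> X)
  then show ?case by (meson proves.ForallSE)
next
  case (EqRefl \<Gamma> t)
  show ?case by (meson proves.EqRefl empty_subsetI finite.emptyI)
qed

lemma subst_tm_cong: "bound_tm t \<le> n \<Longrightarrow> (\<forall>i<n. \<sigma> i = \<tau> i) \<Longrightarrow> subst_tm \<sigma> t = subst_tm \<tau> t"
  by (induction t) auto

lemma subst_cong: "bound \<phi> \<le> n \<Longrightarrow> (\<forall>i<n. \<sigma> i = \<tau> i) \<Longrightarrow> subst \<sigma> \<phi> = subst \<tau> \<phi>"
proof (induction \<phi> arbitrary: n \<sigma> \<tau>)
  case (Forall \<phi>)
  have "subst (up \<sigma>) \<phi> = subst (up \<tau>) \<phi>"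
    by (rule Forall.IH[of "Suc n"]) (use Forall.prems in \<open>auto split: nat.split\<close>)
  then show ?case by simp
next
  case (Imp \<phi> \<psi>)
  have "subst \<sigma> \<phi> = subst \<tau> \<phi>" by (rule Imp.IH(1)[of n]) (use Imp.prems in auto)
  moreover have "subst \<sigma> \<psi> = subst \<tau> \<psi>" by (rule Imp.IH(2)[of n]) (use Imp.prems in auto)
  ultimately show ?case by simp
next
  case (ForallS \<phi>)
  have "subst \<sigma> \<phi> = subst \<tau> \<phi>" by (rule ForallS.IH[of n]) (use ForallS.prems in auto)
  then show ?case by simp
qed (auto intro: subst_tm_cong)

lemma rename_cong: "boundS \<phi> \<le> n \<Longrightarrow> (\<forall>i<n. \<sigma> i = \<tau> i) \<Longrightarrow> rename \<sigma> \<phi> = rename \<tau> \<phi>"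
proof (induction \<phi> arbitrary: n \<sigma> \<tau>)
  case (ForallS \<phi>)
  have "rename (upS \<sigma>) \<phi> = rename (upS \<tau>) \<phi>"
    by (rule ForallS.IH[of "Suc n"]) (use ForallS.prems in \<open>auto split: nat.split\<close>)
  then show ?case by simp
next
  case (Imp \<phi> \<psi>)
  have "rename \<sigma> \<phi> = rename \<tau> \<phi>" by (rule Imp.IH(1)[of n]) (use Imp.prems in auto)
  moreover have "rename \<sigma> \<psi> = rename \<tau> \<psi>" by (rule Imp.IH(2)[of n]) (use Imp.prems in auto)
  ultimately show ?case by simp
next
  case (Forall \<phi>)
  have "rename \<sigma> \<phi> = rename \<tau> \<phi>" by (rule Forall.IH[of n]) (use Forall.prems in auto)
  then show ?case by simp
qed simp_all

text \<open>Variables above all free indices of the context play the role of Henkin constants. The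
  substitution that sends \<open>c\<close> to index 0 and shifts the other variables acts on the
  context as \<open>wk\<close> and recovers \<open>\<phi>\<close> from its instance, so that
  \<open>ForallI\<close> applies.\<close>

lemma generalize:
  assumes "\<Gamma> \<turnstile> inst (Var c) \<phi>" and \<Gamma>: "\<And>\<psi>. \<psi> \<in> \<Gamma> \<Longrightarrow> bound \<psi> \<le> c" and "bound \<phi> \<le> Suc c"
  shows "\<Gamma> \<turnstile> Forall \<phi>"
proof -
  let ?\<sigma> = "\<lambda>i. if i = c then Var 0 else Var (Suc i)"
  have "subst ?\<sigma> \<psi> = wk \<psi>" if "\<psi> \<in> \<Gamma>" for \<psi>
    unfolding wk_def by (rule subst_cong[OF \<Gamma>[OF that]]) auto
  then have "subst ?\<sigma> ` \<Gamma> = wk ` \<Gamma>" by (rule image_cong[OF refl])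
  moreover have "subst ?\<sigma> (inst (Var c) \<phi>) = subst Var \<phi>"
    unfolding inst_def subst_comp
    by (rule subst_cong[OF assms(3)]) (auto split: nat.split)
  ultimately have "wk ` \<Gamma> \<turnstile> \<phi>" using proves_subst[OF assms(1), of ?\<sigma>] by simp
  then show ?thesis by (rule proves.ForallI)
qed

lemma generalizeS:
  assumes "\<Gamma> \<turnstile> instS c \<phi>" and \<Gamma>: "\<And>\<psi>. \<psi> \<in> \<Gamma> \<Longrightarrow> boundS \<psi> \<le> c" and "boundS \<phi> \<le> Suc c"
  shows "\<Gamma> \<turnstile> ForallS \<phi>"
proof -
  let ?\<sigma> = "\<lambda>i. if i = c then 0 else Suc i"
  have "rename ?\<sigma> \<psi> = wkS \<psi>" if "\<psi> \<in> \<Gamma>" for \<psi>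
    unfolding wkS_def by (rule rename_cong[OF \<Gamma>[OF that]]) auto
  then have "rename ?\<sigma> ` \<Gamma> = wkS ` \<Gamma>" by (rule image_cong[OF refl])
  moreover have "rename ?\<sigma> (instS c \<phi>) = rename (\<lambda>i. i) \<phi>"
    unfolding instS_def rename_comp
    by (rule rename_cong[OF assms(3)]) (auto split: nat.split)
  moreover have "rename (\<lambda>i. i) \<phi> = \<phi>" for \<phi>
  proof -
    have "upS (\<lambda>i. i) = (\<lambda>i. i)" by (auto split: nat.split)
    then show ?thesis by (induction \<phi>) auto
  qed
  ultimately have "wkS ` \<Gamma> \<turnstile> \<phi>" using proves_rename[OF assms(1), of ?\<sigma>] by simp
  then show ?thesis by (rule proves.ForallSI)
qed

lemma NegE: "\<Gamma> \<turnstile> \<^bold>\<not> \<phi> \<Longrightarrow> \<Gamma> \<turnstile> \<phi> \<Longrightarrow> \<Gamma> \<turnstile> Bot"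
  unfolding Neg_def by (rule proves.ImpE)

lemma NegI: "insert \<phi> \<Gamma> \<turnstile> Bot \<Longrightarrow> \<Gamma> \<turnstile> \<^bold>\<not> \<phi>"
  unfolding Neg_def by (rule proves.ImpI)

lemma cut: "insert \<phi> \<Gamma> \<turnstile> \<psi> \<Longrightarrow> \<Gamma> \<turnstile> \<phi> \<Longrightarrow> \<Gamma> \<turnstile> \<psi>"
  by (blast intro: proves.ImpI proves.ImpE)

section \<open>Henkin extensions\<close>

definition bounded_by :: "nat \<Rightarrow> fm set \<Rightarrow> bool"
  where "bounded_by c \<Gamma> \<longleftrightarrow> (\<forall>\<psi>\<in>\<Gamma>. bound \<psi> \<le> c \<and> boundS \<psi> \<le> c)"

text \<open>The common bound on the free indices guarantees a fresh variable at every stage;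
  witnesses are thus taken from the variables of the language itself.\<close>

definition admissible :: "fm set \<Rightarrow> bool"
  where "admissible \<Gamma> \<longleftrightarrow> (\<exists>c. bounded_by c \<Gamma>) \<and> \<not> (\<Gamma> \<turnstile> Bot)"

definition witnessed :: "fm \<Rightarrow> fm set \<Rightarrow> bool"
  where "witnessed \<phi> \<Gamma> \<longleftrightarrow>
    (\<forall>\<psi>. \<phi> = (\<^bold>\<not> Forall \<psi>) \<longrightarrow> (\<exists>c. (\<^bold>\<not> inst (Var c) \<psi>) \<in> \<Gamma>)) \<and>
    (\<forall>\<psi>. \<phi> = (\<^bold>\<not> ForallS \<psi>) \<longrightarrow> (\<exists>c. (\<^bold>\<not> instS c \<psi>) \<in> \<Gamma>))"

lemma bounded_by_insert: "bounded_by c \<Gamma> \<Longrightarrow> \<exists>c. bounded_by c (insert \<phi> \<Gamma>)"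
  unfolding bounded_by_def
  by (intro exI[of _ "max c (max (bound \<phi>) (boundS \<phi>))"]) (auto simp: max_def)

lemma Neg_inject [simp]: "(\<^bold>\<not> \<phi>) = (\<^bold>\<not> \<psi>) \<longleftrightarrow> \<phi> = \<psi>"
  by (simp add: Neg_def)

lemma bound_Neg [simp]: "bound (\<^bold>\<not> \<phi>) = bound \<phi>" "boundS (\<^bold>\<not> \<phi>) = boundS \<phi>"
  by (simp_all add: Neg_def)

lemma admissible_extend:
  assumes "admissible \<Gamma>"
  shows "\<exists>\<Delta>. admissible \<Delta> \<and> \<Gamma> \<subseteq> \<Delta> \<and> ((insert \<phi> \<Gamma> \<turnstile> Bot) \<or> \<phi> \<in> \<Delta> \<and> witnessed \<phi> \<Delta>)"
proof (cases "insert \<phi> \<Gamma> \<turnstile> Bot")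
  case True
  then show ?thesis using assms by blast
next
  case False
  \<comment> \<open>\<open>c\<close> lies above the free number and set indices of the context and
    of \<open>\<phi>\<close>, so it can name a witness of either sort.\<close>
  obtain c where c: "bounded_by c (insert \<phi> \<Gamma>)"
    using assms bounded_by_insert unfolding admissible_def by metis
  let ?\<Gamma> = "insert \<phi> \<Gamma>"
  have adm: "admissible ?\<Gamma>" using False c unfolding admissible_def by blast
  consider \<psi> where "\<phi> = (\<^bold>\<not> Forall \<psi>)" | \<psi> where "\<phi> = (\<^bold>\<not> ForallS \<psi>)"
    | "\<And>\<psi>. \<phi> \<noteq> (\<^bold>\<not> Forall \<psi>)" "\<And>\<psi>. \<phi> \<noteq> (\<^bold>\<not> ForallS \<psi>)" by blast
  then show ?thesis
  proof cases
    case 1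
    let ?\<Delta> = "insert (\<^bold>\<not> inst (Var c) \<psi>) ?\<Gamma>"
    have "\<not> (?\<Delta> \<turnstile> Bot)"
    proof
      assume "?\<Delta> \<turnstile> Bot"
      then have "?\<Gamma> \<turnstile> inst (Var c) \<psi>" by (rule proves.Raa)
      then have "?\<Gamma> \<turnstile> Forall \<psi>"
        by (rule generalize) (use c 1 in \<open>auto simp: bounded_by_def\<close>)
      moreover have "?\<Gamma> \<turnstile> \<^bold>\<not> Forall \<psi>" using 1 by (simp add: proves.Assm)
      ultimately show False using False NegE by blast
    qed
    then have "admissible ?\<Delta>" using bounded_by_insert[OF c] unfolding admissible_def by blast
    then show ?thesis using 1 unfolding witnessed_def
      by (intro exI[of _ ?\<Delta>]) (auto simp: Neg_def)
  next
    case 2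
    let ?\<Delta> = "insert (\<^bold>\<not> instS c \<psi>) ?\<Gamma>"
    have "\<not> (?\<Delta> \<turnstile> Bot)"
    proof
      assume "?\<Delta> \<turnstile> Bot"
      then have "?\<Gamma> \<turnstile> instS c \<psi>" by (rule proves.Raa)
      then have "?\<Gamma> \<turnstile> ForallS \<psi>"
        by (rule generalizeS) (use c 2 in \<open>auto simp: bounded_by_def\<close>)
      moreover have "?\<Gamma> \<turnstile> \<^bold>\<not> ForallS \<psi>" using 2 by (simp add: proves.Assm)
      ultimately show False using False NegE by blast
    qed
    then have "admissible ?\<Delta>" using bounded_by_insert[OF c] unfolding admissible_def by blast
    then show ?thesis using 2 unfolding witnessed_def
      by (intro exI[of _ ?\<Delta>]) (auto simp: Neg_def)
  next
    case 3
    then show ?thesis using adm unfolding witnessed_def by (intro exI[of _ ?\<Gamma>]) auto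
  qed
qed

lemma Henkin_extension:
  assumes "admissible \<Gamma>"
  obtains H where "\<Gamma> \<subseteq> H" "\<not> (H \<turnstile> Bot)" "\<And>\<phi>. \<phi> \<in> H \<or> (\<^bold>\<not> \<phi>) \<in> H"
    "\<And>\<phi>. \<phi> \<in> H \<Longrightarrow> witnessed \<phi> H"
proof -
  \<comment> \<open>Stage \<open>n\<close> treats the formula with number \<open>n\<close>.\<close>
  have "\<exists>f. \<forall>n. (admissible (f n) \<and> (n = 0 \<longrightarrow> f n = \<Gamma>)) \<and> (f n \<subseteq> f (Suc n) \<and>
    ((insert (from_nat n) (f n) \<turnstile> Bot) \<or> from_nat n \<in> f (Suc n) \<and> witnessed (from_nat n) (f (Suc n))))"
  proof (rule dependent_nat_choice)
    show "\<exists>\<Delta>. admissible \<Delta> \<and> (0 = 0 \<longrightarrow> \<Delta> = \<Gamma>)" using assms by blast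
  next
    fix \<Delta> and n :: nat
    assume "admissible \<Delta> \<and> (n = 0 \<longrightarrow> \<Delta> = \<Gamma>)"
    then show "\<exists>\<Delta>'. (admissible \<Delta>' \<and> (Suc n = 0 \<longrightarrow> \<Delta>' = \<Gamma>)) \<and> (\<Delta> \<subseteq> \<Delta>' \<and>
      ((insert (from_nat n) \<Delta> \<turnstile> Bot) \<or> from_nat n \<in> \<Delta>' \<and> witnessed (from_nat n) \<Delta>'))"
      using admissible_extend[of \<Delta> "from_nat n"] by simp
  qed
  then obtain f where adm: "\<And>n. admissible (f n)" and f0: "f 0 = \<Gamma>" and mono: "\<And>n. f n \<subseteq> f (Suc n)"
    and step: "\<And>n. (insert (from_nat n) (f n) \<turnstile> Bot) \<or> from_nat n \<in> f (Suc n) \<and> witnessed (from_nat n) (f (Suc n))"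
    by blast
  have mono': "m \<le> n \<Longrightarrow> f m \<subseteq> f n" for m n using mono by (rule lift_Suc_mono_le)
  let ?H = "\<Union>n. f n"
  have fin: "\<exists>n. f n \<turnstile> \<phi>" if "?H \<turnstile> \<phi>" for \<phi>
  proof -
    obtain \<Delta> where \<Delta>: "\<Delta> \<subseteq> ?H" "finite \<Delta>" "\<Delta> \<turnstile> \<phi>" using proves_finite[OF \<open>?H \<turnstile> \<phi>\<close>] by blast
    have "\<exists>n. \<Delta> \<subseteq> f n" using \<Delta>(2,1)
    proof induction
      case (insert x F)
      then obtain m n where "F \<subseteq> f n" "x \<in> f m" by auto
      then have "insert x F \<subseteq> f (max m n)"
        using mono'[of n "max m n"] mono'[of m "max m n"] by auto
      then show ?case by blast
    qed simp
    then show ?thesis using \<Delta>(3) weakening by blast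
  qed
  have cons: "\<not> (?H \<turnstile> Bot)" using fin adm unfolding admissible_def by blast
  \<comment> \<open>A formula consistent with the limit is consistent with the stage that treats it,
    so it is adopted there together with its witness.\<close>
  have in_H: "\<phi> \<in> f (Suc (to_nat \<phi>)) \<and> witnessed \<phi> (f (Suc (to_nat \<phi>)))"
    if "\<not> (insert \<phi> ?H \<turnstile> Bot)" for \<phi>
  proof -
    have "\<not> (insert \<phi> (f (to_nat \<phi>)) \<turnstile> Bot)"
      using that weakening[of _ Bot "insert \<phi> ?H"] by (meson UN_upper UNIV_I insert_mono)
    then show ?thesis using step[of "to_nat \<phi>"] by simp
  qed
  have complete: "\<phi> \<in> ?H \<or> (\<^bold>\<not> \<phi>) \<in> ?H" for \<phi>
  proof (cases "insert \<phi> ?H \<turnstile> Bot")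
    case True
    then have "?H \<turnstile> \<^bold>\<not> \<phi>" by (rule NegI)
    then have "\<not> (insert (\<^bold>\<not> \<phi>) ?H \<turnstile> Bot)" using cut cons by blast
    then show ?thesis using in_H by blast
  next
    case False
    then show ?thesis using in_H by blast
  qed
  have wit: "witnessed \<phi> ?H" if "\<phi> \<in> ?H" for \<phi>
  proof -
    have "insert \<phi> ?H = ?H" using that by blast
    then have "witnessed \<phi> (f (Suc (to_nat \<phi>)))" using in_H[of \<phi>] cons by simp
    then show ?thesis unfolding witnessed_def by blast
  qed
  show ?thesis by (rule that[OF _ cons complete wit]) (use f0 in blast)+
qed

section \<open>Tarskian semantics and the term model\<close>

record 'a interp =
  izero :: 'a
  ione :: 'a
  iadd :: "'a \<Rightarrow> 'a \<Rightarrow> 'a"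
  imul :: "'a \<Rightarrow> 'a \<Rightarrow> 'a"
  iless :: "'a \<Rightarrow> 'a \<Rightarrow> bool"
  isets :: "'a set set"

primrec val :: "'a interp \<Rightarrow> (nat \<Rightarrow> 'a) \<Rightarrow> tm \<Rightarrow> 'a" where
  "val M e (Var i) = e i"
| "val M e \<^bold>0 = izero M"
| "val M e \<^bold>1 = ione M"
| "val M e (s \<^bold>+ t) = iadd M (val M e s) (val M e t)"
| "val M e (s \<^bold>* t) = imul M (val M e s) (val M e t)"

primrec sat :: "'a interp \<Rightarrow> (nat \<Rightarrow> 'a) \<Rightarrow> (nat \<Rightarrow> 'a set) \<Rightarrow> fm \<Rightarrow> bool" where
  "sat M e S (s \<^bold>= t) \<longleftrightarrow> val M e s = val M e t"
| "sat M e S (s \<^bold>< t) \<longleftrightarrow> iless M (val M e s) (val M e t)"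
| "sat M e S (t \<^bold>\<in> X) \<longleftrightarrow> val M e t \<in> S X"
| "sat M e S Bot \<longleftrightarrow> False"
| "sat M e S (\<phi> \<^bold>\<longrightarrow> \<psi>) \<longleftrightarrow> (sat M e S \<phi> \<longrightarrow> sat M e S \<psi>)"
| "sat M e S (Forall \<phi>) \<longleftrightarrow> (\<forall>x. sat M (case_nat x e) S \<phi>)"
| "sat M e S (ForallS \<phi>) \<longleftrightarrow> (\<forall>A\<in>isets M. sat M e (case_nat A S) \<phi>)"

lemma val_subst: "val M e (subst_tm \<sigma> t) = val M (\<lambda>i. val M e (\<sigma> i)) t"
  by (induction t) auto

lemma val_lift [simp]: "val M e (t \<up> n) = val M (\<lambda>i. e (i + n)) t"
  by (simp add: lift_def val_subst)

lemma sat_subst: "sat M e S (subst \<sigma> \<phi>) \<longleftrightarrow> sat M (\<lambda>i. val M e (\<sigma> i)) S \<phi>"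
proof (induction \<phi> arbitrary: e S \<sigma>)
  case (Forall \<phi>)
  have "(\<lambda>i. val M (case_nat x e) (up \<sigma> i)) = case_nat x (\<lambda>i. val M e (\<sigma> i))" for x
    by (auto split: nat.split)
  then show ?case by (simp only: subst.simps sat.simps Forall.IH)
qed (simp_all add: val_subst)

lemma sat_rename: "sat M e S (rename \<rho> \<phi>) \<longleftrightarrow> sat M e (S \<circ> \<rho>) \<phi>"
proof (induction \<phi> arbitrary: e S \<rho>)
  case (ForallS \<phi>)
  have "case_nat A S \<circ> upS \<rho> = case_nat A (S \<circ> \<rho>)" for A
    by (rule ext) (simp split: nat.split)
  then show ?case by (simp only: rename.simps sat.simps ForallS.IH)
qed (simp_all add: val_subst)

lemma sat_inst: "sat M e S (inst t \<phi>) \<longleftrightarrow> sat M (case_nat (val M e t) e) S \<phi>"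
proof -
  have "(\<lambda>i. val M e (case_nat t Var i)) = case_nat (val M e t) e"
    by (auto split: nat.split)
  then show ?thesis by (simp only: inst_def sat_subst)
qed

lemma sat_instS: "sat M e S (instS X \<phi>) \<longleftrightarrow> sat M e (case_nat (S X) S) \<phi>"
proof -
  have "S \<circ> case_nat X (\<lambda>i. i) = case_nat (S X) S"
    by (rule ext) (simp split: nat.split)
  then show ?thesis by (simp only: instS_def sat_rename)
qed

text \<open>Instances of a quantified formula are not subformulas of it. The truth lemma of the term
  model therefore inducts on \<open>size\<close>, which substitution and renaming preserve.\<close>

lemma size_subst [simp]: "size (subst \<sigma> \<phi>) = size \<phi>"
  by (induction \<phi> arbitrary: \<sigma>) auto

lemma size_rename [simp]: "size (rename \<rho> \<phi>) = size \<phi>"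
  by (induction \<phi> arbitrary: \<rho>) auto

lemma subst_lift_one [simp]: "subst_tm (case_nat u Var) (t \<up> Suc 0) = t"
  by (simp add: lift_def subst_tm_comp)

locale henkin =
  fixes H :: "fm set"
  assumes consistent: "\<not> (H \<turnstile> Bot)"
    and complete: "\<phi> \<in> H \<or> (\<^bold>\<not> \<phi>) \<in> H"
    and witnessed: "\<phi> \<in> H \<Longrightarrow> witnessed \<phi> H"
begin

lemma proves_iff: "(H \<turnstile> \<phi>) \<longleftrightarrow> \<phi> \<in> H"
proof
  assume "H \<turnstile> \<phi>"
  then have "(\<^bold>\<not> \<phi>) \<notin> H" using consistent NegE proves.Assm by blast
  then show "\<phi> \<in> H" using complete by blast
qed (rule proves.Assm)

lemma mem_Neg: "(\<^bold>\<not> \<phi>) \<in> H \<longleftrightarrow> \<phi> \<notin> H"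
  using complete consistent NegE proves.Assm by blast

lemma mem_Imp: "(\<phi> \<^bold>\<longrightarrow> \<psi>) \<in> H \<longleftrightarrow> (\<phi> \<in> H \<longrightarrow> \<psi> \<in> H)"
proof
  assume "(\<phi> \<^bold>\<longrightarrow> \<psi>) \<in> H"
  then show "\<phi> \<in> H \<longrightarrow> \<psi> \<in> H" using proves.ImpE unfolding proves_iff[symmetric] by blast
next
  assume "\<phi> \<in> H \<longrightarrow> \<psi> \<in> H"
  then consider "(\<^bold>\<not> \<phi>) \<in> H" | "\<psi> \<in> H" using mem_Neg by blast
  then show "(\<phi> \<^bold>\<longrightarrow> \<psi>) \<in> H"
  proof cases
    case 1
    then have "insert (\<^bold>\<not> \<psi>) (insert \<phi> H) \<turnstile> Bot"
      by (intro NegE[of _ \<phi>]) (simp_all add: proves.Assm)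
    then show ?thesis using proves.Raa proves.ImpI proves_iff by blast
  next
    case 2
    then have "insert \<phi> H \<turnstile> \<psi>" by (simp add: proves.Assm)
    then show ?thesis using proves.ImpI proves_iff by blast
  qed
qed

lemma mem_Forall: "Forall \<phi> \<in> H \<longleftrightarrow> (\<forall>t. inst t \<phi> \<in> H)"
proof
  assume "Forall \<phi> \<in> H"
  then show "\<forall>t. inst t \<phi> \<in> H" using proves.ForallE unfolding proves_iff[symmetric] by blast
next
  assume *: "\<forall>t. inst t \<phi> \<in> H"
  show "Forall \<phi> \<in> H"
  proof (rule ccontr)
    assume "Forall \<phi> \<notin> H"
    then have "(\<^bold>\<not> Forall \<phi>) \<in> H" by (simp add: mem_Neg)
    then obtain c where "(\<^bold>\<not> inst (Var c) \<phi>) \<in> H" using witnessed unfolding witnessed_def by blast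
    then show False using * mem_Neg by blast
  qed
qed

lemma mem_ForallS: "ForallS \<phi> \<in> H \<longleftrightarrow> (\<forall>X. instS X \<phi> \<in> H)"
proof
  assume "ForallS \<phi> \<in> H"
  then show "\<forall>X. instS X \<phi> \<in> H" using proves.ForallSE unfolding proves_iff[symmetric] by blast
next
  assume *: "\<forall>X. instS X \<phi> \<in> H"
  show "ForallS \<phi> \<in> H"
  proof (rule ccontr)
    assume "ForallS \<phi> \<notin> H"
    then have "(\<^bold>\<not> ForallS \<phi>) \<in> H" by (simp add: mem_Neg)
    then obtain c where "(\<^bold>\<not> instS c \<phi>) \<in> H" using witnessed unfolding witnessed_def by blast
    then show False using * mem_Neg by blast
  qed
qed

lemma eq_refl: "(t \<^bold>= t) \<in> H"
  using proves.EqRefl proves_iff by blast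

lemma eq_subst: "(s \<^bold>= t) \<in> H \<Longrightarrow> inst s \<phi> \<in> H \<Longrightarrow> inst t \<phi> \<in> H"
  using proves.EqSubst unfolding proves_iff[symmetric] by blast

text \<open>Symmetry, transitivity and the congruences come from \<open>eq_subst\<close> for an
  atomic formula in which one term is replaced by \<open>Var 0\<close>; the other terms are shifted
  by \<open>\<up> 1\<close>, so instantiation leaves them unchanged.\<close>

lemma eq_sym: "(s \<^bold>= t) \<in> H \<Longrightarrow> (t \<^bold>= s) \<in> H"
  using eq_subst[of s t "Var 0 \<^bold>= s \<up> 1"] eq_refl by (simp add: inst_def)

lemma eq_trans: "(s \<^bold>= t) \<in> H \<Longrightarrow> (t \<^bold>= u) \<in> H \<Longrightarrow> (s \<^bold>= u) \<in> H"
  using eq_subst[of t u "s \<up> 1 \<^bold>= Var 0"] by (simp add: inst_def)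

lemma eq_plus: "(s \<^bold>= t) \<in> H \<Longrightarrow> (s' \<^bold>= t') \<in> H \<Longrightarrow> (s \<^bold>+ s' \<^bold>= t \<^bold>+ t') \<in> H"
  using eq_subst[of s t "s \<up> 1 \<^bold>+ s' \<up> 1 \<^bold>= Var 0 \<^bold>+ s' \<up> 1"]
    eq_subst[of s' t' "s \<up> 1 \<^bold>+ s' \<up> 1 \<^bold>= t \<up> 1 \<^bold>+ Var 0"] eq_refl by (simp add: inst_def)

lemma eq_times: "(s \<^bold>= t) \<in> H \<Longrightarrow> (s' \<^bold>= t') \<in> H \<Longrightarrow> (s \<^bold>* s' \<^bold>= t \<^bold>* t') \<in> H"
  using eq_subst[of s t "s \<up> 1 \<^bold>* s' \<up> 1 \<^bold>= Var 0 \<^bold>* s' \<up> 1"]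
    eq_subst[of s' t' "s \<up> 1 \<^bold>* s' \<up> 1 \<^bold>= t \<up> 1 \<^bold>* Var 0"] eq_refl by (simp add: inst_def)

lemma eq_less: "(s \<^bold>= t) \<in> H \<Longrightarrow> (s' \<^bold>= t') \<in> H \<Longrightarrow> (s \<^bold>< s') \<in> H \<Longrightarrow> (t \<^bold>< t') \<in> H"
  using eq_subst[of s t "Var 0 \<^bold>< s' \<up> 1"] eq_subst[of s' t' "t \<up> 1 \<^bold>< Var 0"]
  by (simp add: inst_def)

lemma eq_mem: "(s \<^bold>= t) \<in> H \<Longrightarrow> (s \<^bold>\<in> X) \<in> H \<Longrightarrow> (t \<^bold>\<in> X) \<in> H"
  using eq_subst[of s t "Var 0 \<^bold>\<in> X"] by (simp add: inst_def)

text \<open>The terms are identified along \<open>\<pi>\<close> so that the domain of the term model is a whole type.\<close>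

lemma term_model:
  fixes \<pi> :: "tm \<Rightarrow> 'a"
  assumes surj: "surj \<pi>" and ker: "\<And>s t. \<pi> s = \<pi> t \<longleftrightarrow> (s \<^bold>= t) \<in> H"
  obtains M :: "'a interp" and e S where "range S = isets M" "\<And>\<phi>. sat M e S \<phi> \<longleftrightarrow> \<phi> \<in> H"
proof -
  define \<rho> where "\<rho> = inv \<pi>"
  define S where "S X = {a. (\<rho> a \<^bold>\<in> X) \<in> H}" for X
  define M where "M = \<lparr>izero = \<pi> \<^bold>0, ione = \<pi> \<^bold>1, iadd = (\<lambda>a b. \<pi> (\<rho> a \<^bold>+ \<rho> b)),
    imul = (\<lambda>a b. \<pi> (\<rho> a \<^bold>* \<rho> b)), iless = (\<lambda>a b. (\<rho> a \<^bold>< \<rho> b) \<in> H), isets = range S\<rparr>"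
  have \<rho>: "(\<rho> (\<pi> t) \<^bold>= t) \<in> H" for t
    unfolding ker[symmetric] \<rho>_def by (simp add: surj surj_f_inv_f)
  have val: "val M (\<lambda>i. \<pi> (\<sigma> i)) t = \<pi> (subst_tm \<sigma> t)" for \<sigma> t
    by (induction t) (auto simp: M_def ker intro: eq_plus eq_times \<rho>)
  have less_iff: "(\<rho> (\<pi> s) \<^bold>< \<rho> (\<pi> t)) \<in> H \<longleftrightarrow> (s \<^bold>< t) \<in> H" for s t
    using eq_less \<rho> eq_sym by blast
  have mem: "\<pi> t \<in> S X \<longleftrightarrow> (t \<^bold>\<in> X) \<in> H" for t X
    unfolding S_def using eq_mem \<rho> eq_sym by blast
  let ?e = "\<lambda>i. \<pi> (Var i)"
  have val': "val M ?e t = \<pi> t" for t using val[of Var] by simp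
  have "sat M ?e S \<phi> \<longleftrightarrow> \<phi> \<in> H" for \<phi>
  proof (induction "size \<phi>" arbitrary: \<phi> rule: less_induct)
    case less
    show ?case
    proof (cases \<phi>)
      case (Forall \<psi>)
      have "sat M ?e S \<phi> \<longleftrightarrow> (\<forall>t. sat M (case_nat (\<pi> t) ?e) S \<psi>)"
        unfolding Forall sat.simps using surj by (metis surj_def)
      also have "\<dots> \<longleftrightarrow> (\<forall>t. sat M ?e S (inst t \<psi>))"
        by (simp add: sat_inst val')
      also have "\<dots> \<longleftrightarrow> \<phi> \<in> H"
        using less Forall by (simp add: mem_Forall inst_def)
      finally show ?thesis .
    next
      case (ForallS \<psi>)
      have "sat M ?e S \<phi> \<longleftrightarrow> (\<forall>X. sat M ?e S (instS X \<psi>))"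
        by (simp add: ForallS sat_instS) (simp add: M_def)
      also have "\<dots> \<longleftrightarrow> \<phi> \<in> H"
        using less ForallS by (simp add: mem_ForallS instS_def)
      finally show ?thesis .
    next
      case (Imp \<phi>1 \<phi>2)
      then show ?thesis using less by (simp add: mem_Imp)
    next
      case Bot
      then show ?thesis using consistent proves_iff by simp
    qed (simp_all add: val' ker mem, simp_all add: M_def less_iff)
  qed
  then show ?thesis by (intro that[of S M ?e]) (simp_all add: M_def)
qed

end

text \<open>The model has to live on a prescribed type, since it is later compared with an instance
  of type classes. The two hypotheses on successors make the numerals pairwise inequivalent, so the
  quotient of the terms is infinite; being countable too, it is in bijection with \<open>nat\<close>
  and hence with \<open>'a\<close>.\<close>

theorem completeness:
  fixes f :: "'a \<Rightarrow> nat"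
  assumes "bij f" and "\<not> (\<Gamma> \<turnstile> \<phi>)"
    and closed: "\<And>\<psi>. \<psi> \<in> \<Gamma> \<Longrightarrow> bound \<psi> = 0 \<and> boundS \<psi> = 0"
    and Suc_neq_Zero: "\<And>t. \<Gamma> \<turnstile> \<^bold>\<not> t \<^bold>+ \<^bold>1 \<^bold>= \<^bold>0"
    and Suc_inject: "\<And>s t. \<Gamma> \<turnstile> s \<^bold>+ \<^bold>1 \<^bold>= t \<^bold>+ \<^bold>1 \<^bold>\<longrightarrow> s \<^bold>= t"
  obtains M :: "'a interp" and e S where "range S = isets M" "\<And>\<psi>. \<psi> \<in> \<Gamma> \<Longrightarrow> sat M e S \<psi>"
    "\<not> sat M e S \<phi>"
proof -
  have "bounded_by 0 \<Gamma>" using closed by (simp add: bounded_by_def)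
  then have "admissible (insert (\<^bold>\<not> \<phi>) \<Gamma>)"
    unfolding admissible_def using bounded_by_insert proves.Raa \<open>\<not> (\<Gamma> \<turnstile> \<phi>)\<close> by blast
  then obtain H where H: "insert (\<^bold>\<not> \<phi>) \<Gamma> \<subseteq> H" and "\<not> (H \<turnstile> Bot)" "\<And>\<phi>. \<phi> \<in> H \<or> (\<^bold>\<not> \<phi>) \<in> H"
    "\<And>\<phi>. \<phi> \<in> H \<Longrightarrow> witnessed \<phi> H"
    using Henkin_extension by blast
  then interpret henkin H by unfold_locales
  have \<Gamma>: "\<Gamma> \<turnstile> \<psi> \<Longrightarrow> \<psi> \<in> H" for \<psi> using H weakening proves_iff by blast
  define c where "c t = {s. (t \<^bold>= s) \<in> H}" for t
  have c: "c s = c t \<longleftrightarrow> (s \<^bold>= t) \<in> H" for s t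
    unfolding c_def using eq_trans eq_sym eq_refl by blast
  have c_Suc: "c (s \<^bold>+ \<^bold>1) = c (t \<^bold>+ \<^bold>1) \<Longrightarrow> c s = c t" for s t
    using \<Gamma>[OF Suc_inject] by (simp add: c mem_Imp)
  have c_Zero: "c (t \<^bold>+ \<^bold>1) \<noteq> c \<^bold>0" for t
    using \<Gamma>[OF Suc_neq_Zero] by (simp add: c mem_Neg)
  have "c (numeral_tm m) = c (numeral_tm n) \<Longrightarrow> m = n" for m n
  proof (induction m arbitrary: n)
    case 0
    then show ?case using c_Zero[symmetric] by (cases n) simp_all
  next
    case (Suc m)
    show ?case
    proof (cases n)
      case 0
      then show ?thesis using Suc.prems c_Zero by simp
    next
      case (Suc n')
      with Suc.prems have "c (numeral_tm m) = c (numeral_tm n')" by (simp add: c_Suc[of "numeral_tm m" "numeral_tm n'"])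
      from Suc.IH[OF this] show ?thesis using Suc by simp
    qed
  qed
  then have "inj (\<lambda>n. c (numeral_tm n))" by (simp add: inj_def)
  then have "infinite (range (\<lambda>n. c (numeral_tm n)))" by (rule range_inj_infinite)
  then have "infinite (range c)" by (rule contrapos_nn) (auto elim: finite_subset[rotated])
  moreover have "countable (range c)" by simp
  ultimately have bij: "bij_betw (to_nat_on (range c)) (range c) UNIV"
    using to_nat_on_infinite by blast
  define \<pi> where "\<pi> t = inv f (to_nat_on (range c) (c t))" for t
  have surj: "surj \<pi>"
    unfolding surj_def
  proof
    fix a
    have "f a \<in> to_nat_on (range c) ` range c" using bij by (simp add: bij_betw_def)
    then obtain t where "f a = to_nat_on (range c) (c t)" by auto
    then show "\<exists>t. a = \<pi> t" using \<open>bij f\<close> by (metis \<pi>_def bij_inv_eq_iff)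
  qed
  have ker: "\<pi> s = \<pi> t \<longleftrightarrow> (s \<^bold>= t) \<in> H" for s t
  proof -
    have "\<pi> s = \<pi> t \<longleftrightarrow> to_nat_on (range c) (c s) = to_nat_on (range c) (c t)"
      unfolding \<pi>_def using bij_is_inj[OF bij_imp_bij_inv[OF \<open>bij f\<close>]] by (rule inj_eq)
    also have "\<dots> \<longleftrightarrow> c s = c t"
      by (rule inj_on_eq_iff[OF bij_betw_imp_inj_on[OF bij]]) auto
    finally show ?thesis using c by simp
  qed
  obtain M :: "'a interp" and e S where M: "range S = isets M"
    "\<And>\<phi>. sat M e S \<phi> \<longleftrightarrow> \<phi> \<in> H"
    using term_model[OF surj ker] by metis
  show ?thesis
    by (rule that[OF M(1)]) (use H M(2) mem_Neg[of \<phi>] in auto)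
qed

section \<open>Truth of derived connectives and of universal closures\<close>

lemma sat_Neg [simp]: "sat M e S (\<^bold>\<not> \<phi>) \<longleftrightarrow> \<not> sat M e S \<phi>"
  by (simp add: Neg_def)

lemma sat_Top [simp]: "sat M e S Top"
  by (simp add: Top_def)

lemma sat_And [simp]: "sat M e S (\<phi> \<^bold>\<and> \<psi>) \<longleftrightarrow> sat M e S \<phi> \<and> sat M e S \<psi>"
  by (simp add: And_def)

lemma sat_Or [simp]: "sat M e S (\<phi> \<^bold>\<or> \<psi>) \<longleftrightarrow> sat M e S \<phi> \<or> sat M e S \<psi>"
  by (auto simp: Or_def)

lemma sat_Iff [simp]: "sat M e S (\<phi> \<^bold>\<longleftrightarrow> \<psi>) \<longleftrightarrow> (sat M e S \<phi> \<longleftrightarrow> sat M e S \<psi>)"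
  by (auto simp: Iff_def)

lemma sat_Exists [simp]: "sat M e S (Exists \<phi>) \<longleftrightarrow> (\<exists>x. sat M (case_nat x e) S \<phi>)"
  by (simp add: Exists_def)

lemma sat_ExistsS [simp]: "sat M e S (ExistsS \<phi>) \<longleftrightarrow> (\<exists>A\<in>isets M. sat M e (case_nat A S) \<phi>)"
  by (simp add: ExistsS_def)

lemma sat_BForall [simp]:
  "sat M e S (BForall t \<phi>) \<longleftrightarrow> (\<forall>x. iless M x (val M e t) \<longrightarrow> sat M (case_nat x e) S \<phi>)"
  by (simp add: BForall_def)

lemma sat_BExists [simp]:
  "sat M e S (BExists t \<phi>) \<longleftrightarrow> (\<exists>x. iless M x (val M e t) \<and> sat M (case_nat x e) S \<phi>)"
  by (auto simp: BExists_def)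

lemma bound_univ_closure: "bound (univ_closure \<phi>) = 0" "boundS (univ_closure \<phi>) = 0"
proof -
  have "bound ((Forall ^^ n) \<phi>) = bound \<phi> - n" "boundS ((Forall ^^ n) \<phi>) = boundS \<phi>" for n \<phi>
    by (induction n) auto
  moreover have "boundS ((ForallS ^^ n) \<phi>) = boundS \<phi> - n" "bound ((ForallS ^^ n) \<phi>) = bound \<phi>" for n \<phi>
    by (induction n) auto
  ultimately show "bound (univ_closure \<phi>) = 0" "boundS (univ_closure \<phi>) = 0"
    by (simp_all add: univ_closure_def)
qed

lemma case_nat_shift: "case_nat (f 0) (\<lambda>i. f (Suc i)) = f"
  by (rule ext) (simp split: nat.split)

lemma range_case_nat: "range (case_nat x f) = insert x (range f)"
proof
  show "range (case_nat x f) \<subseteq> insert x (range f)" by (auto split: nat.split)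
  have "case_nat x f 0 = x" "case_nat x f (Suc i) = f i" for i by simp_all
  then show "insert x (range f) \<subseteq> range (case_nat x f)" by (metis image_subsetI insert_subset rangeI)
qed

text \<open>Under a single assignment a formula and its closure may differ in truth. Once both sides
  range over all assignments with sets from the model, each quantifier of the closure is absorbed
  into that range.\<close>

lemma sat_univ_closure:
  "(\<forall>e S. range S \<subseteq> isets M \<longrightarrow> sat M e S (univ_closure \<phi>)) \<longleftrightarrow>
   (\<forall>e S. range S \<subseteq> isets M \<longrightarrow> sat M e S \<phi>)"
proof -
  have 1: "(\<forall>e S. range S \<subseteq> isets M \<longrightarrow> sat M e S (Forall \<phi>)) \<longleftrightarrow>
    (\<forall>e S. range S \<subseteq> isets M \<longrightarrow> sat M e S \<phi>)" for \<phi>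
  proof (intro iffI allI impI)
    fix e and S :: "nat \<Rightarrow> 'a set"
    assume "\<forall>e S. range S \<subseteq> isets M \<longrightarrow> sat M e S (Forall \<phi>)" "range S \<subseteq> isets M"
    then have "sat M (case_nat (e 0) (\<lambda>i. e (Suc i))) S \<phi>" by simp
    then show "sat M e S \<phi>" by (simp only: case_nat_shift)
  qed simp
  have 2: "(\<forall>e S. range S \<subseteq> isets M \<longrightarrow> sat M e S (ForallS \<phi>)) \<longleftrightarrow>
    (\<forall>e S. range S \<subseteq> isets M \<longrightarrow> sat M e S \<phi>)" for \<phi>
  proof (intro iffI allI impI)
    fix e and S :: "nat \<Rightarrow> 'a set"
    assume *: "\<forall>e S. range S \<subseteq> isets M \<longrightarrow> sat M e S (ForallS \<phi>)" "range S \<subseteq> isets M"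
    from *(2) have "range (\<lambda>i. S (Suc i)) \<subseteq> isets M" "S 0 \<in> isets M" by auto
    then have "sat M e (case_nat (S 0) (\<lambda>i. S (Suc i))) \<phi>" using *(1) by simp
    then show "sat M e S \<phi>" by (simp only: case_nat_shift)
  qed (simp add: range_case_nat)
  have "(\<forall>e S. range S \<subseteq> isets M \<longrightarrow> sat M e S ((Forall ^^ n) \<phi>)) \<longleftrightarrow>
    (\<forall>e S. range S \<subseteq> isets M \<longrightarrow> sat M e S \<phi>)" for n \<phi>
    by (induction n) (simp_all only: funpow.simps comp_def id_def 1)
  moreover have "(\<forall>e S. range S \<subseteq> isets M \<longrightarrow> sat M e S ((ForallS ^^ n) \<phi>)) \<longleftrightarrow>
    (\<forall>e S. range S \<subseteq> isets M \<longrightarrow> sat M e S \<phi>)" for n \<phi>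
    by (induction n) (simp_all only: funpow.simps comp_def id_def 2)
  ultimately show ?thesis by (simp add: univ_closure_def)
qed

section \<open>Models and definability\<close>

text \<open>Models form a type class so that the algebra of the library becomes available for their
  elements. A nonempty \<open>sets\<close> ensures that assignments of the set variables exist,
  without which no axiom could be applied.\<close>

class rca0_pre = zero + one + plus + times + ord +
  fixes sets :: "'a set set"
  assumes sets_nonempty: "sets \<noteq> {}"
    and le_iff: "x \<le> y \<longleftrightarrow> x < y \<or> x = y"
    and sat_RCA0: "\<phi> \<in> RCA0 \<Longrightarrow> range S \<subseteq> sets \<Longrightarrow>
      sat \<lparr>izero = 0, ione = 1, iadd = (+), imul = (*), iless = (<), isets = sets\<rparr> e S \<phi>"

definition std :: "'a::rca0_pre interp"
  where "std = \<lparr>izero = 0, ione = 1, iadd = (+), imul = (*), iless = (<), isets = sets\<rparr>"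

lemma std_simps [simp]: "izero std = 0" "ione std = 1" "iadd std = (+)" "imul std = (*)"
  "iless std = (<)" "isets std = sets"
  by (simp_all add: std_def)

lemma sat_axiom:
  assumes "univ_closure \<phi> \<in> RCA0" "range S \<subseteq> (sets :: 'a::rca0_pre set set)"
  shows "sat std e S \<phi>"
  using sat_univ_closure[of "std :: 'a interp" \<phi>] sat_RCA0[OF assms(1), folded std_def] assms(2)
  by simp blast

lemma sat_basic: "\<phi> \<in> basic_axioms \<Longrightarrow> range S \<subseteq> sets \<Longrightarrow> sat std e S \<phi>"
  by (rule sat_axiom) (auto simp: RCA0_def)

lemma sat_induction: "Sigma1 \<phi> \<Longrightarrow> range S \<subseteq> sets \<Longrightarrow> sat std e S (induction_axiom \<phi>)"
  by (rule sat_axiom) (auto simp: RCA0_def)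

lemma sat_comprehension:
  "Sigma1 \<phi> \<Longrightarrow> Pi1 \<psi> \<Longrightarrow> range S \<subseteq> sets \<Longrightarrow> sat std e S (comprehension_axiom \<phi> \<psi>)"
  by (rule sat_axiom) (auto simp: RCA0_def)

lemma Delta0_subst: "Delta0 \<phi> \<Longrightarrow> Delta0 (subst \<sigma> \<phi>)"
proof (induction arbitrary: \<sigma> rule: Delta0.induct)
  case (6 \<phi> t)
  have "subst \<sigma> (BForall t \<phi>) = BForall (subst_tm \<sigma> t) (subst (up \<sigma>) \<phi>)"
    by (simp add: BForall_def subst_tm_up_lift[simplified])
  then show ?case using 6 by (auto intro: Delta0.intros)
qed (auto intro: Delta0.intros)

lemma Delta0_rename: "Delta0 \<phi> \<Longrightarrow> Delta0 (rename \<rho> \<phi>)"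
proof (induction rule: Delta0.induct)
  case (6 \<phi> t)
  have "rename \<rho> (BForall t \<phi>) = BForall t (rename \<rho> \<phi>)"
    by (simp add: BForall_def)
  then show ?case using 6 by (auto intro: Delta0.intros)
qed (auto intro: Delta0.intros)

text \<open>Variables occupy the even indices and parameters the odd ones, so a formula has an
  unlimited supply of both and no index must be reserved in advance.\<close>

definition merge :: "(nat \<Rightarrow> 'a) \<Rightarrow> (nat \<Rightarrow> 'a) \<Rightarrow> nat \<Rightarrow> 'a"
  where "merge e p i = (if even i then e (i div 2) else p (i div 2))"

lemma merge_simps [simp]: "merge e p (2 * i) = e i" "merge e p (Suc (2 * i)) = p i"
  by (simp_all add: merge_def)

lemma range_merge: "range (merge S T) \<subseteq> A \<longleftrightarrow> range S \<subseteq> A \<and> range T \<subseteq> A"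
proof
  assume *: "range (merge S T) \<subseteq> A"
  have "merge S T (2 * i) \<in> A" "merge S T (Suc (2 * i)) \<in> A" for i using * by (auto simp del: merge_simps)
  then show "range S \<subseteq> A \<and> range T \<subseteq> A" by auto
qed (auto simp: merge_def)

text \<open>In \<open>trm f\<close> and \<open>d0 P\<close> the function \<open>f\<close> and the predicate \<open>P\<close> depend on an assignment \<open>e\<close>;
  \<open>p\<close> and \<open>S\<close> hold the parameters.\<close>

definition trm :: "((nat \<Rightarrow> 'a) \<Rightarrow> 'a::rca0_pre) \<Rightarrow> bool"
  where "trm f \<longleftrightarrow> (\<exists>t p. \<forall>e. f e = val std (merge e p) t)"

definition d0 :: "((nat \<Rightarrow> 'a::rca0_pre) \<Rightarrow> bool) \<Rightarrow> bool"
  where "d0 P \<longleftrightarrow> (\<exists>\<theta> p S. Delta0 \<theta> \<and> range S \<subseteq> sets \<and> (\<forall>e. P e \<longleftrightarrow> sat std (merge e p) S \<theta>))"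

text \<open>These maps reindex a formula when two families of parameters are joined to
  \<open>merge p q\<close>: those of \<open>p\<close> move to the indices of the form 4 n + 1, those
  of \<open>q\<close> to 4 n + 3.\<close>

abbreviation (input) left :: "nat \<Rightarrow> nat"
  where "left i \<equiv> (if even i then i else 4 * (i div 2) + 1)"

abbreviation (input) right :: "nat \<Rightarrow> nat"
  where "right i \<equiv> (if even i then i else 4 * (i div 2) + 3)"

lemma merge_merge:
  "merge e (merge p q) (left i) = merge e p i"
  "merge e (merge p q) (right i) = merge e q i"
proof -
  have "merge e (merge p q) (left i) = merge e p i \<and> merge e (merge p q) (right i) = merge e q i"
  proof (cases "even i")
    case False
    then obtain k where "i = Suc (2 * k)" by (metis oddE Suc_eq_plus1)
    then have "i div 2 = k" "4 * (i div 2) + 1 = Suc (2 * (2 * k))" "4 * (i div 2) + 3 = Suc (2 * (Suc (2 * k)))"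
      by simp_all
    then show ?thesis using False unfolding if_not_P[OF False] by (simp only: merge_simps) (simp add: merge_def)
  qed (simp add: merge_def)
  then show "merge e (merge p q) (left i) = merge e p i" "merge e (merge p q) (right i) = merge e q i"
    by simp_all
qed

lemma trm_left: "\<exists>t'. \<forall>e. val std (merge e p) t = val std (merge e (merge p q)) t'"
  by (rule exI[of _ "subst_tm (\<lambda>i. Var (left i)) t"]) (simp only: val_subst val.simps merge_merge simp_thms)

lemma trm_right: "\<exists>t'. \<forall>e. val std (merge e q) t = val std (merge e (merge p q)) t'"
  by (rule exI[of _ "subst_tm (\<lambda>i. Var (right i)) t"]) (simp only: val_subst val.simps merge_merge simp_thms)

lemma trm_common:
  assumes "trm f" "trm g"
  obtains t u p where "\<And>e. f e = val std (merge e p) t" "\<And>e. g e = val std (merge e p) u"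
proof -
  obtain t p u q where "\<And>e. f e = val std (merge e p) t" "\<And>e. g e = val std (merge e q) u"
    using assms unfolding trm_def by blast
  moreover obtain t' u' where "\<And>e. val std (merge e p) t = val std (merge e (merge p q)) t'"
    "\<And>e. val std (merge e q) u = val std (merge e (merge p q)) u'"
    using trm_left trm_right by blast
  ultimately show ?thesis using that by simp
qed

lemma d0_left:
  assumes "Delta0 \<theta>"
  shows "\<exists>\<theta>'. Delta0 \<theta>' \<and> (\<forall>e. sat std (merge e p) S \<theta> \<longleftrightarrow> sat std (merge e (merge p q)) (merge S T) \<theta>')"
proof -
  have "merge S T \<circ> (*) 2 = S" by auto
  then show ?thesis using assms
    by (intro exI[of _ "rename ((*) 2) (subst (\<lambda>i. Var (left i)) \<theta>)"])
      (simp only: sat_rename sat_subst val.simps merge_merge Delta0_subst Delta0_rename simp_thms)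
qed

lemma d0_right:
  assumes "Delta0 \<theta>"
  shows "\<exists>\<theta>'. Delta0 \<theta>' \<and> (\<forall>e. sat std (merge e q) T \<theta> \<longleftrightarrow> sat std (merge e (merge p q)) (merge S T) \<theta>')"
proof -
  have "merge S T \<circ> (\<lambda>i. Suc (2 * i)) = T" by auto
  then show ?thesis using assms
    by (intro exI[of _ "rename (\<lambda>i. Suc (2 * i)) (subst (\<lambda>i. Var (right i)) \<theta>)"])
      (simp only: sat_rename sat_subst val.simps merge_merge Delta0_subst Delta0_rename simp_thms)
qed

lemma d0_common:
  assumes "d0 P" "d0 Q"
  obtains \<theta> \<eta> p S where "Delta0 \<theta>" "Delta0 \<eta>" "range S \<subseteq> sets"
    "\<And>e. P e \<longleftrightarrow> sat std (merge e p) S \<theta>" "\<And>e. Q e \<longleftrightarrow> sat std (merge e p) S \<eta>"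
proof -
  obtain \<theta> p S where "Delta0 \<theta>" "range S \<subseteq> sets" "\<And>e. P e \<longleftrightarrow> sat std (merge e p) S \<theta>"
    using assms(1) unfolding d0_def by metis
  moreover obtain \<eta> q T where "Delta0 \<eta>" "range T \<subseteq> sets" "\<And>e. Q e \<longleftrightarrow> sat std (merge e q) T \<eta>"
    using assms(2) unfolding d0_def by metis
  moreover obtain \<theta>' where "Delta0 \<theta>'"
    "\<And>e. sat std (merge e p) S \<theta> \<longleftrightarrow> sat std (merge e (merge p q)) (merge S T) \<theta>'"
    using d0_left[OF \<open>Delta0 \<theta>\<close>] by blast
  moreover obtain \<eta>' where "Delta0 \<eta>'"
    "\<And>e. sat std (merge e q) T \<eta> \<longleftrightarrow> sat std (merge e (merge p q)) (merge S T) \<eta>'"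
    using d0_right[OF \<open>Delta0 \<eta>\<close>] by blast
  ultimately show ?thesis by (intro that[of \<theta>' \<eta>' "merge S T" "merge p q"]) (simp_all add: range_merge)
qed

lemma sets_env: "\<exists>S. range S \<subseteq> (sets :: 'a::rca0_pre set set)"
proof -
  obtain A :: "'a set" where "A \<in> sets" using sets_nonempty by blast
  then show ?thesis by (intro exI[of _ "\<lambda>_. A"]) auto
qed

lemma trm_const: "trm (\<lambda>e. c)"
proof -
  have "merge e (\<lambda>_. c) 1 = c" for e by (simp add: merge_def)
  then show ?thesis unfolding trm_def by (metis val.simps(1))
qed

lemma trm_var: "trm (\<lambda>e. e i)"
proof -
  have "merge e p (2 * i) = e i" for e p :: "nat \<Rightarrow> 'a" by simp
  then show ?thesis unfolding trm_def by (metis val.simps(1))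
qed

lemma trm_plus: "trm f \<Longrightarrow> trm g \<Longrightarrow> trm (\<lambda>e. f e + g e)"
proof (erule (1) trm_common)
  fix t u p
  assume "\<And>e. f e = val std (merge e p) t" "\<And>e. g e = val std (merge e p) u"
  then show ?thesis unfolding trm_def by (intro exI[of _ "t \<^bold>+ u"] exI[of _ p]) simp
qed

lemma trm_times: "trm f \<Longrightarrow> trm g \<Longrightarrow> trm (\<lambda>e. f e * g e)"
proof (erule (1) trm_common)
  fix t u p
  assume "\<And>e. f e = val std (merge e p) t" "\<And>e. g e = val std (merge e p) u"
  then show ?thesis unfolding trm_def by (intro exI[of _ "t \<^bold>* u"] exI[of _ p]) simp
qed

lemma d0_eq: "trm (f :: _ \<Rightarrow> 'a::rca0_pre) \<Longrightarrow> trm g \<Longrightarrow> d0 (\<lambda>e. f e = g e)"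
proof (erule (1) trm_common)
  fix t u p
  assume *: "\<And>e. f e = val std (merge e p) t" "\<And>e. g e = val std (merge e p) u"
  obtain S :: "nat \<Rightarrow> 'a set" where "range S \<subseteq> sets" by (rule exE[OF sets_env])
  then show ?thesis unfolding d0_def using *
    by (intro exI[of _ "t \<^bold>= u"] exI[of _ p] exI[of _ S]) (simp add: Delta0.intros)
qed

lemma d0_less: "trm (f :: _ \<Rightarrow> 'a::rca0_pre) \<Longrightarrow> trm g \<Longrightarrow> d0 (\<lambda>e. f e < g e)"
proof (erule (1) trm_common)
  fix t u p
  assume *: "\<And>e. f e = val std (merge e p) t" "\<And>e. g e = val std (merge e p) u"
  obtain S :: "nat \<Rightarrow> 'a set" where "range S \<subseteq> sets" by (rule exE[OF sets_env])
  then show ?thesis unfolding d0_def using *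
    by (intro exI[of _ "t \<^bold>< u"] exI[of _ p] exI[of _ S]) (simp add: Delta0.intros)
qed

lemma d0_mem: "trm f \<Longrightarrow> A \<in> sets \<Longrightarrow> d0 (\<lambda>e. f e \<in> A)"
proof -
  assume "trm f" "A \<in> sets"
  then obtain t p where "\<And>e. f e = val std (merge e p) t" unfolding trm_def by blast
  then show ?thesis unfolding d0_def using \<open>A \<in> sets\<close>
    by (intro exI[of _ "t \<^bold>\<in> 0"] exI[of _ p] exI[of _ "\<lambda>_. A"]) (auto simp: Delta0.intros)
qed

lemma d0_False: "d0 (\<lambda>e :: nat \<Rightarrow> 'a::rca0_pre. False)"
proof -
  obtain S :: "nat \<Rightarrow> 'a set" where "range S \<subseteq> sets" by (rule exE[OF sets_env])
  then show ?thesis unfolding d0_def by (intro exI[of _ Bot] exI[of _ "\<lambda>_. 0"] exI[of _ S]) (auto simp: Delta0.intros subset_eq)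
qed

lemma d0_imp: "d0 P \<Longrightarrow> d0 Q \<Longrightarrow> d0 (\<lambda>e. P e \<longrightarrow> Q e)"
proof (erule (1) d0_common)
  fix \<theta> \<eta> p S
  assume "Delta0 \<theta>" "Delta0 \<eta>" "range S \<subseteq> sets"
    "\<And>e. P e \<longleftrightarrow> sat std (merge e p) S \<theta>" "\<And>e. Q e \<longleftrightarrow> sat std (merge e p) S \<eta>"
  then show ?thesis unfolding d0_def
    by (intro exI[of _ "\<theta> \<^bold>\<longrightarrow> \<eta>"] exI[of _ p] exI[of _ S]) (simp add: Delta0.intros)
qed

lemma d0_ball:
  assumes "d0 (\<lambda>e. P (e 0) (\<lambda>i. e (Suc i)))" "trm f"
  shows "d0 (\<lambda>e. \<forall>x<f e. P x e)"
proof -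
  obtain \<theta> p S where \<theta>: "Delta0 \<theta>" "range S \<subseteq> sets"
    "\<And>e. P (e 0) (\<lambda>i. e (Suc i)) \<longleftrightarrow> sat std (merge e p) S \<theta>"
    using assms(1) unfolding d0_def by metis
  obtain t q where t: "\<And>e. f e = val std (merge e q) t" using assms(2) unfolding trm_def by blast
  obtain \<theta>' where \<theta>': "Delta0 \<theta>'"
    "\<And>e. sat std (merge e p) S \<theta> \<longleftrightarrow> sat std (merge e (merge p q)) (merge S S) \<theta>'"
    using d0_left[OF \<open>Delta0 \<theta>\<close>] by blast
  obtain t' where t': "\<And>e. f e = val std (merge e (merge p q)) t'" using trm_right[of q t p] t by metis
  \<comment> \<open>Under the quantifier the merged assignment is shifted by one, whereas the body
    expects the new element at index 0 and the old variables at the later even indices.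
    \<open>K\<close> translates between the two.\<close>
  define K where "K j = (if j = 0 then 0 else if even j then j - 1 else j + 1)" for j :: nat
  have K: "case_nat x (merge e r) (K j) = merge (case_nat x e) r j" for x :: 'a and e r j
  proof (cases "even j")
    case True
    then obtain i where i: "j = 2 * i" by blast
    show ?thesis
    proof (cases i)
      case (Suc k)
      then show ?thesis by (simp add: K_def i merge_def)
    qed (simp add: K_def i merge_def)
  next
    case False
    then show ?thesis by (auto simp: K_def merge_def elim: oddE)
  qed
  have "P x e \<longleftrightarrow> sat std (case_nat x (merge e (merge p q))) (merge S S) (subst (\<lambda>j. Var (K j)) \<theta>')" for x e
    using \<theta>(3)[of "case_nat x e"] by (simp add: \<theta>' sat_subst K)
  then show ?thesis unfolding d0_def
    by (intro exI[of _ "BForall t' (subst (\<lambda>j. Var (K j)) \<theta>')"] exI[of _ "merge p q"] exI[of _ "merge S S"])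
      (auto simp: t'[symmetric] range_merge \<theta>(2) intro!: Delta0.intros Delta0_subst \<theta>'(1))
qed

lemma d0_cong: "d0 P \<Longrightarrow> (\<And>e. P e \<longleftrightarrow> Q e) \<Longrightarrow> d0 Q"
  by (simp add: d0_def)

text \<open>Brings a predicate of two variables into the form of the axiom schemes: its variables
  get the indices 0 and 1, its parameters the indices from 2 on. All other variables are sent to
  index 0, which is sound because \<open>P\<close> does not depend on them.\<close>

lemma d0_param:
  fixes p :: "nat \<Rightarrow> 'a::rca0_pre"
  defines "\<sigma> \<equiv> \<lambda>j. Var (if even j then (if j = 2 then 1 else 0) else j div 2 + 2)"
  assumes "\<And>e. P (e 0) (e 1) \<longleftrightarrow> sat std (merge e p) S \<theta>"
  shows "P y x \<longleftrightarrow> sat std (case_nat y (case_nat x p)) S (subst \<sigma> \<theta>)"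
proof -
  let ?e = "\<lambda>j. if j = 1 then x else y"
  have "val std (case_nat y (case_nat x p)) (\<sigma> j) = merge ?e p j" for j
  proof -
    have 2: "even j \<Longrightarrow> j div 2 = 1 \<longleftrightarrow> j = 2" by presburger
    show ?thesis
    proof (cases "even j")
      case True
      then show ?thesis unfolding \<sigma>_def merge_def if_P[OF True] 2[OF True] by (cases "j = 2") simp_all
    next
      case False
      have "case_nat y (case_nat x p) (k + 2) = p k" for k by simp
      then show ?thesis unfolding \<sigma>_def merge_def if_not_P[OF False] val.simps .
    qed
  qed
  then show ?thesis using assms(2)[of ?e] by (simp only: sat_subst) simp
qed

lemma sat_subst_Suc:
  "sat M (case_nat x e) S (subst (case_nat (Var 0 \<^bold>+ \<^bold>1) (\<lambda>i. Var (Suc i))) \<phi>) \<longleftrightarrow>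
   sat M (case_nat (iadd M x (ione M)) e) S \<phi>"
proof -
  have "(\<lambda>i. val M (case_nat x e) (case_nat (Var 0 \<^bold>+ \<^bold>1) (\<lambda>i. Var (Suc i)) i)) =
    case_nat (iadd M x (ione M)) e"
    by (rule ext) (simp split: nat.split)
  then show ?thesis by (simp only: sat_subst)
qed

lemma sigma1_induct:
  fixes P :: "'a::rca0_pre \<Rightarrow> 'a \<Rightarrow> bool"
  assumes "d0 (\<lambda>e. P (e 0) (e 1))" and base: "\<exists>y. P y 0" and step: "\<And>x. \<exists>y. P y x \<Longrightarrow> \<exists>y. P y (x + 1)"
  shows "\<exists>y. P y x"
proof -
  obtain \<theta> p S where "Delta0 \<theta>" and S: "range S \<subseteq> sets" and \<theta>: "\<And>e. P (e 0) (e 1) \<longleftrightarrow> sat std (merge e p) S \<theta>"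
    using assms(1) unfolding d0_def by metis
  define \<phi> where "\<phi> = Exists (subst (\<lambda>j. Var (if even j then (if j = 2 then 1 else 0) else j div 2 + 2)) \<theta>)"
  have \<phi>: "sat std (case_nat x p) S \<phi> \<longleftrightarrow> (\<exists>y. P y x)" for x
    unfolding \<phi>_def by (simp add: d0_param[OF \<theta>])
  have "Sigma1 \<phi>" unfolding Sigma1_def \<phi>_def using \<open>Delta0 \<theta>\<close> Delta0_subst by blast
  then have "sat std p S (induction_axiom \<phi>)" using S by (rule sat_induction)
  then have "(\<exists>y. P y 0) \<and> (\<forall>x. (\<exists>y. P y x) \<longrightarrow> (\<exists>y. P y (x + 1))) \<longrightarrow> (\<forall>x. \<exists>y. P y x)"
    unfolding induction_axiom_def sat.simps sat_And sat_inst sat_subst_Suc \<phi> val.simps std_simps .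
  then show ?thesis using base step by blast
qed

lemma delta0_induct:
  fixes P :: "'a::rca0_pre \<Rightarrow> bool"
  assumes "d0 (\<lambda>e. P (e 0))" "P 0" "\<And>x. P x \<Longrightarrow> P (x + 1)"
  shows "P x"
proof -
  have "d0 (\<lambda>e. P (e 1))"
  proof -
    obtain \<theta> p S where \<theta>: "Delta0 \<theta>" "range S \<subseteq> sets" "\<And>e. P (e 0) \<longleftrightarrow> sat std (merge e p) S \<theta>"
      using assms(1) unfolding d0_def by metis
    let ?\<sigma> = "\<lambda>j. Var (if even j then 2 else j)"
    have "P (e 1) \<longleftrightarrow> sat std (merge e p) S (subst ?\<sigma> \<theta>)" for e
    proof -
      have "(\<lambda>i. val std (merge e p) (?\<sigma> i)) = merge (\<lambda>_. e 1) p" by (auto simp: merge_def)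
      then show ?thesis using \<theta>(3)[of "\<lambda>_. e 1"] by (simp add: sat_subst)
    qed
    then show ?thesis unfolding d0_def using \<theta> Delta0_subst by blast
  qed
  then have "\<exists>y::'a. P x" by (rule sigma1_induct[of "\<lambda>_. P"]) (use assms in auto)
  then show ?thesis by simp
qed

lemma delta1_comprehension:
  fixes P Q :: "'a::rca0_pre \<Rightarrow> 'a \<Rightarrow> bool"
  assumes "d0 (\<lambda>e. P (e 0) (e 1))" "d0 (\<lambda>e. Q (e 0) (e 1))" and eq: "\<And>x. (\<exists>y. P y x) \<longleftrightarrow> (\<forall>y. Q y x)"
  shows "{x. \<exists>y. P y x} \<in> sets"
proof -
  obtain \<theta> \<eta> p S where D: "Delta0 \<theta>" "Delta0 \<eta>" and S: "range S \<subseteq> sets"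
    and \<theta>: "\<And>e. P (e 0) (e 1) \<longleftrightarrow> sat std (merge e p) S \<theta>"
    and \<eta>: "\<And>e. Q (e 0) (e 1) \<longleftrightarrow> sat std (merge e p) S \<eta>"
    using d0_common[OF assms(1,2)] by metis
  let ?\<sigma> = "\<lambda>j. Var (if even j then (if j = 2 then 1 else 0) else j div 2 + 2)"
  have "sat std p S (comprehension_axiom (Exists (subst ?\<sigma> \<theta>)) (Forall (subst ?\<sigma> \<eta>)))"
    by (rule sat_comprehension[OF _ _ S]) (use D Delta0_subst in \<open>auto simp: Sigma1_def Pi1_def\<close>)
  moreover have "case_nat A S \<circ> Suc = S" for A :: "'a set" by auto
  ultimately have "\<exists>A\<in>sets. \<forall>x. x \<in> A \<longleftrightarrow> (\<exists>y. P y x)"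
    unfolding comprehension_axiom_def
    by (simp add: d0_param[OF \<theta>, symmetric] d0_param[OF \<eta>, symmetric] eq[symmetric] wkS_def sat_rename
       del: subst.simps)
  then obtain A where "A \<in> sets" "A = {x. \<exists>y. P y x}" by blast
  then show ?thesis by simp
qed

lemma d0_not: "d0 P \<Longrightarrow> d0 (\<lambda>e. \<not> P e)"
  by (rule d0_cong[OF d0_imp[OF _ d0_False]]) auto

lemma d0_and: "d0 P \<Longrightarrow> d0 Q \<Longrightarrow> d0 (\<lambda>e. P e \<and> Q e)"
  using d0_not[OF d0_imp[of P "\<lambda>e. \<not> Q e"]] by (simp add: d0_not)

lemma d0_or: "d0 P \<Longrightarrow> d0 Q \<Longrightarrow> d0 (\<lambda>e. P e \<or> Q e)"
  using d0_imp[of "\<lambda>e. \<not> P e" Q] by (simp add: d0_not disj_imp)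

lemmas d0_basic = trm_const trm_var trm_plus trm_times d0_eq d0_less d0_imp d0_not d0_and d0_or

section \<open>Ordered semiring laws from the axioms and bounded induction\<close>

context
  fixes x y z :: "'a::rca0_pre"
begin

lemma basic_sat:
  fixes e :: "nat \<Rightarrow> 'a"
  shows "\<phi> \<in> basic_axioms \<Longrightarrow> \<exists>S. sat std e S \<phi>"
  using sat_basic sets_env by metis

lemma pre_Suc_neq_0: "x + 1 \<noteq> 0"
  using basic_sat[of "\<^bold>\<not> Var 0 \<^bold>+ \<^bold>1 \<^bold>= \<^bold>0" "\<lambda>_. x"] by (simp add: basic_axioms_def)

lemma pre_Suc_inject: "x + 1 = y + 1 \<Longrightarrow> x = y"
  using basic_sat[of "Var 1 \<^bold>+ \<^bold>1 \<^bold>= Var 0 \<^bold>+ \<^bold>1 \<^bold>\<longrightarrow> Var 1 \<^bold>= Var 0" "case_nat y (\<lambda>_. x)"]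
  by (simp add: basic_axioms_def)

lemma pre_add_0: "x + 0 = x"
  using basic_sat[of "Var 0 \<^bold>+ \<^bold>0 \<^bold>= Var 0" "\<lambda>_. x"] by (simp add: basic_axioms_def)

lemma pre_add_Suc: "x + (y + 1) = (x + y) + 1"
  using basic_sat[of "Var 1 \<^bold>+ (Var 0 \<^bold>+ \<^bold>1) \<^bold>= (Var 1 \<^bold>+ Var 0) \<^bold>+ \<^bold>1" "case_nat y (\<lambda>_. x)"]
  by (simp add: basic_axioms_def)

lemma pre_mult_0: "x * 0 = 0"
  using basic_sat[of "Var 0 \<^bold>* \<^bold>0 \<^bold>= \<^bold>0" "\<lambda>_. x"] by (simp add: basic_axioms_def)

lemma pre_mult_Suc: "x * (y + 1) = x * y + x"
  using basic_sat[of "Var 1 \<^bold>* (Var 0 \<^bold>+ \<^bold>1) \<^bold>= Var 1 \<^bold>* Var 0 \<^bold>+ Var 1" "case_nat y (\<lambda>_. x)"]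
  by (simp add: basic_axioms_def)

lemma pre_not_less_0: "\<not> x < 0"
  using basic_sat[of "\<^bold>\<not> Var 0 \<^bold>< \<^bold>0" "\<lambda>_. x"] by (simp add: basic_axioms_def)

lemma pre_less_Suc: "x < y + 1 \<longleftrightarrow> x < y \<or> x = y"
  using basic_sat[of "Var 1 \<^bold>< Var 0 \<^bold>+ \<^bold>1 \<^bold>\<longleftrightarrow> (Var 1 \<^bold>< Var 0 \<^bold>\<or> Var 1 \<^bold>= Var 0)" "case_nat y (\<lambda>_. x)"]
  by (simp add: basic_axioms_def)

end

lemma pre_add_assoc: "(x + y) + z = x + (y + z)" for x y z :: "'a::rca0_pre"
  by (rule delta0_induct[where P = "\<lambda>z. (x + y) + z = x + (y + z)"])
    (intro d0_basic | simp add: pre_add_0 pre_add_Suc)+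

lemma pre_0_add: "0 + x = x" for x :: "'a::rca0_pre"
  by (rule delta0_induct[where P = "\<lambda>x. 0 + x = x"])
    (intro d0_basic | simp add: pre_add_0 pre_add_Suc)+

lemma pre_Suc_add: "(x + 1) + y = (x + y) + 1" for x y :: "'a::rca0_pre"
  by (rule delta0_induct[where P = "\<lambda>y. (x + 1) + y = (x + y) + 1"])
    (intro d0_basic | simp add: pre_add_0 pre_add_Suc)+

lemma pre_add_commute: "x + y = y + x" for x y :: "'a::rca0_pre"
  by (rule delta0_induct[where P = "\<lambda>y. x + y = y + x"])
    (intro d0_basic | simp add: pre_add_0 pre_0_add pre_add_Suc pre_Suc_add)+

lemma pre_add_left_commute: "x + (y + z) = y + (x + z)" for x y z :: "'a::rca0_pre"
  by (metis pre_add_assoc pre_add_commute)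

lemmas pre_ac = pre_add_assoc pre_add_commute pre_add_left_commute

lemma pre_0_mult: "0 * x = 0" for x :: "'a::rca0_pre"
  by (rule delta0_induct[where P = "\<lambda>x. 0 * x = 0"])
    (intro d0_basic | simp add: pre_add_0 pre_mult_0 pre_mult_Suc)+

lemma pre_Suc_mult: "(x + 1) * y = x * y + y" for x y :: "'a::rca0_pre"
  by (rule delta0_induct[where P = "\<lambda>y. (x + 1) * y = x * y + y"])
    (intro d0_basic | simp add: pre_add_0 pre_mult_0 pre_mult_Suc pre_ac)+

lemma pre_mult_commute: "x * y = y * x" for x y :: "'a::rca0_pre"
  by (rule delta0_induct[where P = "\<lambda>y. x * y = y * x"])
    (intro d0_basic | simp add: pre_mult_0 pre_0_mult pre_mult_Suc pre_Suc_mult)+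

lemma pre_mult_1_right: "x * 1 = x" for x :: "'a::rca0_pre"
  using pre_mult_Suc[of x 0] by (simp only: pre_0_add pre_mult_0)

lemma pre_distrib_left: "x * (y + z) = x * y + x * z" for x y z :: "'a::rca0_pre"
proof (rule delta0_induct[where P = "\<lambda>z. x * (y + z) = x * y + x * z"])
  fix z assume "x * (y + z) = x * y + x * z"
  then show "x * (y + (z + 1)) = x * y + x * (z + 1)"
    unfolding pre_add_Suc pre_mult_Suc by (simp only: pre_add_assoc)
qed (intro d0_basic | simp add: pre_add_0 pre_mult_0)+

lemma pre_distrib_right: "(x + y) * z = x * z + y * z" for x y z :: "'a::rca0_pre"
  using pre_distrib_left[of z x y] by (simp only: pre_mult_commute)

lemma pre_mult_assoc: "(x * y) * z = x * (y * z)" for x y z :: "'a::rca0_pre"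
  by (rule delta0_induct[where P = "\<lambda>z. (x * y) * z = x * (y * z)"])
    (intro d0_basic | simp add: pre_mult_0 pre_mult_1_right pre_distrib_left)+

lemma pre_mult_1: "1 * x = x" for x :: "'a::rca0_pre"
  using pre_mult_1_right[of x] by (simp only: pre_mult_commute)

lemma pre_add_right_cancel: "x + z = y + z \<Longrightarrow> x = y" for x y z :: "'a::rca0_pre"
proof -
  have "x + z = y + z \<longrightarrow> x = y"
    by (rule delta0_induct[where P = "\<lambda>z. x + z = y + z \<longrightarrow> x = y"])
      (intro d0_basic | simp add: pre_add_0 pre_add_Suc | blast dest: pre_Suc_inject)+
  then show "x + z = y + z \<Longrightarrow> x = y" by blast
qed

lemma pre_add_left_cancel: "z + x = z + y \<Longrightarrow> x = y" for x y z :: "'a::rca0_pre"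
  using pre_add_right_cancel[of x z y] by (simp add: pre_add_commute)

lemma pre_less_iff_ex: "x < y \<longleftrightarrow> (\<exists>d. y = x + d + 1)" for x y :: "'a::rca0_pre"
proof
  \<comment> \<open>The existential quantifier stands in front of the implication, which makes the
    induction formula Sigma_1.\<close>
  have "\<exists>d. x < y \<longrightarrow> y = x + d + 1"
  proof (rule sigma1_induct[where P = "\<lambda>d y. x < y \<longrightarrow> y = x + d + 1"])
    fix y assume "\<exists>d. x < y \<longrightarrow> y = x + d + 1"
    then show "\<exists>d. x < y + 1 \<longrightarrow> y + 1 = x + d + 1"
      unfolding pre_less_Suc by (metis pre_add_0 pre_add_assoc)
  qed (intro d0_basic | simp add: pre_not_less_0)+
  then show "x < y \<Longrightarrow> \<exists>d. y = x + d + 1" by blast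
next
  have "x < x + d + 1" for d
    by (rule delta0_induct[where P = "\<lambda>d. x < x + d + 1"])
      (intro d0_basic | simp add: pre_add_0 pre_add_Suc pre_less_Suc)+
  then show "\<exists>d. y = x + d + 1 \<Longrightarrow> x < y" by blast
qed

lemma pre_add_Suc_neq: "x + d + 1 \<noteq> x" for x d :: "'a::rca0_pre"
  using pre_add_left_cancel[of x "d + 1" 0] pre_Suc_neq_0[of d] by (auto simp: pre_add_0 pre_add_assoc)

lemma pre_less_trans: "x < y \<Longrightarrow> y < z \<Longrightarrow> x < z" for x y z :: "'a::rca0_pre"
  unfolding pre_less_iff_ex by (metis pre_add_assoc)

lemma pre_less_irrefl: "\<not> x < x" for x :: "'a::rca0_pre"
  unfolding pre_less_iff_ex using pre_add_Suc_neq by metis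

lemma pre_eq_0_or_Suc: "x = 0 \<or> (\<exists>y. x = y + 1)" for x :: "'a::rca0_pre"
proof -
  have "\<exists>y. x = 0 \<or> x = y + 1"
    by (rule sigma1_induct[where P = "\<lambda>y x. x = 0 \<or> x = y + 1"]) (intro d0_basic | blast)+
  then show ?thesis by blast
qed

lemma pre_Suc_less_Suc: "x + 1 < y + 1 \<longleftrightarrow> x < y" for x y :: "'a::rca0_pre"
  unfolding pre_less_iff_ex by (metis pre_Suc_add pre_Suc_inject)

lemma pre_0_less_Suc: "0 < x + 1" for x :: "'a::rca0_pre"
  unfolding pre_less_iff_ex by (metis pre_0_add)

lemma pre_linear: "x < y \<or> x = y \<or> y < x" for x y :: "'a::rca0_pre"
proof (rule delta0_induct[where P = "\<lambda>y. x < y \<or> x = y \<or> y < x"])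
  show "x < 0 \<or> x = 0 \<or> 0 < x" using pre_eq_0_or_Suc pre_0_less_Suc by metis
next
  fix y assume "x < y \<or> x = y \<or> y < x"
  moreover have "y + 1 = x \<or> y + 1 < x" if "y < x"
  proof -
    obtain d where "x = y + d + 1" using \<open>y < x\<close> pre_less_iff_ex by blast
    then show ?thesis using pre_eq_0_or_Suc[of d] pre_Suc_less_Suc[of y "y + d"] pre_less_iff_ex
      by (metis pre_add_0 pre_add_assoc)
  qed
  ultimately show "x < y + 1 \<or> x = y + 1 \<or> y + 1 < x" using pre_less_Suc by metis
qed (intro d0_basic)+

lemma pre_add_less_mono: "x < y \<Longrightarrow> z + x < z + y" for x y z :: "'a::rca0_pre"
  unfolding pre_less_iff_ex by (metis pre_add_assoc)

lemma pre_mult_less_mono: "x < y \<Longrightarrow> 0 < z \<Longrightarrow> z * x < z * y" for x y z :: "'a::rca0_pre"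
proof -
  assume "x < y" "0 < z"
  then obtain d c where y: "y = x + d + 1" and z: "z = c + 1" unfolding pre_less_iff_ex by (metis pre_0_add)
  have "z * y = z * x + z * d + z" unfolding y by (simp only: pre_distrib_left pre_mult_1_right)
  also have "\<dots> = z * x + (z * d + c) + 1" by (simp only: z pre_add_assoc)
  finally show ?thesis unfolding pre_less_iff_ex by blast
qed

lemma pre_le_ex: "x \<le> y \<Longrightarrow> \<exists>d. d + x = y" for x y :: "'a::rca0_pre"
  unfolding le_iff pre_less_iff_ex by (metis pre_0_add pre_add_assoc pre_add_commute)

text \<open>The library's class of ordered semirings requires a subtraction, which is taken to be truncated.\<close>

class rca0 = linordered_semidom + rca0_pre +
  assumes diff_eq_0: "x \<le> y \<Longrightarrow> x - y = 0"

section \<open>A generic model\<close>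

text \<open>A fresh copy of \<open>nat\<close>, as \<open>nat\<close> itself already carries its own
  arithmetic instances.\<close>

typedef gm = "UNIV :: nat set" by simp

definition models :: "'a interp \<Rightarrow> bool"
  where "models M \<longleftrightarrow> isets M \<noteq> {} \<and> (\<forall>\<phi>\<in>RCA0. \<forall>e S. range S \<subseteq> isets M \<longrightarrow> sat M e S \<phi>)"

definition valid :: "'a interp \<Rightarrow> fm \<Rightarrow> bool"
  where "valid M \<phi> \<longleftrightarrow> (\<forall>e S. range S \<subseteq> isets M \<longrightarrow> sat M e S \<phi>)"

lemma bij_Rep_gm: "bij Rep_gm"
  unfolding bij_def inj_def surj_def by (metis Abs_gm_inverse Rep_gm_inject UNIV_I)

text \<open>The type \<open>gm\<close> must become an instance unconditionally, so there has to be a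
  model on it even if none is a counterexample. The standard numbers with all sets serve.\<close>

lemma models_exists: "\<exists>M :: gm interp. models M"
proof -
  define M where "M = \<lparr>izero = Abs_gm 0, ione = Abs_gm 1, iadd = (\<lambda>x y. Abs_gm (Rep_gm x + Rep_gm y)),
    imul = (\<lambda>x y. Abs_gm (Rep_gm x * Rep_gm y)), iless = (\<lambda>x y. Rep_gm x < Rep_gm y), isets = UNIV\<rparr>"
  have [simp]: "Rep_gm (Abs_gm n) = n" for n by (simp add: Abs_gm_inverse)
  have [simp]: "Abs_gm n = Abs_gm m \<longleftrightarrow> n = m" for n m by (simp add: Abs_gm_inject)
  have [simp]: "isets M = UNIV" by (simp add: M_def)
  have "sat M e S \<phi>" if "\<phi> \<in> basic_axioms" for e S \<phi>
    using that unfolding basic_axioms_def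
    by (auto simp: M_def Rep_gm_inverse algebra_simps Rep_gm_inject less_Suc_eq)
  moreover have "sat M e S (induction_axiom \<phi>)" for e S \<phi>
  proof -
    have "sat M (case_nat (Abs_gm n) e) S \<phi>"
      if "sat M (case_nat (Abs_gm 0) e) S \<phi>"
        "\<And>n. sat M (case_nat (Abs_gm n) e) S \<phi> \<Longrightarrow> sat M (case_nat (Abs_gm (n + 1)) e) S \<phi>" for n
      using that by (induction n) auto
    moreover have "iadd M (Abs_gm n) (ione M) = Abs_gm (n + 1)" "izero M = Abs_gm 0" for n by (simp_all add: M_def)
    ultimately show ?thesis
      unfolding induction_axiom_def by (simp only: sat.simps sat_And sat_inst sat_subst_Suc val.simps) (metis Rep_gm_inverse)
  qed
  moreover have "sat M e S (comprehension_axiom \<phi> \<psi>)" for e S \<phi> \<psi>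
  proof -
    have "case_nat A S \<circ> Suc = S" for A by auto
    then show ?thesis
      unfolding comprehension_axiom_def wkS_def
      by (simp add: sat_rename) (intro impI exI[of _ "{x. sat M (case_nat x e) S \<phi>}"], simp)
  qed
  ultimately have "\<forall>\<phi>\<in>RCA0. \<forall>e S. range S \<subseteq> isets M \<longrightarrow> sat M e S \<phi>"
    unfolding RCA0_def using sat_univ_closure[of M] by (auto simp del: split_paired_All)
  then show ?thesis unfolding models_def by (intro exI[of _ M]) simp
qed

text \<open>The type \<open>gm\<close> carries a model of \<open>RCA0\<close> in which the theorem fails, if there is one. Everything
  true in the class \<open>rca0\<close> holds in this model, hence there is none.\<close>

definition counter :: "gm interp \<Rightarrow> bool"
  where "counter M \<longleftrightarrow> (\<exists>k\<ge>1. \<not> valid M (TS (k + 1) \<^bold>\<longrightarrow> DNR_jump k))"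

definition gmodel :: "gm interp"
  where "gmodel = (SOME M. models M \<and> ((\<exists>M. models M \<and> counter M) \<longrightarrow> counter M))"

lemma gmodel: "models gmodel" "models M \<Longrightarrow> counter M \<Longrightarrow> counter gmodel"
proof -
  have "\<exists>M. models M \<and> ((\<exists>M. models M \<and> counter M) \<longrightarrow> counter M)" using models_exists by blast
  from someI_ex[OF this] show "models gmodel" "models M \<Longrightarrow> counter M \<Longrightarrow> counter gmodel"
    unfolding gmodel_def by blast+
qed

instantiation gm :: rca0_pre
begin

definition "0 = izero gmodel"
definition "1 = ione gmodel"
definition "x + y = iadd gmodel x y"
definition "x * y = imul gmodel x y"
definition "x < y \<longleftrightarrow> iless gmodel x y"
definition "x \<le> y \<longleftrightarrow> iless gmodel x y \<or> x = y" for x y :: gm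
definition "sets = isets gmodel"

instance
proof
  have eq: "\<lparr>izero = 0, ione = 1, iadd = (+), imul = (*), iless = (<), isets = sets\<rparr> = gmodel"
    by (rule interp.equality)
      (simp_all add: zero_gm_def one_gm_def plus_gm_def[abs_def] times_gm_def[abs_def] less_gm_def[abs_def] sets_gm_def)
  show "sets \<noteq> ({} :: gm set set)" using gmodel(1) by (simp add: models_def sets_gm_def)
  show "x \<le> y \<longleftrightarrow> x < y \<or> x = y" for x y :: gm by (simp add: less_gm_def less_eq_gm_def)
  show "sat \<lparr>izero = 0, ione = 1, iadd = (+), imul = (*), iless = (<), isets = sets\<rparr> e S \<phi>"
    if "\<phi> \<in> RCA0" "range S \<subseteq> sets" for \<phi> S and e :: "nat \<Rightarrow> gm"
    unfolding eq using gmodel(1) that by (simp add: models_def sets_gm_def)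
qed

end

lemma std_gm: "std = gmodel"
  unfolding std_def by (rule interp.equality)
    (simp_all add: zero_gm_def one_gm_def plus_gm_def[abs_def] times_gm_def[abs_def] less_gm_def[abs_def] sets_gm_def)

instantiation gm :: rca0
begin

definition "x - y = (if y \<le> x then THE d. d + y = x else 0)" for x y :: gm

lemma gm_diffI: "d + y = x \<Longrightarrow> x - y = d" for x y d :: gm
proof -
  assume *: "d + y = x"
  then have "y \<le> x" unfolding le_iff pre_less_iff_ex
    by (metis pre_eq_0_or_Suc pre_0_add pre_add_assoc pre_add_commute)
  moreover have "(THE d. d + y = x) = d"
    by (rule the_equality) (use * pre_add_right_cancel in blast)+
  ultimately show ?thesis by (simp add: minus_gm_def)
qed

lemma gm_le_linear: "x \<le> y \<or> y \<le> x" for x y :: gm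
  using pre_linear le_iff by metis

instance
proof
  fix a b c :: gm
  show "a + b + c = a + (b + c)" by (rule pre_add_assoc)
  show "a + b = b + a" by (rule pre_add_commute)
  show "0 + a = a" by (rule pre_0_add)
  show "a * b * c = a * (b * c)" by (rule pre_mult_assoc)
  show "a * b = b * a" by (rule pre_mult_commute)
  show "1 * a = a" by (rule pre_mult_1)
  show "(a + b) * c = a * c + b * c" by (rule pre_distrib_right)
  show "a * (b + c) = a * b + a * c" by (rule pre_distrib_left)
  show "0 * a = 0" by (rule pre_0_mult)
  show "a * 0 = 0" by (rule pre_mult_0)
  show "a + b - a = b" by (rule gm_diffI) (rule pre_add_commute)
  show le_diff: "b \<le> a \<Longrightarrow> a - b + b = a" using pre_le_ex gm_diffI by metis
  show diff_0: "a \<le> b \<Longrightarrow> a - b = 0"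
    using gm_diffI[of 0 b a] by (metis le_iff minus_gm_def pre_0_add pre_less_irrefl pre_less_trans)
  show "a - b - c = a - (b + c)"
  proof (cases "b + c \<le> a")
    case True
    then obtain d where "d + (b + c) = a" using pre_le_ex by blast
    then have "(d + c) + b = a" by (metis pre_add_assoc pre_add_commute)
    then have "a - b = d + c" by (rule gm_diffI)
    then show ?thesis using gm_diffI[of d c "a - b"] gm_diffI[OF \<open>d + (b + c) = a\<close>] by simp
  next
    case False
    then have "a - (b + c) = 0" by (simp add: minus_gm_def)
    moreover have "a - b - c = 0"
    proof (rule ccontr)
      assume "a - b - c \<noteq> 0"
      then have "c \<le> a - b" by (metis minus_gm_def)
      then obtain d where d: "d + c = a - b" using pre_le_ex by blast
      show False
      proof (cases "b \<le> a")
        case True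
        then obtain d' where "d' + b = a" using pre_le_ex by blast
        then have "a = d + (b + c)" using d gm_diffI by (metis pre_add_assoc pre_add_commute)
        then have "b + c \<le> a" unfolding le_iff pre_less_iff_ex
          by (metis pre_eq_0_or_Suc pre_0_add pre_add_assoc pre_add_commute)
        then show False using False by blast
      next
        case False
        then have "a - b = 0" by (simp add: minus_gm_def)
        then show False using \<open>a - b - c \<noteq> 0\<close> \<open>c \<le> a - b\<close>
          by (metis gm_diffI le_iff pre_0_add pre_not_less_0)
      qed
    qed
    ultimately show ?thesis by simp
  qed
  show "(0::gm) \<noteq> 1" using pre_Suc_neq_0[of "0::gm"] by (simp add: pre_0_add eq_commute)
  show "(0::gm) < 1" using pre_0_less_Suc[of "0::gm"] by (simp add: pre_0_add)
  show "(a < b) = (a \<le> b \<and> \<not> b \<le> a)"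
    unfolding le_iff using pre_less_irrefl pre_less_trans by metis
  show "a \<le> a" by (simp add: le_iff)
  show "a \<le> b \<Longrightarrow> b \<le> c \<Longrightarrow> a \<le> c" unfolding le_iff using pre_less_trans by metis
  show "a \<le> b \<Longrightarrow> b \<le> a \<Longrightarrow> a = b" unfolding le_iff using pre_less_irrefl pre_less_trans by metis
  show "a \<le> b \<or> b \<le> a" by (rule gm_le_linear)
  show "a \<le> b \<Longrightarrow> c + a \<le> c + b" unfolding le_iff using pre_add_less_mono by metis
  show "a < b \<Longrightarrow> 0 < c \<Longrightarrow> c * a < c * b" by (rule pre_mult_less_mono)
  show "a \<noteq> 0 \<Longrightarrow> b \<noteq> 0 \<Longrightarrow> a * b \<noteq> 0"
    using pre_mult_less_mono[of 0 b a] by (metis pre_0_less_Suc pre_eq_0_or_Suc pre_less_irrefl pre_mult_0)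
  show "a * (b - c) = a * b - a * c"
  proof (cases "c \<le> b")
    case True
    then obtain d where d: "d + c = b" using pre_le_ex by blast
    then have "a * d + a * c = a * b" by (simp flip: pre_distrib_left)
    then show ?thesis using d gm_diffI by metis
  next
    case False
    then have "b < c" using pre_linear le_iff by metis
    then have "a * b \<le> a * c"
      using pre_mult_less_mono[of b c a] unfolding le_iff
      by (metis pre_0_less_Suc pre_0_mult pre_eq_0_or_Suc)
    then have "a * b - a * c = 0"
      using gm_diffI[of 0 "a * c" "a * b"] by (metis le_iff minus_gm_def pre_0_add pre_less_irrefl pre_less_trans)
    then show ?thesis using False by (simp add: minus_gm_def pre_mult_0)
  qed
qed

end

section \<open>Arithmetic in models\<close>

instance rca0 \<subseteq> ordered_cancel_comm_monoid_diff
proof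
  fix a b c :: "'a::rca0"
  show "a \<le> b \<longleftrightarrow> (\<exists>c. b = a + c)"
  proof
    show "a \<le> b \<Longrightarrow> \<exists>c. b = a + c" using pre_le_ex add.commute by metis
    have "0 \<le> c" for c :: 'a using pre_not_less_0 not_less by blast
    then show "\<exists>c. b = a + c \<Longrightarrow> a \<le> b" by auto
  qed
  show "0 - a = 0" using diff_eq_0 pre_not_less_0 not_less by blast
qed

lemma less_Suc_iff_le: "x < y + 1 \<longleftrightarrow> x \<le> y" for x y :: "'a::rca0"
  unfolding pre_less_Suc le_iff ..

lemma Suc_le_iff_less: "x + 1 \<le> y \<longleftrightarrow> x < y" for x y :: "'a::rca0"
  using less_Suc_iff_le[of y x] not_less by blast

lemma less_one_iff: "x < 1 \<longleftrightarrow> x = 0" for x :: "'a::rca0"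
  using less_Suc_iff_le[of x 0] by simp

lemma not_0_obtain: "x \<noteq> 0 \<Longrightarrow> \<exists>y. x = y + 1" for x :: "'a::rca0"
  using pre_eq_0_or_Suc by blast

lemma le_mult_self: "x \<le> x * x" for x :: "'a::rca0"
proof (cases "x = 0")
  case False
  then have "1 \<le> x" using less_one_iff not_less by blast
  then show ?thesis using mult_left_mono[of 1 x x] by simp
qed simp

definition pair :: "'a::rca0 \<Rightarrow> 'a \<Rightarrow> 'a"
  where "pair x y = (x + y) * (x + y) + x"

lemma val_pr [simp]: "val std e (pr s t) = pair (val std e s) (val std e t)"
  by (simp add: pr_def pair_def)

lemma add_le_pair: "x + y \<le> pair x y"
  unfolding pair_def using le_mult_self[of "x + y"] by (meson add_increasing2 order.trans zero_le)

lemma fst_le_pair: "x \<le> pair x y" and snd_le_pair: "y \<le> pair x y"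
  using add_le_pair[of x y] by (meson le_add_same_cancel1 le_add_same_cancel2 order.trans zero_le)+

lemma pair_mono: "x \<le> x' \<Longrightarrow> y \<le> y' \<Longrightarrow> pair x y \<le> pair x' y'"
  unfolding pair_def by (intro add_mono mult_mono) simp_all

text \<open>\<open>pair x y\<close> lies between the square of \<open>x + y\<close> and the next
  square, so codes are ordered by the sums of the components. A code thus determines the sum and
  then both components.\<close>

lemma pair_less_aux: "x + y < x' + y' \<Longrightarrow> pair x y < pair x' y'"
proof -
  assume "x + y < x' + y'"
  then have "x + y + 1 \<le> x' + y'" by (simp add: Suc_le_iff_less)
  then have "(x + y + 1) * (x + y + 1) \<le> (x' + y') * (x' + y')" by (intro mult_mono) simp_all
  moreover have "pair x y < (x + y + 1) * (x + y + 1)"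
  proof -
    have "(x + y + 1) * (x + y + 1) = pair x y + (x + y + y) + 1"
      unfolding pair_def by (simp add: algebra_simps)
    then show ?thesis by (simp only: less_Suc_iff_le) simp
  qed
  moreover have "(x' + y') * (x' + y') \<le> pair x' y'" unfolding pair_def by simp
  ultimately show ?thesis by (meson less_le_trans)
qed

lemma pair_inject [simp]: "pair x y = pair x' y' \<longleftrightarrow> x = x' \<and> y = y'"
proof
  assume *: "pair x y = pair x' y'"
  then have "x + y = x' + y'" using pair_less_aux less_irrefl linorder_less_linear by metis
  then show "x = x' \<and> y = y'" using * unfolding pair_def by simp
qed simp

section \<open>Closure of definable predicates\<close>

text \<open>Both definability by bounded formulas and computability by indices have these closure properties;
  \<open>n\<close> bounds the variables on which a predicate depends.\<close>

locale bounded_closed =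
  fixes T :: "nat \<Rightarrow> ((nat \<Rightarrow> 'a::rca0) \<Rightarrow> 'a) \<Rightarrow> bool" and P :: "nat \<Rightarrow> ((nat \<Rightarrow> 'a) \<Rightarrow> bool) \<Rightarrow> bool"
  assumes T_var: "i < n \<Longrightarrow> T n (\<lambda>e. e i)"
    and T_zero: "T n (\<lambda>e. 0)"
    and T_one: "T n (\<lambda>e. 1)"
    and T_plus: "T n f \<Longrightarrow> T n g \<Longrightarrow> T n (\<lambda>e. f e + g e)"
    and T_times: "T n f \<Longrightarrow> T n g \<Longrightarrow> T n (\<lambda>e. f e * g e)"
    and T_shift: "T n f \<Longrightarrow> T (Suc n) (\<lambda>e. f (\<lambda>i. e (Suc i)))"
    and P_eq: "T n f \<Longrightarrow> T n g \<Longrightarrow> P n (\<lambda>e. f e = g e)"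
    and P_less: "T n f \<Longrightarrow> T n g \<Longrightarrow> P n (\<lambda>e. f e < g e)"
    and P_False: "P n (\<lambda>e. False)"
    and P_imp: "P n A \<Longrightarrow> P n B \<Longrightarrow> P n (\<lambda>e. A e \<longrightarrow> B e)"
    and P_ball: "P (Suc n) (\<lambda>e. C (e 0) (\<lambda>i. e (Suc i))) \<Longrightarrow> T n f \<Longrightarrow> P n (\<lambda>e. \<forall>x<f e. C x e)"
begin

lemma P_not: "P n A \<Longrightarrow> P n (\<lambda>e. \<not> A e)"
  using P_imp[of n A "\<lambda>_. False"] P_False by simp

lemma P_and: "P n A \<Longrightarrow> P n B \<Longrightarrow> P n (\<lambda>e. A e \<and> B e)"
  using P_not[OF P_imp[of n A "\<lambda>e. \<not> B e"]] by (simp add: P_not)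

lemma P_or: "P n A \<Longrightarrow> P n B \<Longrightarrow> P n (\<lambda>e. A e \<or> B e)"
  using P_imp[of n "\<lambda>e. \<not> A e" B] by (simp add: P_not disj_imp)

lemma P_iff: "P n A \<Longrightarrow> P n B \<Longrightarrow> P n (\<lambda>e. A e \<longleftrightarrow> B e)"
  using P_and[OF P_imp P_imp, of n A B B A] by (simp add: iff_conv_conj_imp)

lemma P_le: "T n f \<Longrightarrow> T n g \<Longrightarrow> P n (\<lambda>e. f e \<le> g e)"
  using P_not[OF P_less, of n g f] by (simp add: not_less)

lemma P_bex: "P (Suc n) (\<lambda>e. C (e 0) (\<lambda>i. e (Suc i))) \<Longrightarrow> T n f \<Longrightarrow> P n (\<lambda>e. \<exists>x<f e. C x e)"
  using P_not[OF P_ball[of n "\<lambda>x e. \<not> C x e" f]] by (simp add: P_not)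

lemma T_pair: "T n f \<Longrightarrow> T n g \<Longrightarrow> T n (\<lambda>e. pair (f e) (g e))"
  unfolding pair_def by (intro T_plus T_times)

lemmas basic = T_var T_zero T_one T_plus T_times T_pair P_eq P_less P_False P_imp P_not P_and P_or P_iff P_le P_ball P_bex

text \<open>Substitution of a term is not among the closure assumptions. A quantifier bounded by
  \<open>f e + 1\<close> names the value of the term instead.\<close>

lemma P_subst1:
  assumes "\<And>n i. i < n \<Longrightarrow> P n (\<lambda>e. A (e i))" "T n f"
  shows "P n (\<lambda>e. A (f e))"
proof -
  have "P n (\<lambda>e. \<exists>x<f e + 1. x = f e \<and> A x)"
    by (intro basic assms T_shift) simp_all
  then show ?thesis by (simp add: less_Suc_iff_le cong: conj_cong)
qed

lemma P_subst2:
  assumes A: "\<And>n i j. i < n \<Longrightarrow> j < n \<Longrightarrow> P n (\<lambda>e. A (e i) (e j))" and f: "T n f" and g: "T n g"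
  shows "P n (\<lambda>e. A (f e) (g e))"
proof -
  have "P n (\<lambda>e. \<exists>x<f e + 1. (\<exists>y<g e + 1. x = f e \<and> y = g e \<and> A x y))"
    by (intro basic A f T_shift[OF f] T_shift[OF T_shift[OF f]] g T_shift[OF g] T_shift[OF T_shift[OF g]]) simp_all
  moreover have "(\<exists>x<a + 1. (\<exists>y<b + 1. x = a \<and> y = b \<and> A x y)) \<longleftrightarrow> A a b" for a b
    by (auto simp: less_Suc_iff_le)
  ultimately show ?thesis by simp
qed

lemma P_subst3:
  assumes A: "\<And>n i j k. i < n \<Longrightarrow> j < n \<Longrightarrow> k < n \<Longrightarrow> P n (\<lambda>e. A (e i) (e j) (e k))"
    and f: "T n f" and g: "T n g" and h: "T n h"
  shows "P n (\<lambda>e. A (f e) (g e) (h e))"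
proof -
  have "P n (\<lambda>e. \<exists>x<f e + 1. (\<exists>y<g e + 1. (\<exists>z<h e + 1. x = f e \<and> y = g e \<and> z = h e \<and> A x y z)))"
    by (intro basic A f T_shift[OF f] T_shift[OF T_shift[OF f]] T_shift[OF T_shift[OF T_shift[OF f]]]
      g T_shift[OF g] T_shift[OF T_shift[OF g]] T_shift[OF T_shift[OF T_shift[OF g]]]
      h T_shift[OF h] T_shift[OF T_shift[OF h]] T_shift[OF T_shift[OF T_shift[OF h]]]) simp_all
  moreover have "(\<exists>x<a + 1. (\<exists>y<b + 1. (\<exists>z<c + 1. x = a \<and> y = b \<and> z = c \<and> A x y z))) \<longleftrightarrow> A a b c" for a b c
    by (auto simp: less_Suc_iff_le)
  ultimately show ?thesis by simp
qed

end

lemma trm_shift: "trm f \<Longrightarrow> trm (\<lambda>e. f (\<lambda>i. e (Suc i)))"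
proof -
  assume "trm f"
  then obtain t p where t: "\<And>e. f e = val std (merge e p) t" unfolding trm_def by blast
  let ?\<sigma> = "\<lambda>j. Var (if even j then j + 2 else j)"
  have "(\<lambda>j. val std (merge e p) (?\<sigma> j)) = merge (\<lambda>i. e (Suc i)) p" for e
    by (rule ext) (simp add: merge_def)
  then have "f (\<lambda>i. e (Suc i)) = val std (merge e p) (subst_tm ?\<sigma> t)" for e
    using t by (simp only: val_subst)
  then show ?thesis unfolding trm_def by blast
qed

interpretation d0: bounded_closed "\<lambda>n. trm :: ((nat \<Rightarrow> 'a::rca0) \<Rightarrow> 'a) \<Rightarrow> bool" "\<lambda>n. d0"
  by unfold_locales (rule trm_var trm_const trm_plus trm_times trm_shift d0_eq d0_less d0_False d0_imp d0_ball; assumption)+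

lemmas d0_intros = trm_const trm_var trm_plus trm_times d0.T_pair d0_eq d0_less d0_False d0_imp d0_not d0_and d0_or
  d0.P_iff d0.P_le d0_ball d0.P_bex

lemma d0_weaken1: "d0 (\<lambda>e. A (e 0)) \<Longrightarrow> trm f \<Longrightarrow> d0 (\<lambda>e. A (f e))" for A :: "'a::rca0 \<Rightarrow> bool"
proof -
  assume "d0 (\<lambda>e. A (e 0))" and f: "trm f"
  then obtain \<theta> p S where \<theta>: "Delta0 \<theta>" "range S \<subseteq> sets" "\<And>e. A (e 0) \<longleftrightarrow> sat std (merge e p) S \<theta>"
    unfolding d0_def by metis
  have "d0 (\<lambda>e. A (e i))" for i
  proof -
    let ?\<sigma> = "\<lambda>j. Var (if even j then 2 * i else j)"
    have "A (e i) \<longleftrightarrow> sat std (merge e p) S (subst ?\<sigma> \<theta>)" for e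
    proof -
      have "(\<lambda>j. val std (merge e p) (?\<sigma> j)) = merge (\<lambda>_. e i) p" by (rule ext) (simp add: merge_def)
      then show ?thesis using \<theta>(3)[of "\<lambda>_. e i"] by (simp only: sat_subst)
    qed
    then show ?thesis unfolding d0_def using \<theta> Delta0_subst by blast
  qed
  then show ?thesis using d0.P_subst1[of A f] f by simp
qed

lemma delta0_less_induct:
  fixes A :: "'a::rca0 \<Rightarrow> bool"
  assumes A: "d0 (\<lambda>e. A (e 0))" and step: "\<And>x. (\<And>y. y < x \<Longrightarrow> A y) \<Longrightarrow> A x"
  shows "A x"
proof -
  have "\<forall>y<x. A y" for x
  proof (rule delta0_induct[where P = "\<lambda>x. \<forall>y<x. A y"])
    show "d0 (\<lambda>e. \<forall>y<e 0. A y)"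
      by (intro d0_intros A)
  next
    fix x assume "\<forall>y<x. A y"
    then show "\<forall>y<x + 1. A y" using step pre_less_Suc by metis
  qed (simp add: pre_not_less_0)
  then show ?thesis using step by blast
qed

lemma delta0_least:
  fixes A :: "'a::rca0 \<Rightarrow> bool"
  shows "d0 (\<lambda>e. A (e 0)) \<Longrightarrow> A x \<Longrightarrow> \<exists>y. A y \<and> (\<forall>z<y. \<not> A z)"
  using delta0_less_induct[of "\<lambda>x. \<not> A x" x] d0_not by blast

lemma delta0_comprehension: "d0 (\<lambda>e. A (e 0)) \<Longrightarrow> {x. A x} \<in> sets" for A :: "'a::rca0 \<Rightarrow> bool"
proof -
  assume A: "d0 (\<lambda>e. A (e 0))"
  have "d0 (\<lambda>e. A (e 1))" by (rule d0_weaken1[OF A trm_var])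
  from delta1_comprehension[of "\<lambda>_. A" "\<lambda>_. A", OF this this] show ?thesis by simp
qed

text \<open>Bounding for bounded formulas. The statement for the first \<open>a\<close> values of
  \<open>i\<close> has only \<open>b\<close> as an unbounded quantifier, hence Sigma_1 induction on
  \<open>a\<close> applies.\<close>

lemma collection:
  fixes A :: "'a::rca0 \<Rightarrow> 'a \<Rightarrow> bool"
  assumes A: "d0 (\<lambda>e. A (e 0) (e 1))" and ex: "\<And>i. i < l \<Longrightarrow> \<exists>y. A y i"
  shows "\<exists>b. \<forall>i<l. \<exists>y<b. A y i"
proof -
  have "\<exists>b. \<forall>i<a. i < l \<longrightarrow> (\<exists>y<b. A y i)" for a
  proof (rule sigma1_induct[where P = "\<lambda>b a. \<forall>i<a. i < l \<longrightarrow> (\<exists>y<b. A y i)"])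
    show "d0 (\<lambda>e. \<forall>i<e 1. i < l \<longrightarrow> (\<exists>y<e 0. A y i))"
      using A by (intro d0_intros) simp
  next
    fix a assume "\<exists>b. \<forall>i<a. i < l \<longrightarrow> (\<exists>y<b. A y i)"
    then obtain b where b: "\<And>i. i < a \<Longrightarrow> i < l \<Longrightarrow> \<exists>y<b. A y i" by blast
    show "\<exists>b. \<forall>i<a + 1. i < l \<longrightarrow> (\<exists>y<b. A y i)"
    proof (cases "a < l")
      case True
      then obtain y where "A y a" using ex by blast
      then show ?thesis using b
        by (intro exI[of _ "max b (y + 1)"]) (metis less_Suc_iff_le less_max_iff_disj order_le_less order_refl)
    next
      case False
      then show ?thesis using b by (metis less_Suc_iff_le order_le_less)
    qed
  qed (simp add: pre_not_less_0)
  from this[of l] show ?thesis by blast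
qed

lemma d0_dvd: "trm (f :: _ \<Rightarrow> 'a::rca0) \<Longrightarrow> trm g \<Longrightarrow> d0 (\<lambda>e. f e dvd g e)"
proof -
  assume f: "trm f" and g: "trm g"
  have "d0 (\<lambda>e. \<exists>q<g e + 1. g e = f e * q)"
    by (intro d0_intros trm_shift[OF f] g trm_shift[OF g])
  moreover have "(\<exists>q<b + 1. b = a * q) \<longleftrightarrow> a dvd b" for a b :: 'a
  proof
    assume "a dvd b"
    then obtain q where q: "b = a * q" by (rule dvdE)
    show "\<exists>q<b + 1. b = a * q"
    proof (cases "a = 0")
      case False
      then have "1 \<le> a" using less_one_iff not_less by blast
      then have "q \<le> b" using q mult_right_mono[of 1 a q] by simp
      then show ?thesis using q less_Suc_iff_le by blast
    qed (use q in \<open>auto simp: less_one_iff\<close>)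
  qed auto
  ultimately show ?thesis by simp
qed

section \<open>Codes of finite sets\<close>

definition dec :: "'a::rca0 \<Rightarrow> 'a set" where
  "dec c = {i. \<exists>l<c + 1. (\<exists>m<c + 1. (\<exists>n. n < c + 1 \<and>
    c = pair l (pair m n) \<and> i < l \<and> (\<exists>q<n + 1. q * (m * (i + 1) + 1) = n)))}"

lemma (in bounded_closed) P_dec: "T n f \<Longrightarrow> T n g \<Longrightarrow> P n (\<lambda>e. f e \<in> dec (g e))"
proof (rule P_subst2[of "\<lambda>x y. x \<in> dec y"])
  fix n i j :: nat
  assume "i < n" "j < n"
  then show "P n (\<lambda>e. e i \<in> dec (e j))"
    unfolding dec_def mem_Collect_eq by (intro basic) simp_all
qed

lemmas d0_dec = d0.P_dec

lemma sat_in_code: "sat std e S (in_code i c) \<longleftrightarrow> val std e i \<in> dec (val std e c)"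
  by (simp add: in_code_def dec_def eval_nat_numeral)

lemma dec_less: "i \<in> dec c \<Longrightarrow> i < c"
  unfolding dec_def using fst_le_pair less_le_trans by blast

lemma mem_dec_pair: "i \<in> dec (pair l (pair m n)) \<longleftrightarrow> i < l \<and> (m * (i + 1) + 1) dvd n"
proof
  assume "i \<in> dec (pair l (pair m n))"
  then show "i < l \<and> (m * (i + 1) + 1) dvd n"
    unfolding dec_def by (auto simp del: add.commute)
next
  assume *: "i < l \<and> (m * (i + 1) + 1) dvd n"
  let ?c = "pair l (pair m n)" and ?k = "m * (i + 1) + 1"
  obtain q where q: "n = ?k * q" using * by (auto elim: dvdE)
  have "q \<le> n" using q mult_right_mono[of 1 ?k q] by simp
  moreover have "l \<le> ?c" "m \<le> ?c" "n \<le> ?c"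
    by (rule fst_le_pair, rule order.trans[OF fst_le_pair snd_le_pair], rule order.trans[OF snd_le_pair snd_le_pair])
  ultimately show "i \<in> dec ?c" unfolding dec_def less_Suc_iff_le mem_Collect_eq
    using * q by (intro exI conjI) (assumption | simp only: mult.commute)+
qed

text \<open>Invertibility of \<open>b\<close> modulo \<open>a\<close>, written without negative
  numbers. It replaces coprimality: it is visibly multiplicative in \<open>b\<close>, and it
  excludes that \<open>a\<close> divides \<open>b\<close>.\<close>

definition inv_mod :: "'a::rca0 \<Rightarrow> 'a \<Rightarrow> bool"
  where "inv_mod a b \<longleftrightarrow> (\<exists>x y. b * x = a * y + 1)"

lemma inv_mod_mult: "inv_mod a b \<Longrightarrow> inv_mod a c \<Longrightarrow> inv_mod a (b * c)"
proof -
  assume "inv_mod a b" "inv_mod a c"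
  then obtain x y x' y' where *: "b * x = a * y + 1" "c * x' = a * y' + 1" unfolding inv_mod_def by blast
  have "b * c * (x * x') = (b * x) * (c * x')" by (simp only: mult.assoc mult.left_commute)
  also have "\<dots> = a * (a * y * y' + y + y') + 1" unfolding * by (simp add: algebra_simps)
  finally show ?thesis unfolding inv_mod_def by blast
qed

lemma inv_mod_1: "inv_mod a 1"
  unfolding inv_mod_def by (rule exI[of _ 1], rule exI[of _ 0]) simp

lemma inv_mod_not_dvd: "inv_mod a b \<Longrightarrow> 1 < a \<Longrightarrow> \<not> a dvd b"
proof
  assume "inv_mod a b" "1 < a" "a dvd b"
  then obtain x y where "b * x = a * y + 1" unfolding inv_mod_def by blast
  then have "a dvd a * y + 1" using \<open>a dvd b\<close> by (metis dvd_mult2)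
  then have "a dvd 1" using dvd_add_right_iff[of a "a * y" 1] by simp
  then obtain k where k: "1 = a * k" by (rule dvdE)
  then have "k \<noteq> 0" by auto
  then have "1 \<le> k" using less_one_iff not_less by blast
  then have "a \<le> 1" using k mult_left_mono[of 1 k a] by simp
  then show False using \<open>1 < a\<close> by simp
qed

text \<open>Modulo \<open>m (i + 1) + 1\<close> the number \<open>m (i + 1)\<close> is congruent to \<open>-1\<close>; this yields
  explicit inverses for the other moduli of the \<open>\<beta>\<close>-function.\<close>

lemma inv_mod_less:
  fixes m :: "'a::rca0"
  assumes "m = d * q"
  shows "inv_mod (m * (i + 1) + 1) (m * (i + d + 1) + 1)"
proof -
  define g where "g = m * (i + 1)"
  define x where "x = (i + 1) * (i + 1) * q"
  have sq: "m * d * x = g * g" unfolding x_def g_def using assms by (simp add: algebra_simps)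
  have mod: "m * (i + d + 1) + 1 = (g + 1) + m * d" unfolding g_def by (simp add: algebra_simps)
  show ?thesis
  proof (cases "g = 0")
    case True
    then have "((g + 1) + m * d) * 1 = (g + 1) * (m * d) + 1" by (simp add: add.commute)
    then show ?thesis unfolding inv_mod_def mod g_def[symmetric] by blast
  next
    case False
    then obtain p where p: "g = p + 1" using not_0_obtain by blast
    have "((g + 1) + m * d) * x = (g + 1) * x + g * g" by (simp add: distrib_right sq)
    also have "\<dots> = (g + 1) * (x + p) + 1" unfolding p by (simp add: algebra_simps)
    finally show ?thesis unfolding inv_mod_def mod g_def[symmetric] by blast
  qed
qed

text \<open>Modulo \<open>g + 1\<close> the number \<open>C\<close> is congruent to
  \<open>- m * d\<close>, and \<open>m * d * x\<close> is the cube of \<open>g\<close>, which is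
  congruent to -1; hence \<open>C * x\<close> is congruent to 1. \<open>K\<close> is the quotient of
  the cube of \<open>g\<close> plus 1 by \<open>g + 1\<close>, written in terms of
  \<open>p = g - 1\<close>. The inequality \<open>K \<le> x\<close> yields a cofactor
  \<open>y\<close> that is a genuine element of the model.\<close>

lemma inv_mod_greater:
  fixes m :: "'a::rca0"
  assumes "m = d * q" "0 < m"
  shows "inv_mod (m * (i + d + 1) + 1) (m * (i + 1) + 1)"
proof -
  define g where "g = m * (i + d + 1)"
  define C where "C = m * (i + 1) + 1"
  define x where "x = g * ((i + d + 1) * (i + d + 1)) * q"
  have "m * d * x = g * (m * (i + d + 1)) * ((d * q) * (i + d + 1))"
    unfolding x_def by (simp only: mult.assoc mult.left_commute mult.commute)
  then have cube: "m * d * x = g * g * g" using assms(1) by (simp add: g_def mult.assoc)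
  have mod: "g + 1 = C + m * d" unfolding g_def C_def by (simp add: algebra_simps)
  have "g \<noteq> 0" unfolding g_def using assms(2) by simp
  then obtain p where p: "g = p + 1" using not_0_obtain by blast
  define K where "K = p * p + p + 1"
  have K: "(g + 1) * K = g * g * g + 1" unfolding K_def p by (simp add: algebra_simps)
  have "C * x + (g + 1) * K = C * x + m * d * x + 1" unfolding K cube by (simp add: add.assoc)
  also have "\<dots> = (g + 1) * x + 1" unfolding mod by (simp add: distrib_right)
  finally have eq: "C * x + (g + 1) * K = (g + 1) * x + 1" .
  have "K \<le> x"
  proof (rule ccontr)
    assume "\<not> K \<le> x"
    then have "x + 1 \<le> K" by (simp add: Suc_le_iff_less)
    then have "(g + 1) * (x + 1) \<le> (g + 1) * K" by (intro mult_left_mono) simp_all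
    also have "\<dots> \<le> (g + 1) * x + 1" using eq le_iff_add[of "(g + 1) * K" "(g + 1) * x + 1"] by (metis add.commute)
    finally have "(g + 1) * x + (g + 1) \<le> (g + 1) * x + 1" by (simp only: distrib_left mult_1_right)
    then have "g + 1 \<le> 1" by (simp only: add_le_cancel_left)
    then show False using \<open>g \<noteq> 0\<close> by simp
  qed
  then obtain y where y: "x = K + y" unfolding le_iff_add by blast
  have "(g + 1) * K + C * x = (g + 1) * K + ((g + 1) * y + 1)"
    using eq unfolding y distrib_left[of "g + 1"] by (simp only: add.assoc add.commute add.left_commute)
  then have "C * x = (g + 1) * y + 1" by (simp only: add_left_cancel)
  then show ?thesis unfolding inv_mod_def g_def[symmetric] C_def[symmetric] by blast
qed

text \<open>A substitute for the factorial. If all differences of indices divide \<open>m\<close>,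
  the moduli \<open>m * (i + 1) + 1\<close> are invertible modulo each other.\<close>

lemma common_multiple: "\<exists>m>0. \<forall>i. 0 < i \<longrightarrow> i \<le> l \<longrightarrow> i dvd m" for l :: "'a::rca0"
proof -
  have "\<exists>m. 0 < m \<and> (\<forall>i<l + 1. 0 < i \<longrightarrow> i dvd m)"
  proof (rule sigma1_induct[where P = "\<lambda>m l. 0 < m \<and> (\<forall>i<l + 1. 0 < i \<longrightarrow> i dvd m)"])
    show "\<exists>m::'a. 0 < m \<and> (\<forall>i<0 + 1. 0 < i \<longrightarrow> i dvd m)"
      by (intro exI[of _ 1]) (auto simp: less_one_iff)
  next
    fix l :: 'a
    assume "\<exists>m. 0 < m \<and> (\<forall>i<l + 1. 0 < i \<longrightarrow> i dvd m)"
    then obtain m where m: "0 < m" "\<And>i. i < l + 1 \<Longrightarrow> 0 < i \<Longrightarrow> i dvd m" by blast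
    have "i dvd m * (l + 1)" if "i < l + 1 + 1" "0 < i" for i
      using that m(2)[of i] by (metis pre_less_Suc dvd_mult dvd_mult2 dvd_refl)
    moreover have "0 < m * (l + 1)" using m(1) by (simp add: pre_0_less_Suc)
    ultimately show "\<exists>m. 0 < m \<and> (\<forall>i<l + 1 + 1. 0 < i \<longrightarrow> i dvd m)" by blast
  qed (intro d0_intros d0_dvd)
  then show ?thesis by (simp add: less_Suc_iff_le) blast
qed

text \<open>The code is the product of the moduli of the members, built by induction on the bound
  \<open>a\<close> for the members included. That the product is invertible modulo the other moduli
  hides unbounded quantifiers; \<open>good\<close> bounds their witnesses by \<open>w\<close>, and
  \<open>collection\<close> supplies one \<open>w\<close> for all \<open>i < l\<close>, so that the
  induction formula is Sigma_1.\<close>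

lemma code_exists:
  fixes A :: "'a::rca0 \<Rightarrow> bool"
  assumes A: "d0 (\<lambda>e. A (e 0))"
  shows "\<exists>c. dec c = {i. i < l \<and> A i}"
proof -
  obtain m :: 'a where "0 < m" and m: "\<And>i. 0 < i \<Longrightarrow> i \<le> l \<Longrightarrow> i dvd m" using common_multiple by blast
  define M where "M i = m * (i + 1) + 1" for i
  have trm_M: "trm f \<Longrightarrow> trm (\<lambda>e. M (f e))" for f unfolding M_def by (intro d0_intros)
  have inv: "inv_mod (M i) (M j)" if ij: "i \<noteq> j" "i < l" "j < l" for i j
  proof (cases "i < j")
    case True
    then obtain d where d: "j = i + d" using less_imp_le le_iff_add by metis
    then have "d \<noteq> 0" "d \<le> l" using ij by auto (meson le_add_same_cancel2 less_imp_le order.trans zero_le)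
    then have "d dvd m" using m[of d] by (simp add: zero_less_iff_neq_zero)
    then show ?thesis unfolding M_def d by (auto elim!: dvdE intro: inv_mod_less)
  next
    case False
    then obtain d where d: "i = j + d" using not_less le_iff_add by metis
    then have "d \<noteq> 0" "d \<le> l" using ij by auto (meson le_add_same_cancel2 less_imp_le order.trans zero_le)
    then have "d dvd m" using m[of d] by (simp add: zero_less_iff_neq_zero)
    then show ?thesis unfolding M_def d using \<open>0 < m\<close> by (auto elim!: dvdE intro: inv_mod_greater)
  qed
  define good where "good w n a i \<longleftrightarrow>
    (i < a \<and> A i \<longrightarrow> M i dvd n) \<and> (\<not> (i < a \<and> A i) \<longrightarrow> (\<exists>x<w. (\<exists>y<w. n * x = M i * y + 1)))" for w n a i
  have good_d0: "d0 (\<lambda>e. good (f1 e) (f2 e) (f3 e) (f4 e))" if "trm f1" "trm f2" "trm f3" "trm f4" for f1 f2 f3 f4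
    unfolding good_def
    by (intro d0_intros d0_dvd trm_M that trm_shift[OF that(1)] trm_shift[OF that(2)] trm_shift[OF that(4)]
      trm_shift[OF trm_shift[OF that(1)]] trm_shift[OF trm_shift[OF that(2)]] trm_shift[OF trm_shift[OF that(4)]]
      d0_weaken1[OF A])
  have good_mono: "good w n a i \<Longrightarrow> w \<le> w' \<Longrightarrow> good w' n a i" for w w' n a i
    unfolding good_def by (meson less_le_trans)
  have good_inv: "\<exists>w. good w n a i" if "i < a \<and> A i \<Longrightarrow> M i dvd n" and unsel: "\<not> (i < a \<and> A i) \<Longrightarrow> inv_mod (M i) n" for n a i
  proof (cases "i < a \<and> A i")
    case False
    then obtain x y where "n * x = M i * y + 1" using unsel[OF False] unfolding inv_mod_def by blast
    moreover have "x < x + y + 1" "y < x + y + 1" by (simp_all only: less_Suc_iff_le) simp_all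
    ultimately show ?thesis unfolding good_def using False by blast
  qed (use that(1) in \<open>simp add: good_def\<close>)
  have good_collect: "\<exists>w. \<exists>n'<w. (\<forall>i<l. good w n' a i)"
    if "\<And>i. i < l \<Longrightarrow> \<exists>w. good w n a i" for n a
  proof -
    have "\<exists>b. \<forall>i<l. \<exists>w<b. good w n a i"
      by (rule collection[of "\<lambda>w i. good w n a i"]) (intro good_d0 d0_intros, rule that)
    then obtain b where b: "\<And>i. i < l \<Longrightarrow> \<exists>w<b. good w n a i" by blast
    have "good (max b (n + 1)) n a i" if "i < l" for i
      using b[OF that] good_mono by (meson max.cobounded1 less_imp_le order.trans)
    moreover have "n < max b (n + 1)" by (simp add: less_max_iff_disj)
    ultimately show ?thesis by blast
  qed
  have "\<exists>w. \<exists>n<w. (\<forall>i<l. good w n a i)" for a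
  proof (rule sigma1_induct[where P = "\<lambda>w a. \<exists>n<w. (\<forall>i<l. good w n a i)"])
    show "d0 (\<lambda>e. \<exists>n<e 0. (\<forall>i<l. good (e 0) n (e 1) i))"
      by (intro good_d0 d0_intros)
    show "\<exists>w. \<exists>n<w. (\<forall>i<l. good w n 0 i)"
      by (rule good_collect[of 1 0], rule good_inv) (auto simp: inv_mod_1)
  next
    fix a assume "\<exists>w. \<exists>n<w. (\<forall>i<l. good w n a i)"
    then obtain w n where n: "\<And>i. i < l \<Longrightarrow> good w n a i" by blast
    have sel: "M i dvd n" if "i < l" "i < a \<and> A i" for i using n that unfolding good_def by blast
    have unsel: "inv_mod (M i) n" if "i < l" "\<not> (i < a \<and> A i)" for i
      using n[OF that(1)] that(2) unfolding good_def inv_mod_def by blast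
    show "\<exists>w. \<exists>n<w. (\<forall>i<l. good w n (a + 1) i)"
    proof (cases "A a \<and> a < l")
      case True
      show ?thesis
      proof (rule good_collect[of "n * M a" "a + 1"], rule good_inv)
        fix i assume "i < l"
        show "M i dvd n * M a" if "i < a + 1 \<and> A i"
          using sel[OF \<open>i < l\<close>] that unfolding pre_less_Suc by (metis dvd_mult2 dvd_triv_right)
        show "inv_mod (M i) (n * M a)" if "\<not> (i < a + 1 \<and> A i)"
          using that True unsel[OF \<open>i < l\<close>] inv[of i a] \<open>i < l\<close> unfolding pre_less_Suc
          by (metis inv_mod_mult)
      qed
    next
      case False
      then have "i < a + 1 \<and> A i \<longleftrightarrow> i < a \<and> A i" if "i < l" for i using that pre_less_Suc by metis
      then show ?thesis by (intro good_collect[of n "a + 1"] good_inv) (use sel unsel in metis)+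
    qed
  qed
  then obtain w n where n: "\<And>i. i < l \<Longrightarrow> good w n l i" by blast
  have M: "1 < M i" for i
  proof -
    have "0 < m * (i + 1)" using \<open>0 < m\<close> by (simp add: pre_0_less_Suc)
    then show ?thesis unfolding M_def by simp
  qed
  have "M i dvd n \<longleftrightarrow> A i" if "i < l" for i
    using n[OF that] that inv_mod_not_dvd[of "M i" n] M unfolding good_def inv_mod_def by blast
  then have "dec (pair l (pair m n)) = {i. i < l \<and> A i}"
    by (auto simp: mem_dec_pair M_def)
  then show ?thesis by blast
qed

lemma code_empty: "dec 0 = {}"
  using dec_less pre_not_less_0 by blast

lemma code_insert: "\<exists>c. dec c = insert x (dec d)"
proof -
  have "\<exists>c. dec c = {i. i < x + d + 1 \<and> (i = x \<or> i \<in> dec d)}"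
    by (rule code_exists) (intro d0_intros d0_dec)
  then obtain c where c: "dec c = {i. i < x + d + 1 \<and> (i = x \<or> i \<in> dec d)}" ..
  have "i < x + d + 1" if "i \<in> dec d" for i
    using dec_less[OF that] unfolding less_Suc_iff_le by (simp add: add_increasing less_imp_le)
  moreover have "x < x + d + 1" unfolding less_Suc_iff_le by simp
  ultimately have "dec c = insert x (dec d)" unfolding c by blast
  then show ?thesis ..
qed

lemma code_union: "\<exists>c. dec c = dec c1 \<union> dec c2"
proof -
  have "\<exists>c. dec c = {i. i < c1 + c2 \<and> (i \<in> dec c1 \<or> i \<in> dec c2)}"
    by (rule code_exists) (intro d0_intros d0_dec)
  then obtain c where c: "dec c = {i. i < c1 + c2 \<and> (i \<in> dec c1 \<or> i \<in> dec c2)}" ..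
  have "i < c1 + c2" if "i \<in> dec c1" for i
    using dec_less[OF that] by (rule less_le_trans) simp
  moreover have "i < c1 + c2" if "i \<in> dec c2" for i
    using dec_less[OF that] by (rule less_le_trans) simp
  ultimately have "dec c = dec c1 \<union> dec c2" unfolding c by blast
  then show ?thesis ..
qed

section \<open>Computations\<close>

abbreviation ix :: "nat \<Rightarrow> 'a::rca0 \<Rightarrow> 'a"
  where "ix i a \<equiv> pair (of_nat i) a"

abbreviation tri :: "'a::rca0 \<Rightarrow> 'a \<Rightarrow> 'a \<Rightarrow> 'a"
  where "tri e x y \<equiv> pair e (pair x y)"

lemma val_numeral [simp]: "val std e (numeral_tm i) = of_nat i"
  by (induction i) (simp_all add: add.commute)

lemma val_index [simp]: "val std e (index_tm i a) = ix i (val std e a)"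
  by (simp add: index_tm_def)

lemma less_pair: "0 < x \<Longrightarrow> y < pair x y" for x y :: "'a::rca0"
  using add_le_pair[of x y] less_add_same_cancel2[of y x] by (metis less_le_trans)

lemma ix_less: "0 < i \<Longrightarrow> a < ix i (pair a b)" "0 < i \<Longrightarrow> b < ix i (pair a b)" "0 < i \<Longrightarrow> a < ix i a"
  using less_pair[of "of_nat i"] fst_le_pair[of a b] snd_le_pair[of b a] by (auto intro: le_less_trans)

lemma tri_mem_less:
  assumes "tri e x y \<in> dec d"
  shows "e < d" "x < d" "y < d" "pair x y < d"
proof -
  show *: "e < d" "pair x y < d"
    using dec_less[OF assms] fst_le_pair[of e] snd_le_pair[of _ e] by (metis le_less_trans)+
  then show "x < d" "y < d" using fst_le_pair[of x y] snd_le_pair[of y x] by (metis le_less_trans)+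
qed

definition JstB :: "'a::rca0 \<Rightarrow> 'a \<Rightarrow> 'a \<Rightarrow> 'a \<Rightarrow> 'a \<Rightarrow> bool" where
  "JstB h d e x y \<longleftrightarrow>
    (e = ix 0 0 \<and> y = 0) \<or> (e = ix 1 0 \<and> y = x + 1) \<or> (e = ix 2 0 \<and> y = x) \<or>
    (e = ix 3 0 \<and> (\<exists>b<d. x = pair y b)) \<or> (e = ix 4 0 \<and> (\<exists>b<d. x = pair b y)) \<or>
    (e = ix 5 0 \<and> (x \<in> dec h \<and> y = 1 \<or> x \<notin> dec h \<and> y = 0)) \<or>
    (\<exists>a<d. (\<exists>b<d. (\<exists>z<d. e = ix 6 (pair a b) \<and> tri b x z \<in> dec d \<and> tri a z y \<in> dec d))) \<or>
    (\<exists>a<d. (\<exists>b<d. (\<exists>z<d. (\<exists>w<d. e = ix 7 (pair a b) \<and> y = pair z w \<and>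
      tri a x z \<in> dec d \<and> tri b x w \<in> dec d)))) \<or>
    (\<exists>a<d. (\<exists>b<d. (\<exists>p<d. e = ix 8 (pair a b) \<and>
      (x = pair p 0 \<and> tri a p y \<in> dec d \<or>
       (\<exists>n<d. (\<exists>r<d. x = pair p (n + 1) \<and> tri e (pair p n) r \<in> dec d \<and>
         tri b (pair p (pair n r)) y \<in> dec d)))))) \<or>
    (\<exists>a<d. e = ix 9 a \<and> tri a (pair x y) 0 \<in> dec d \<and>
      (\<forall>i<y. (\<exists>r<d. tri a (pair x i) (r + 1) \<in> dec d)))"

lemma sat_justified: "sat std v S (justified h d e x y) \<longleftrightarrow>
    JstB (val std v h) (val std v d) (val std v e) (val std v x) (val std v y)"
  unfolding justified_def JstB_def value_in_def
  by (simp add: sat_in_code eval_nat_numeral del: of_nat_Suc)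

definition Comput :: "'a::rca0 \<Rightarrow> 'a \<Rightarrow> bool" where
  "Comput h d \<longleftrightarrow> (\<forall>e<d. (\<forall>x<d. (\<forall>y<d. tri e x y \<in> dec d \<longrightarrow> JstB h d e x y)))"

lemma sat_computation: "sat std v S (computation h d) \<longleftrightarrow> Comput (val std v h) (val std v d)"
  unfolding computation_def Comput_def value_in_def
  by (simp add: sat_in_code sat_justified eval_nat_numeral)

text \<open>The bounds in \<open>JstB\<close> are automatic for triples in the computation.\<close>

definition J :: "'a::rca0 set \<Rightarrow> 'a set \<Rightarrow> 'a \<Rightarrow> 'a \<Rightarrow> 'a \<Rightarrow> bool" where
  "J H D e x y \<longleftrightarrow>
    (e = ix 0 0 \<and> y = 0) \<or> (e = ix 1 0 \<and> y = x + 1) \<or> (e = ix 2 0 \<and> y = x) \<or>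
    (e = ix 3 0 \<and> (\<exists>b. x = pair y b)) \<or> (e = ix 4 0 \<and> (\<exists>b. x = pair b y)) \<or>
    (e = ix 5 0 \<and> (x \<in> H \<and> y = 1 \<or> x \<notin> H \<and> y = 0)) \<or>
    (\<exists>a b z. e = ix 6 (pair a b) \<and> tri b x z \<in> D \<and> tri a z y \<in> D) \<or>
    (\<exists>a b z w. e = ix 7 (pair a b) \<and> y = pair z w \<and> tri a x z \<in> D \<and> tri b x w \<in> D) \<or>
    (\<exists>a b p. e = ix 8 (pair a b) \<and>
      (x = pair p 0 \<and> tri a p y \<in> D \<or>
       (\<exists>n r. x = pair p (n + 1) \<and> tri e (pair p n) r \<in> D \<and> tri b (pair p (pair n r)) y \<in> D))) \<or>
    (\<exists>a. e = ix 9 a \<and> tri a (pair x y) 0 \<in> D \<and> (\<forall>i<y. (\<exists>r. tri a (pair x i) (r + 1) \<in> D)))"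

definition OK :: "'a::rca0 set \<Rightarrow> 'a set \<Rightarrow> bool"
  where "OK H D \<longleftrightarrow> (\<forall>e x y. tri e x y \<in> D \<longrightarrow> J H D e x y)"

lemma ex_bound_cong: "(\<And>a. Q a \<Longrightarrow> a < d) \<Longrightarrow> (\<And>a. P a \<longleftrightarrow> Q a) \<Longrightarrow> (\<exists>a<d. P a) \<longleftrightarrow> (\<exists>a. Q a)"
  by blast

lemma JstB_iff: "tri e x y \<in> dec d \<Longrightarrow> JstB h d e x y \<longleftrightarrow> J (dec h) (dec d) e x y"
proof -
  assume *: "tri e x y \<in> dec d"
  have b: "x = pair u w \<Longrightarrow> u < d \<and> w < d" for u w
    using tri_mem_less(2)[OF *] fst_le_pair[of u w] snd_le_pair[of w u] by (auto intro: le_less_trans)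
  have r: "r + 1 < d \<Longrightarrow> r < d" for r :: 'a by (rule less_trans[of r "r + 1"]) simp_all
  have n: "x = pair p (n + 1) \<Longrightarrow> n < d" for p n
    using b r by blast
  show ?thesis
    unfolding JstB_def J_def
  proof (intro disj_cong conj_cong refl)
    show "(\<exists>ba<d. x = pair y ba) \<longleftrightarrow> (\<exists>ba. x = pair y ba)" using b by blast
    show "(\<exists>ba<d. x = pair ba y) \<longleftrightarrow> (\<exists>ba. x = pair ba y)" using b by blast
    show "(\<exists>a<d. \<exists>b<d. \<exists>z<d. e = ix 6 (pair a b) \<and> tri b x z \<in> dec d \<and> tri a z y \<in> dec d) \<longleftrightarrow>
      (\<exists>a b z. e = ix 6 (pair a b) \<and> tri b x z \<in> dec d \<and> tri a z y \<in> dec d)"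
      by (intro ex_bound_cong refl; elim exE conjE; (erule tri_mem_less(1) | erule tri_mem_less(2) | erule tri_mem_less(3)))
    show "(\<exists>a<d. \<exists>b<d. \<exists>z<d. \<exists>w<d. e = ix 7 (pair a b) \<and> y = pair z w \<and> tri a x z \<in> dec d \<and> tri b x w \<in> dec d) \<longleftrightarrow>
      (\<exists>a b z w. e = ix 7 (pair a b) \<and> y = pair z w \<and> tri a x z \<in> dec d \<and> tri b x w \<in> dec d)"
      by (intro ex_bound_cong refl; elim exE conjE; (erule tri_mem_less(1) | erule tri_mem_less(2) | erule tri_mem_less(3)))
    \<comment> \<open>In each branch only one of \<open>a\<close> and \<open>b\<close> is visibly
      the index of a triple of \<open>d\<close>. The bounds therefore come from the index itself,
      which exceeds its components because of the positive tag.\<close>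
    have ab: "a < d \<and> b < d" if "e = ix 8 (pair a b)" for a b
      using tri_mem_less(1)[OF *] ix_less(1,2)[of 8 _ ] that by (meson less_trans zero_less_numeral)
    show "(\<exists>a<d. \<exists>b<d. \<exists>p<d. e = ix 8 (pair a b) \<and> (x = pair p 0 \<and> tri a p y \<in> dec d \<or>
        (\<exists>n<d. \<exists>r<d. x = pair p (n + 1) \<and> tri e (pair p n) r \<in> dec d \<and> tri b (pair p (pair n r)) y \<in> dec d))) \<longleftrightarrow>
      (\<exists>a b p. e = ix 8 (pair a b) \<and> (x = pair p 0 \<and> tri a p y \<in> dec d \<or>
        (\<exists>n r. x = pair p (n + 1) \<and> tri e (pair p n) r \<in> dec d \<and> tri b (pair p (pair n r)) y \<in> dec d)))"
      by (intro ex_bound_cong conj_cong disj_cong refl; elim exE conjE disjE; (erule tri_mem_less(3) | use ab b n in blast))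
    have r': "(\<exists>r<d. tri a (pair x i) (r + 1) \<in> dec d) \<longleftrightarrow> (\<exists>r. tri a (pair x i) (r + 1) \<in> dec d)" for a i
      using tri_mem_less(3) r by blast
    show "(\<exists>a<d. e = ix 9 a \<and> tri a (pair x y) 0 \<in> dec d \<and> (\<forall>i<y. \<exists>r<d. tri a (pair x i) (r + 1) \<in> dec d)) \<longleftrightarrow>
      (\<exists>a. e = ix 9 a \<and> tri a (pair x y) 0 \<in> dec d \<and> (\<forall>i<y. \<exists>r. tri a (pair x i) (r + 1) \<in> dec d))"
      unfolding r' by (intro ex_bound_cong refl; elim exE conjE; erule tri_mem_less(1))
  qed
qed

lemma Comput_iff: "Comput h d \<longleftrightarrow> OK (dec h) (dec d)"
proof
  show "Comput h d \<Longrightarrow> OK (dec h) (dec d)"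
    unfolding Comput_def OK_def by (meson JstB_iff tri_mem_less)
  show "OK (dec h) (dec d) \<Longrightarrow> Comput h d"
    unfolding Comput_def OK_def by (meson JstB_iff)
qed

lemma (in bounded_closed) T_of_nat: "T n (\<lambda>e. of_nat k)"
  by (induction k) (simp_all add: T_zero T_plus T_one add.commute)

lemma (in bounded_closed) P_Comput: "T n f \<Longrightarrow> T n g \<Longrightarrow> P n (\<lambda>e. Comput (f e) (g e))"
proof (rule P_subst2[of Comput])
  fix n i j :: nat
  assume "i < n" "j < n"
  then show "P n (\<lambda>e. Comput (e i) (e j))"
    unfolding Comput_def JstB_def by (intro basic P_dec T_of_nat) simp_all
qed

lemmas d0_Comput = d0.P_Comput

definition PhiM :: "'a::rca0 set \<Rightarrow> 'a \<Rightarrow> 'a \<Rightarrow> 'a \<Rightarrow> bool" where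
  "PhiM Y e x y \<longleftrightarrow> (\<exists>s h d. (\<forall>i<s. (i \<in> dec h \<longleftrightarrow> i \<in> Y)) \<and> d < s \<and> Comput h d \<and> tri e x y \<in> dec d)"

lemma sat_Phi:
  assumes "\<And>v t. sat std v S (Y t) \<longleftrightarrow> val std v t \<in> A"
  shows "sat std v S (Phi Y e x y) \<longleftrightarrow> PhiM A (val std v e) (val std v x) (val std v y)"
  unfolding Phi_def PhiM_def value_in_def
  by (simp add: sat_in_code sat_computation assms eval_nat_numeral)

primrec Jump :: "nat \<Rightarrow> 'a::rca0 set \<Rightarrow> 'a set" where
  "Jump 0 X = X"
| "Jump (Suc k) X = {t. \<exists>y. PhiM (Jump k X) t t y}"

lemma sat_jump: "sat std v S (jump k X t) \<longleftrightarrow> val std v t \<in> Jump k (S X)"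
proof (induction k arbitrary: v t)
  case (Suc k)
  show ?case by (simp add: sat_Phi[OF Suc])
qed simp

lemma J_agree: "J H D e x y \<Longrightarrow> (e = ix 5 0 \<Longrightarrow> x \<in> H \<longleftrightarrow> x \<in> H') \<Longrightarrow> J H' D e x y"
  unfolding J_def by blast

lemma J_simps:
  "J H D (ix 0 0) x y \<longleftrightarrow> y = 0"
  "J H D (ix 1 0) x y \<longleftrightarrow> y = x + 1"
  "J H D (ix 2 0) x y \<longleftrightarrow> y = x"
  "J H D (ix 3 0) x y \<longleftrightarrow> (\<exists>b. x = pair y b)"
  "J H D (ix 4 0) x y \<longleftrightarrow> (\<exists>b. x = pair b y)"
  "J H D (ix 5 0) x y \<longleftrightarrow> (x \<in> H \<and> y = 1 \<or> x \<notin> H \<and> y = 0)"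
  "J H D (ix 6 (pair a b)) x y \<longleftrightarrow> (\<exists>z. tri b x z \<in> D \<and> tri a z y \<in> D)"
  "J H D (ix 7 (pair a b)) x y \<longleftrightarrow> (\<exists>z w. y = pair z w \<and> tri a x z \<in> D \<and> tri b x w \<in> D)"
  "J H D (ix 8 (pair a b)) x y \<longleftrightarrow> (\<exists>p. x = pair p 0 \<and> tri a p y \<in> D \<or>
       (\<exists>n r. x = pair p (n + 1) \<and> tri (ix 8 (pair a b)) (pair p n) r \<in> D \<and> tri b (pair p (pair n r)) y \<in> D))"
  "J H D (ix 9 a) x y \<longleftrightarrow> tri a (pair x y) 0 \<in> D \<and> (\<forall>i<y. (\<exists>r. tri a (pair x i) (r + 1) \<in> D))"
  unfolding J_def by auto

lemma J_cases:
  assumes "J H D e x y"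
  obtains "e \<in> {ix 0 0, ix 1 0, ix 2 0, ix 3 0, ix 4 0, ix 5 0}" | a b where "e = ix 6 (pair a b)"
    | a b where "e = ix 7 (pair a b)" | a b where "e = ix 8 (pair a b)" | a where "e = ix 9 a"
proof -
  have "e \<in> {ix 0 0, ix 1 0, ix 2 0, ix 3 0, ix 4 0, ix 5 0} \<or> (\<exists>a b. e = ix 6 (pair a b)) \<or>
    (\<exists>a b. e = ix 7 (pair a b)) \<or> (\<exists>a b. e = ix 8 (pair a b)) \<or> (\<exists>a. e = ix 9 a)"
    using assms unfolding J_def by (elim disjE exE conjE) simp_all
  then show ?thesis using that by blast
qed

text \<open>\<open>D\<close> occurs only positively in the clauses; this is why unions of
  computations are computations.\<close>

lemma J_mono:
  assumes "J H D e x y" "D \<subseteq> D'"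
  shows "J H D' e x y"
proof (rule J_cases[OF assms(1)])
  assume "e \<in> {ix 0 0, ix 1 0, ix 2 0, ix 3 0, ix 4 0, ix 5 0}"
  then show ?thesis using assms(1) by (elim insertE emptyE) (simp_all only: J_simps)
next
  fix a b assume e: "e = ix 6 (pair a b)"
  show ?thesis using assms unfolding e J_simps by blast
next
  fix a b assume e: "e = ix 7 (pair a b)"
  show ?thesis using assms unfolding e J_simps by blast
next
  fix a b assume e: "e = ix 8 (pair a b)"
  show ?thesis using assms unfolding e J_simps by blast
next
  fix a assume e: "e = ix 9 a"
  show ?thesis using assms unfolding e J_simps by blast
qed

lemma add_one_neq_0 [simp]: "x + 1 \<noteq> 0" "0 \<noteq> x + 1" for x :: "'a::rca0"
  using pre_Suc_neq_0[of x] by simp_all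

text \<open>Induction on the index, as clauses refer to smaller indices. Primitive recursion refers
  to its own index and needs an inner induction on the recursion argument. Both formulas are bounded
  since all numbers in question lie below \<open>d\<close> or \<open>d'\<close>.\<close>

lemma determinate:
  assumes OK: "OK H (dec d)" "OK H (dec d')" and "tri e x y \<in> dec d" "tri e x y' \<in> dec d'"
  shows "y = y'"
proof -
  let ?A = "\<lambda>e. \<forall>x<d. (\<forall>y<d. (\<forall>y'. y' < d' \<longrightarrow>
    tri e x y \<in> dec d \<longrightarrow> tri e x y' \<in> dec d' \<longrightarrow> y = y'))"
  have "?A e"
  proof (rule delta0_less_induct[where A = ?A])
    show "d0 (\<lambda>e. ?A (e 0))" by (intro d0_intros d0_dec)
  next
    fix e assume "\<And>e'. e' < e \<Longrightarrow> ?A e'"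
    then have IH: "\<And>e' x y y'. e' < e \<Longrightarrow> tri e' x y \<in> dec d \<Longrightarrow> tri e' x y' \<in> dec d' \<Longrightarrow> y = y'"
      using tri_mem_less by blast
    have "y = y'" if D: "tri e x y \<in> dec d" "tri e x y' \<in> dec d'" for x y y'
    proof -
      have J1: "J H (dec d) e x y" and J2: "J H (dec d') e x y'" using OK D unfolding OK_def by blast+
      from J1 show ?thesis
      proof (cases rule: J_cases)
        case 1
        then show ?thesis using J1 J2 by (elim insertE emptyE) (auto simp only: J_simps pair_inject)
      next
        case (2 a b)
        then have less: "a < e" "b < e" by (simp_all add: ix_less del: of_nat_numeral)
        obtain z z' where "tri b x z \<in> dec d" "tri a z y \<in> dec d" "tri b x z' \<in> dec d'" "tri a z' y' \<in> dec d'"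
          using J1 J2 unfolding 2 J_simps by blast
        then show ?thesis using IH[OF less(1)] IH[OF less(2)] by metis
      next
        case (3 a b)
        then have less: "a < e" "b < e" by (simp_all add: ix_less del: of_nat_numeral)
        obtain z z' w w' where "tri a x z \<in> dec d" "tri b x w \<in> dec d" "tri a x z' \<in> dec d'" "tri b x w' \<in> dec d'"
          "y = pair z w" "y' = pair z' w'"
          using J1 J2 unfolding 3 J_simps by blast
        then show ?thesis using IH[OF less(1)] IH[OF less(2)] by metis
      next
        case (4 a b)
        then have less: "a < e" "b < e" by (simp_all add: ix_less del: of_nat_numeral)
        have J: "\<And>x y. tri e x y \<in> dec d \<Longrightarrow> J H (dec d) (ix 8 (pair a b)) x y"
          "\<And>x y. tri e x y \<in> dec d' \<Longrightarrow> J H (dec d') (ix 8 (pair a b)) x y"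
          using OK unfolding OK_def 4 by blast+
        obtain p n where p: "x = pair p n" using J1 unfolding 4 J_simps by blast
        let ?B = "\<lambda>n. \<forall>y<d. (\<forall>y'. y' < d' \<longrightarrow>
          tri e (pair p n) y \<in> dec d \<longrightarrow> tri e (pair p n) y' \<in> dec d' \<longrightarrow> y = y')"
        have "?B n"
        proof (rule delta0_induct[where P = ?B])
          show "d0 (\<lambda>e. ?B (e 0))" by (intro d0_intros d0_dec)
        next
          have "tri a p y \<in> dec d" if "tri e (pair p 0) y \<in> dec d" for y
            using J(1)[OF that] unfolding J_simps by auto
          moreover have "tri a p y \<in> dec d'" if "tri e (pair p 0) y \<in> dec d'" for y
            using J(2)[OF that] unfolding J_simps by auto
          ultimately show "?B 0" using IH[OF less(1)] by blast
        next
          fix n assume "?B n"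
          then have B: "\<And>y y'. tri e (pair p n) y \<in> dec d \<Longrightarrow> tri e (pair p n) y' \<in> dec d' \<Longrightarrow> y = y'"
            using tri_mem_less by blast
          have "\<exists>r. tri e (pair p n) r \<in> dec d \<and> tri b (pair p (pair n r)) y \<in> dec d"
            if "tri e (pair p (n + 1)) y \<in> dec d" for y
            using J(1)[OF that] unfolding J_simps 4 by auto
          moreover have "\<exists>r. tri e (pair p n) r \<in> dec d' \<and> tri b (pair p (pair n r)) y \<in> dec d'"
            if "tri e (pair p (n + 1)) y \<in> dec d'" for y
            using J(2)[OF that] unfolding J_simps 4 by auto
          ultimately show "?B (n + 1)" using IH[OF less(2)] B by metis
        qed
        then show ?thesis using D tri_mem_less(3) unfolding p by blast
      next
        case (5 a)
        then have less: "a < e" by (simp add: ix_less del: of_nat_numeral)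
        have *: "tri a (pair x y) 0 \<in> dec d" "\<And>i. i < y \<Longrightarrow> \<exists>r. tri a (pair x i) (r + 1) \<in> dec d"
          "tri a (pair x y') 0 \<in> dec d'" "\<And>i. i < y' \<Longrightarrow> \<exists>r. tri a (pair x i) (r + 1) \<in> dec d'"
          using J1 J2 unfolding 5 J_simps by blast+
        then have "\<not> y < y'" "\<not> y' < y" using IH[OF less] add_one_neq_0 by metis+
        then show ?thesis by simp
      qed
    qed
    then show "?A e" by blast
  qed
  then show ?thesis using assms tri_mem_less by blast
qed

section \<open>Computable functions\<close>

text \<open>The queries of the computations considered are bounded by \<open>v\<close>, so that the oracle matters
  only below \<open>v\<close>.\<close>

definition evD :: "'a::rca0 set \<Rightarrow> 'a \<Rightarrow> 'a \<Rightarrow> bool"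
  where "evD Y v d \<longleftrightarrow> OK Y (dec d) \<and> (\<forall>x y. tri (ix 5 0) x y \<in> dec d \<longrightarrow> x < v)"

definition ev :: "'a::rca0 set \<Rightarrow> 'a \<Rightarrow> 'a \<Rightarrow> 'a \<Rightarrow> 'a \<Rightarrow> bool"
  where "ev Y v e x y \<longleftrightarrow> (\<exists>d. evD Y v d \<and> tri e x y \<in> dec d)"

definition agree :: "'a::rca0 \<Rightarrow> 'a set \<Rightarrow> 'a set \<Rightarrow> bool"
  where "agree s A B \<longleftrightarrow> (\<forall>i<s. (i \<in> A \<longleftrightarrow> i \<in> B))"

text \<open>All initial segments are coded. A jump, which need not be a set of the model, may fail
  to have this property.\<close>

definition regular :: "'a::rca0 set \<Rightarrow> bool"
  where "regular Y \<longleftrightarrow> (\<forall>s. \<exists>h. agree s (dec h) Y)"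

lemma agree_sym: "agree s A B \<Longrightarrow> agree s B A"
  by (simp add: agree_def)

lemma agree_le: "agree s A B \<Longrightarrow> s' \<le> s \<Longrightarrow> agree s' A B"
  unfolding agree_def by (meson less_le_trans)

lemma OK_agree: "OK Y D \<Longrightarrow> (\<And>x y. tri (ix 5 0) x y \<in> D \<Longrightarrow> x \<in> Y \<longleftrightarrow> x \<in> Y') \<Longrightarrow> OK Y' D"
  unfolding OK_def using J_agree by blast

lemma OK_agree_code: "agree s Y Y' \<Longrightarrow> d \<le> s \<Longrightarrow> OK Y (dec d) \<longleftrightarrow> OK Y' (dec d)"
  unfolding agree_def using OK_agree tri_mem_less(2) by (meson less_le_trans)

lemma evD_agree: "agree v Y Y' \<Longrightarrow> evD Y v d \<longleftrightarrow> evD Y' v d"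
  unfolding evD_def agree_def using OK_agree by blast

lemma evD_mono: "evD Y v d \<Longrightarrow> v \<le> v' \<Longrightarrow> evD Y v' d"
  unfolding evD_def by (meson less_le_trans)

lemma ev_mono: "ev Y v e x y \<Longrightarrow> v \<le> v' \<Longrightarrow> ev Y v' e x y"
  unfolding ev_def using evD_mono by blast

text \<open>For a regular oracle the code demanded by \<open>PhiM\<close> can always be supplied at
  length \<open>d + 1\<close>, since all queries in \<open>d\<close> are below \<open>d\<close>. So
  computations may be taken relative to \<open>Y\<close> itself.\<close>

lemma PhiM_iff: "regular Y \<Longrightarrow> PhiM Y e x y \<longleftrightarrow> (\<exists>d. OK Y (dec d) \<and> tri e x y \<in> dec d)"
proof
  assume "PhiM Y e x y"
  then obtain s h d where *: "agree s (dec h) Y" "d < s" "OK (dec h) (dec d)" "tri e x y \<in> dec d"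
    unfolding PhiM_def Comput_iff agree_def by blast
  then have "OK Y (dec d)" using OK_agree_code[OF *(1), of d] by simp
  then show "\<exists>d. OK Y (dec d) \<and> tri e x y \<in> dec d" using * by blast
next
  assume "regular Y" "\<exists>d. OK Y (dec d) \<and> tri e x y \<in> dec d"
  then obtain d h where *: "OK Y (dec d)" "tri e x y \<in> dec d" "agree (d + 1) (dec h) Y" unfolding regular_def by blast
  then have "OK (dec h) (dec d)" using OK_agree_code[OF *(3), of d] by simp
  then show "PhiM Y e x y" unfolding PhiM_def Comput_iff using * unfolding agree_def
    by (intro exI[of _ "d + 1"] exI[of _ h] exI[of _ d]) simp
qed

lemma ev_PhiM: "regular Y \<Longrightarrow> ev Y v e x y \<Longrightarrow> PhiM Y e x y"
  unfolding ev_def evD_def using PhiM_iff by blast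

lemma ev_determinate: "ev Y v e x y \<Longrightarrow> OK Y (dec d) \<Longrightarrow> tri e x y' \<in> dec d \<Longrightarrow> y' = y"
  unfolding ev_def evD_def using determinate by blast

lemma evD_union: "evD Y v d \<Longrightarrow> evD Y v d' \<Longrightarrow> \<exists>d''. evD Y v d'' \<and> dec d \<subseteq> dec d'' \<and> dec d' \<subseteq> dec d''"
proof -
  assume *: "evD Y v d" "evD Y v d'"
  obtain c where c: "dec c = dec d \<union> dec d'" using code_union by blast
  have "evD Y v c" using * unfolding evD_def OK_def c by (metis J_mono Un_iff Un_upper1 Un_upper2)
  then show ?thesis using c by blast
qed

lemma evD_insert:
  assumes "evD Y v d" "J Y (dec d) e x y" "e = ix 5 0 \<Longrightarrow> x < v"
  shows "\<exists>d'. evD Y v d' \<and> dec d \<subseteq> dec d' \<and> tri e x y \<in> dec d'"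
proof -
  obtain c where c: "dec c = insert (tri e x y) (dec d)" using code_insert by blast
  have sub: "dec d \<subseteq> dec c" using c by blast
  have "J Y (dec c) e' x' y'" if "tri e' x' y' \<in> dec c" for e' x' y'
    using that assms(1,2) J_mono[OF _ sub] unfolding c evD_def OK_def by auto
  moreover have "x' < v" if "tri (ix 5 0) x' y' \<in> dec c" for x' y'
    using that assms(1,3) unfolding c evD_def by auto
  ultimately show ?thesis using c sub unfolding evD_def OK_def by blast
qed

lemma ev_insert: "evD Y v d \<Longrightarrow> J Y (dec d) e x y \<Longrightarrow> (e = ix 5 0 \<Longrightarrow> x < v) \<Longrightarrow> ev Y v e x y"
  unfolding ev_def using evD_insert by blast

lemma evD_0: "evD Y v 0"
  by (simp add: evD_def OK_def code_empty)

section \<open>Evaluation of the basic indices and operators\<close>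

lemma ev_zero: "ev Y v (ix 0 0) x 0"
  by (rule ev_insert[OF evD_0]) (simp_all add: J_simps del: of_nat_numeral of_nat_0 of_nat_1)

lemma ev_succ: "ev Y v (ix 1 0) x (x + 1)"
  by (rule ev_insert[OF evD_0]) (simp only: J_simps, simp)

lemma ev_id: "ev Y v (ix 2 0) x x"
  by (rule ev_insert[OF evD_0]) (simp only: J_simps, simp)

lemma ev_fst: "ev Y v (ix 3 0) (pair x y) x"
  by (rule ev_insert[OF evD_0]) (simp only: J_simps pair_inject, simp_all)

lemma ev_snd: "ev Y v (ix 4 0) (pair x y) y"
  by (rule ev_insert[OF evD_0]) (simp only: J_simps pair_inject, simp_all)

lemma ev_oracle: "x < v \<Longrightarrow> ev Y v (ix 5 0) x (if x \<in> Y then 1 else 0)"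
  by (rule ev_insert[OF evD_0]) (simp only: J_simps, simp_all)

lemma ev_comp: "ev Y v b x z \<Longrightarrow> ev Y v a z y \<Longrightarrow> ev Y v (ix 6 (pair a b)) x y"
proof -
  assume "ev Y v b x z" "ev Y v a z y"
  then obtain d where d: "evD Y v d" and D: "tri b x z \<in> dec d" "tri a z y \<in> dec d"
    unfolding ev_def using evD_union by (meson subsetD)
  show ?thesis by (rule ev_insert[OF d]) (unfold J_simps, use D in blast, simp)
qed

lemma ev_pair: "ev Y v a x z \<Longrightarrow> ev Y v b x w \<Longrightarrow> ev Y v (ix 7 (pair a b)) x (pair z w)"
proof -
  assume "ev Y v a x z" "ev Y v b x w"
  then obtain d where d: "evD Y v d" and D: "tri a x z \<in> dec d" "tri b x w \<in> dec d"
    unfolding ev_def using evD_union by (meson subsetD)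
  show ?thesis by (rule ev_insert[OF d]) (unfold J_simps, use D in blast, simp)
qed

lemma ev_rec_0: "ev Y v a p y \<Longrightarrow> ev Y v (ix 8 (pair a b)) (pair p 0) y"
proof -
  assume "ev Y v a p y"
  then obtain d where d: "evD Y v d" and D: "tri a p y \<in> dec d" unfolding ev_def by blast
  show ?thesis by (rule ev_insert[OF d]) (unfold J_simps, use D in blast, simp)
qed

lemma ev_rec_Suc: "ev Y v (ix 8 (pair a b)) (pair p n) r \<Longrightarrow> ev Y v b (pair p (pair n r)) y \<Longrightarrow>
  ev Y v (ix 8 (pair a b)) (pair p (n + 1)) y"
proof -
  assume "ev Y v (ix 8 (pair a b)) (pair p n) r" "ev Y v b (pair p (pair n r)) y"
  then obtain d where d: "evD Y v d" and D: "tri (ix 8 (pair a b)) (pair p n) r \<in> dec d" "tri b (pair p (pair n r)) y \<in> dec d"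
    unfolding ev_def using evD_union by (meson subsetD)
  show ?thesis by (rule ev_insert[OF d]) (unfold J_simps, use D in blast, simp)
qed

lemma d0_evD: "agree v (dec h) Y \<Longrightarrow> trm f \<Longrightarrow> d0 (\<lambda>e. evD Y v (f e))"
proof -
  assume *: "agree v (dec h) Y" and f: "trm f"
  have "evD Y v d \<longleftrightarrow> Comput h d \<and> (\<forall>x<d. (\<forall>y<d. tri (ix 5 0) x y \<in> dec d \<longrightarrow> x < v))" for d
    using evD_agree[OF *, of d] unfolding evD_def Comput_iff using tri_mem_less by blast
  then show ?thesis
    by (simp only:) (intro d0_intros d0_Comput d0_dec f trm_shift[OF f] trm_shift[OF trm_shift[OF f]])
qed

text \<open>The induction on \<open>n\<close> has a whole computation as its witness. It is Sigma_1
  because \<open>h\<close> stands in for the oracle and \<open>graph\<close> makes the intended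
  values definable by bounded formulas.\<close>

lemma ev_rec:
  assumes Y: "agree v (dec h) Y" and graph: "\<And>f g. trm f \<Longrightarrow> trm g \<Longrightarrow> d0 (\<lambda>e. f e = F (g e))"
    and 0: "ev Y v a p (F 0)" and Suc: "\<And>n. ev Y v b (pair p (pair n (F n))) (F (n + 1))"
  shows "ev Y v (ix 8 (pair a b)) (pair p n) (F n)"
proof -
  let ?e = "ix 8 (pair a b)"
  have "\<exists>d. evD Y v d \<and> (\<exists>r<d. r = F n \<and> tri ?e (pair p n) r \<in> dec d)"
  proof (rule sigma1_induct[where P = "\<lambda>d n. evD Y v d \<and> (\<exists>r<d. r = F n \<and> tri ?e (pair p n) r \<in> dec d)"])
    show "d0 (\<lambda>e. evD Y v (e 0) \<and> (\<exists>r<e 0. r = F (e 1) \<and> tri ?e (pair p (e 1)) r \<in> dec (e 0)))"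
      by (intro d0_intros graph d0_evD[OF Y] d0_dec)
  next
    show "\<exists>d. evD Y v d \<and> (\<exists>r<d. r = F 0 \<and> tri ?e (pair p 0) r \<in> dec d)"
      using ev_rec_0[OF 0, of b] tri_mem_less(3) unfolding ev_def by blast
  next
    fix n assume "\<exists>d. evD Y v d \<and> (\<exists>r<d. r = F n \<and> tri ?e (pair p n) r \<in> dec d)"
    then have "ev Y v ?e (pair p n) (F n)" unfolding ev_def by blast
    from ev_rec_Suc[OF this Suc]
    show "\<exists>d. evD Y v d \<and> (\<exists>r<d. r = F (n + 1) \<and> tri ?e (pair p (n + 1)) r \<in> dec d)"
      using tri_mem_less(3) unfolding ev_def by blast
  qed
  then show ?thesis unfolding ev_def by blast
qed

text \<open>Minimization needs one computation that contains the nonzero values at all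
  \<open>i < y\<close>, a possibly nonstandard number of them. Sigma_1 induction on \<open>m\<close>
  joins them one at a time.\<close>

lemma ev_min:
  assumes Y: "agree v (dec h) Y" and pos: "\<And>i. i < y \<Longrightarrow> \<exists>r. ev Y v a (pair x i) (r + 1)"
    and zero: "ev Y v a (pair x y) 0"
  shows "ev Y v (ix 9 a) x y"
proof -
  have "\<exists>d. evD Y v d \<and> (\<forall>i<m. i < y \<longrightarrow> (\<exists>r<d. tri a (pair x i) (r + 1) \<in> dec d))" for m
  proof (rule sigma1_induct[where P = "\<lambda>d m. evD Y v d \<and> (\<forall>i<m. i < y \<longrightarrow> (\<exists>r<d. tri a (pair x i) (r + 1) \<in> dec d))"])
    show "d0 (\<lambda>e. evD Y v (e 0) \<and> (\<forall>i<e 1. i < y \<longrightarrow> (\<exists>r<e 0. tri a (pair x i) (r + 1) \<in> dec (e 0))))"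
      by (intro d0_intros d0_evD[OF Y] d0_dec)
    show "\<exists>d. evD Y v d \<and> (\<forall>i<0. i < y \<longrightarrow> (\<exists>r<d. tri a (pair x i) (r + 1) \<in> dec d))"
      using evD_0 by (intro exI[of _ 0]) (simp add: evD_0)
  next
    fix m assume "\<exists>d. evD Y v d \<and> (\<forall>i<m. i < y \<longrightarrow> (\<exists>r<d. tri a (pair x i) (r + 1) \<in> dec d))"
    then obtain d where d: "evD Y v d" "\<And>i. i < m \<Longrightarrow> i < y \<Longrightarrow> \<exists>r. tri a (pair x i) (r + 1) \<in> dec d" by blast
    have r: "\<exists>r<d. tri a (pair x i) (r + 1) \<in> dec d" if ex: "\<exists>r. tri a (pair x i) (r + 1) \<in> dec d" for i d
    proof -
      obtain r where r: "tri a (pair x i) (r + 1) \<in> dec d" using ex by blast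
      have "r < r + 1" by simp
      then show ?thesis using r tri_mem_less(3)[OF r] less_trans by blast
    qed
    show "\<exists>d. evD Y v d \<and> (\<forall>i<m + 1. i < y \<longrightarrow> (\<exists>r<d. tri a (pair x i) (r + 1) \<in> dec d))"
    proof (cases "m < y")
      case True
      then obtain r d' where "evD Y v d'" "tri a (pair x m) (r + 1) \<in> dec d'" using pos unfolding ev_def by blast
      moreover obtain d'' where "evD Y v d''" "dec d \<subseteq> dec d''" "dec d' \<subseteq> dec d''"
        using evD_union[OF d(1) \<open>evD Y v d'\<close>] by blast
      ultimately have "evD Y v d''" "\<And>i. i < m + 1 \<Longrightarrow> i < y \<Longrightarrow> \<exists>r. tri a (pair x i) (r + 1) \<in> dec d''"
        using d(2) unfolding pre_less_Suc by blast+
      then show ?thesis using r by blast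
    next
      case False
      then show ?thesis using d r unfolding pre_less_Suc by blast
    qed
  qed
  then obtain d where d: "evD Y v d" "\<And>i. i < y \<Longrightarrow> \<exists>r. tri a (pair x i) (r + 1) \<in> dec d" by blast
  obtain d' where d': "evD Y v d'" "tri a (pair x y) 0 \<in> dec d'" using zero unfolding ev_def by blast
  obtain d'' where d'': "evD Y v d''" and D: "dec d \<subseteq> dec d''" "dec d' \<subseteq> dec d''"
    using evD_union[OF d(1) d'(1)] by blast
  show ?thesis by (rule ev_insert[OF d'']) (unfold J_simps, use D d(2) d'(2) in blast, simp)
qed

section \<open>Indices for arithmetic functions and bounded predicates\<close>

primrec enc :: "nat \<Rightarrow> (nat \<Rightarrow> 'a::rca0) \<Rightarrow> 'a" where
  "enc 0 e = 0"
| "enc (Suc n) e = pair (e 0) (enc n (\<lambda>i. e (Suc i)))"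

text \<open>With query bound 0 the oracle is never consulted, so these facts hold for every
  \<open>Y\<close>, regular or not. One index serves all assignments.\<close>

definition cfun :: "'a::rca0 set \<Rightarrow> nat \<Rightarrow> ((nat \<Rightarrow> 'a) \<Rightarrow> 'a) \<Rightarrow> bool"
  where "cfun Y n f \<longleftrightarrow> (\<exists>E. \<forall>e. ev Y 0 E (enc n e) (f e))"

text \<open>Definability by bounded formulas is carried along with computability, since the search
  behind a bounded quantifier stops only by the least number principle.\<close>

definition cterm :: "'a::rca0 set \<Rightarrow> nat \<Rightarrow> ((nat \<Rightarrow> 'a) \<Rightarrow> 'a) \<Rightarrow> bool"
  where "cterm Y n f \<longleftrightarrow> trm f \<and> cfun Y n f"

text \<open>The value 0 stands for truth.\<close>

definition cpred :: "'a::rca0 set \<Rightarrow> nat \<Rightarrow> ((nat \<Rightarrow> 'a) \<Rightarrow> bool) \<Rightarrow> bool"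
  where "cpred Y n A \<longleftrightarrow> d0 A \<and> (\<exists>f. cfun Y n f \<and> (\<forall>e. f e = 0 \<longleftrightarrow> A e))"

lemma agree_0: "agree 0 A B"
  by (simp add: agree_def)

lemma cfun_op:
  assumes "\<And>x y. ev Y 0 G (pair x y) (g x y)" "cfun Y n f1" "cfun Y n f2"
  shows "cfun Y n (\<lambda>e. g (f1 e) (f2 e))"
proof -
  obtain E1 E2 where "\<And>e. ev Y 0 E1 (enc n e) (f1 e)" "\<And>e. ev Y 0 E2 (enc n e) (f2 e)"
    using assms(2,3) unfolding cfun_def by blast
  then show ?thesis unfolding cfun_def using ev_comp[OF ev_pair assms(1)] by blast
qed

lemma ev_plus: "\<exists>E. \<forall>x y. ev (Y :: 'a::rca0 set) 0 E (pair x y) (x + y)"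
proof (intro exI allI)
  fix p n
  show "ev Y 0 (ix 8 (pair (ix 2 0) (ix 6 (pair (ix 1 0) (ix 6 (pair (ix 4 0) (ix 4 0))))))) (pair p n) (p + n)"
  proof (rule ev_rec[where F = "\<lambda>n. p + n" and h = 0])
    show "ev Y 0 (ix 2 0) p (p + 0)" using ev_id by simp
    show "ev Y 0 (ix 6 (pair (ix 1 0) (ix 6 (pair (ix 4 0) (ix 4 0))))) (pair p (pair n (p + n))) (p + (n + 1))" for n
      unfolding add.assoc[symmetric] by (rule ev_comp[OF ev_comp[OF ev_snd ev_snd] ev_succ])
  qed (rule agree_0, intro d0_intros)
qed

lemma ev_times: "\<exists>E. \<forall>x y. ev (Y :: 'a::rca0 set) 0 E (pair x y) (x * y)"
proof -
  obtain P where P: "\<And>x y. ev Y 0 P (pair x y) (x + y)" using ev_plus by blast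
  show ?thesis
  proof (intro exI allI)
    fix p n
    show "ev Y 0 (ix 8 (pair (ix 0 0) (ix 6 (pair P (ix 7 (pair (ix 6 (pair (ix 4 0) (ix 4 0))) (ix 3 0))))))) (pair p n) (p * n)"
    proof (rule ev_rec[where F = "\<lambda>n. p * n" and h = 0])
      show "ev Y 0 (ix 0 0) p (p * 0)" using ev_zero by simp
      show "ev Y 0 (ix 6 (pair P (ix 7 (pair (ix 6 (pair (ix 4 0) (ix 4 0))) (ix 3 0))))) (pair p (pair n (p * n))) (p * (n + 1))" for n
        unfolding distrib_left mult_1_right by (rule ev_comp[OF ev_pair[OF ev_comp[OF ev_snd ev_snd] ev_fst] P])
    qed (rule agree_0, intro d0_intros)
  qed
qed

lemma ev_pred: "\<exists>E. \<forall>x. ev (Y :: 'a::rca0 set) 0 E x (x - 1)"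
proof (intro exI allI)
  fix n
  \<comment> \<open>The recursion ignores the previous value and returns its counter. Its parameter
    is a dummy 0, supplied by the outer composition below.\<close>
  have "ev Y 0 (ix 8 (pair (ix 0 0) (ix 6 (pair (ix 3 0) (ix 4 0))))) (pair 0 n) (n - 1)"
  proof (rule ev_rec[where F = "\<lambda>n. n - 1" and h = 0])
    fix f g :: "(nat \<Rightarrow> 'a) \<Rightarrow> 'a" assume "trm f" "trm g"
    \<comment> \<open>Subtraction is not in the language, so its graph is expressed by
      addition.\<close>
    then have "d0 (\<lambda>e. g e = 0 \<and> f e = 0 \<or> g e = f e + 1)" by (intro d0_intros)
    moreover have "b = 0 \<and> a = 0 \<or> b = a + 1 \<longleftrightarrow> a = b - 1" for a b :: 'a
      using pre_eq_0_or_Suc[of b] by auto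
    ultimately show "d0 (\<lambda>e. f e = g e - 1)" by simp
  next
    show "ev Y 0 (ix 0 0) 0 (0 - 1)" using ev_zero by simp
    show "ev Y 0 (ix 6 (pair (ix 3 0) (ix 4 0))) (pair 0 (pair n (n - 1))) (n + 1 - 1)" for n
      unfolding add_diff_cancel_right' by (rule ev_comp[OF ev_snd ev_fst])
  qed (rule agree_0)
  then show "ev Y 0 (ix 6 (pair (ix 8 (pair (ix 0 0) (ix 6 (pair (ix 3 0) (ix 4 0))))) (ix 7 (pair (ix 0 0) (ix 2 0))))) n (n - 1)"
    by (intro ev_comp[OF ev_pair[OF ev_zero ev_id]])
qed

lemma ev_diff: "\<exists>E. \<forall>x y. ev (Y :: 'a::rca0 set) 0 E (pair x y) (x - y)"
proof -
  obtain P where P: "\<And>x. ev Y 0 P x (x - 1)" using ev_pred by blast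
  show ?thesis
  proof (intro exI allI)
    fix p n
    show "ev Y 0 (ix 8 (pair (ix 2 0) (ix 6 (pair P (ix 6 (pair (ix 4 0) (ix 4 0))))))) (pair p n) (p - n)"
    proof (rule ev_rec[where F = "\<lambda>n. p - n" and h = 0])
      fix f g :: "(nat \<Rightarrow> 'a) \<Rightarrow> 'a" assume "trm f" "trm g"
      then have "d0 (\<lambda>e. p = f e + g e \<or> p < g e \<and> f e = 0)" by (intro d0_intros)
      moreover have "p = a + b \<or> p < b \<and> a = 0 \<longleftrightarrow> a = p - b" for a b :: 'a
        using le_add_diff_inverse2[of b p] diff_eq_0[of p b] by (metis add_diff_cancel_right' le_add_same_cancel2 less_imp_le not_less zero_le)
      ultimately show "d0 (\<lambda>e. f e = p - g e)" by simp
    next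
      show "ev Y 0 (ix 2 0) p (p - 0)" using ev_id by simp
      show "ev Y 0 (ix 6 (pair P (ix 6 (pair (ix 4 0) (ix 4 0))))) (pair p (pair n (p - n))) (p - (n + 1))" for n
        unfolding diff_diff_add[symmetric] by (rule ev_comp[OF ev_comp[OF ev_snd ev_snd] P])
    qed (rule agree_0)
  qed
qed

lemma cfun_plus: "cfun Y n f \<Longrightarrow> cfun Y n g \<Longrightarrow> cfun Y n (\<lambda>e. f e + g e)"
  using ev_plus cfun_op by blast

lemma cfun_times: "cfun Y n f \<Longrightarrow> cfun Y n g \<Longrightarrow> cfun Y n (\<lambda>e. f e * g e)"
  using ev_times cfun_op by blast

lemma cfun_diff: "cfun Y n f \<Longrightarrow> cfun Y n g \<Longrightarrow> cfun Y n (\<lambda>e. f e - g e)"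
  using ev_diff cfun_op by blast

lemma cfun_zero: "cfun Y n (\<lambda>e. 0)"
  unfolding cfun_def using ev_zero by blast

lemma cfun_one: "cfun Y n (\<lambda>e. 1)"
  unfolding cfun_def using ev_comp[OF ev_zero ev_succ] by fastforce

lemma cfun_shift: "cfun Y n f \<Longrightarrow> cfun Y (Suc n) (\<lambda>e. f (\<lambda>i. e (Suc i)))"
  unfolding cfun_def enc.simps using ev_comp[OF ev_snd] by blast

lemma cfun_var: "i < n \<Longrightarrow> cfun Y n (\<lambda>e. e i)"
proof (induction i arbitrary: n)
  case 0
  then obtain m where "n = Suc m" using not0_implies_Suc by blast
  then show ?case unfolding cfun_def using ev_fst by (metis enc.simps(2))
next
  case (Suc i)
  then obtain m where m: "n = Suc m" "i < m" by (metis Suc_lessE)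
  then show ?case using cfun_shift[OF Suc.IH[OF m(2)]] by simp
qed

text \<open>All variables except the first become parameters, as the least number principle for a
  single variable requires.\<close>

lemma d0_fix: "d0 A \<Longrightarrow> d0 (\<lambda>e. A (case_nat (e 0) r))"
proof -
  assume "d0 A"
  then obtain \<theta> p S where \<theta>: "Delta0 \<theta>" "range S \<subseteq> sets" "\<And>e. A e \<longleftrightarrow> sat std (merge e p) S \<theta>"
    unfolding d0_def by metis
  let ?\<sigma> = "\<lambda>j. Var (if j = 0 then 0 else if even j then 2 * j - 3 else 2 * j + 1)"
  have "val std (merge e (merge r p)) (?\<sigma> j) = merge (case_nat (e 0) r) p j" for e j
  proof (cases "even j")
    case True
    then obtain i where i: "j = 2 * i" by blast
    show ?thesis
    proof (cases i)
      case (Suc k)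
      have "2 * j - 3 = Suc (2 * (2 * k))" using i Suc by simp
      then show ?thesis using i Suc merge_simps(2)[of e "merge r p" "2 * k"] merge_simps(1)[of "case_nat (e 0) r" p i]
        by simp
    qed (simp add: i merge_def)
  next
    case False
    then obtain k where k: "j = Suc (2 * k)" by (metis oddE Suc_eq_plus1)
    have "2 * j + 1 = Suc (2 * (Suc (2 * k)))" using k by simp
    then show ?thesis using k False merge_simps(2)[of e "merge r p" "Suc (2 * k)"] by simp
  qed
  then have "A (case_nat (e 0) r) \<longleftrightarrow> sat std (merge e (merge r p)) S (subst ?\<sigma> \<theta>)" for e
    by (simp only: \<theta>(3) sat_subst)
  then show ?thesis unfolding d0_def using \<theta> Delta0_subst by blast
qed

lemma diff_eq_0_iff: "x - y = 0 \<longleftrightarrow> x \<le> y" for x y :: "'a::rca0"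
proof
  assume *: "x - y = 0"
  show "x \<le> y"
  proof (rule ccontr)
    assume "\<not> x \<le> y"
    then have "y \<le> x" by simp
    then have "x - y + y = x" by (rule le_add_diff_inverse2)
    then have "0 + y = x" unfolding * .
    then show False using \<open>\<not> x \<le> y\<close> by simp
  qed
qed (rule diff_eq_0)

lemma one_diff_eq_0: "1 - x = 0 \<longleftrightarrow> x \<noteq> 0" for x :: "'a::rca0"
  unfolding diff_eq_0_iff using less_one_iff[of x] not_less[of x 1] by simp

text \<open>The product \<open>(f e - i) * (1 - F (case_nat i e))\<close> vanishes exactly if
  \<open>i\<close> has reached \<open>f e\<close> or is a counterexample. Its least zero
  \<open>i\<close> exists, and \<open>f e - i\<close> is 0 exactly if no counterexample occurs below
  \<open>f e\<close>.\<close>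

lemma cpred_ball:
  assumes "cpred Y (Suc n) (\<lambda>e. C (e 0) (\<lambda>i. e (Suc i)))" "cterm Y n f"
  shows "cpred Y n (\<lambda>e. \<forall>x<f e. C x e)"
proof -
  obtain F where F: "cfun Y (Suc n) F" "\<And>e. F e = 0 \<longleftrightarrow> C (e 0) (\<lambda>i. e (Suc i))"
    and C: "d0 (\<lambda>e. C (e 0) (\<lambda>i. e (Suc i)))"
    using assms(1) unfolding cpred_def by blast
  obtain EF where EF: "\<And>e. ev Y 0 EF (enc (Suc n) e) (F e)" using F(1) unfolding cfun_def by blast
  obtain Ef where Ef: "\<And>e. ev Y 0 Ef (enc n e) (f e)" and "trm f" using assms(2) unfolding cterm_def cfun_def by blast
  obtain M where M: "\<And>x y. ev Y 0 M (pair x y) (x - y)" using ev_diff by blast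
  obtain T where T: "\<And>x y. ev Y 0 T (pair x y) (x * y)" using ev_times by blast
  have one: "ev Y 0 (ix 6 (pair (ix 1 0) (ix 0 0))) x 1" for x using ev_comp[OF ev_zero ev_succ] by fastforce
  have "\<exists>a. \<forall>e i. ev Y 0 a (pair (enc n e) i) ((f e - i) * (1 - F (case_nat i e)))"
  proof (intro exI allI)
    fix e i
    have "ev Y 0 EF (pair i (enc n e)) (F (case_nat i e))" using EF[of "case_nat i e"] by simp
    from ev_comp[OF ev_pair[OF ev_comp[OF ev_pair[OF ev_comp[OF ev_fst Ef] ev_snd] M]
        ev_comp[OF ev_pair[OF one ev_comp[OF ev_pair[OF ev_snd ev_fst] this]] M]] T]
    show "ev Y 0 (ix 6 (pair T (ix 7 (pair (ix 6 (pair M (ix 7 (pair (ix 6 (pair Ef (ix 3 0))) (ix 4 0)))))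
      (ix 6 (pair M (ix 7 (pair (ix 6 (pair (ix 1 0) (ix 0 0))) (ix 6 (pair EF (ix 7 (pair (ix 4 0) (ix 3 0)))))))))))))
      (pair (enc n e) i) ((f e - i) * (1 - F (case_nat i e)))" .
  qed
  then obtain a where a: "\<And>e i. ev Y 0 a (pair (enc n e) i) ((f e - i) * (1 - F (case_nat i e)))" by blast
  have zero: "(f e - i) * (1 - F (case_nat i e)) = 0 \<longleftrightarrow> \<not> i < f e \<or> \<not> C i e" for e i
    by (simp only: mult_eq_0_iff one_diff_eq_0 F(2)) (simp add: diff_eq_0_iff not_less)
  have "\<exists>r. ev Y 0 (ix 6 (pair M (ix 7 (pair Ef (ix 9 a))))) (enc n e) r \<and> (r = 0 \<longleftrightarrow> (\<forall>x<f e. C x e))" for e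
  proof -
    have "d0 (\<lambda>u. C (u 0) e)" using d0_fix[OF C, of e] by simp
    then have D: "d0 (\<lambda>u. \<not> u 0 < f e \<or> \<not> C (u 0) e)" by (intro d0_intros)
    have "\<not> f e < f e \<or> \<not> C (f e) e" by simp
    from delta0_least[of "\<lambda>i. \<not> i < f e \<or> \<not> C i e", OF D this]
    obtain i where i: "\<not> i < f e \<or> \<not> C i e" and "\<And>j. j < i \<Longrightarrow> \<not> (\<not> j < f e \<or> \<not> C j e)"
      by blast
    then have i': "\<And>j. j < i \<Longrightarrow> j < f e \<and> C j e" by blast
    have "ev Y 0 (ix 9 a) (enc n e) i"
    proof (rule ev_min[where h = 0])
      show "ev Y 0 a (pair (enc n e) i) 0" using a[of e i] i zero by metis
      fix j assume "j < i"
      then have "(f e - j) * (1 - F (case_nat j e)) \<noteq> 0" using i' zero by blast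
      then show "\<exists>r. ev Y 0 a (pair (enc n e) j) (r + 1)" using a[of e j] not_0_obtain by metis
    qed (rule agree_0)
    from ev_comp[OF ev_pair[OF Ef this] M]
    have "ev Y 0 (ix 6 (pair M (ix 7 (pair Ef (ix 9 a))))) (enc n e) (f e - i)" .
    moreover have "f e - i = 0 \<longleftrightarrow> (\<forall>x<f e. C x e)"
      unfolding diff_eq_0_iff using i i' by (meson leD leI less_le_trans)
    ultimately show ?thesis by blast
  qed
  then obtain r where r: "\<And>e. ev Y 0 (ix 6 (pair M (ix 7 (pair Ef (ix 9 a))))) (enc n e) (r e)"
    "\<And>e. r e = 0 \<longleftrightarrow> (\<forall>x<f e. C x e)" by metis
  have "cfun Y n r" unfolding cfun_def using r(1) by blast
  moreover have "d0 (\<lambda>e. \<forall>x<f e. C x e)" by (rule d0_ball[OF C \<open>trm f\<close>])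
  ultimately show ?thesis unfolding cpred_def using r(2) by blast
qed

interpretation c: bounded_closed "cterm Y" "cpred Y" for Y :: "'a::rca0 set"
proof
  fix n :: nat and f g :: "(nat \<Rightarrow> 'a) \<Rightarrow> 'a" and A B :: "(nat \<Rightarrow> 'a) \<Rightarrow> bool"
  show "i < n \<Longrightarrow> cterm Y n (\<lambda>e. e i)" for i by (simp add: cterm_def cfun_var trm_var)
  show "cterm Y n (\<lambda>e. 0)" by (simp add: cterm_def cfun_zero trm_const)
  show "cterm Y n (\<lambda>e. 1)" by (simp add: cterm_def cfun_one trm_const)
  show "cterm Y n f \<Longrightarrow> cterm Y n g \<Longrightarrow> cterm Y n (\<lambda>e. f e + g e)" by (simp add: cterm_def cfun_plus trm_plus)
  show "cterm Y n f \<Longrightarrow> cterm Y n g \<Longrightarrow> cterm Y n (\<lambda>e. f e * g e)" by (simp add: cterm_def cfun_times trm_times)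
  show "cterm Y n f \<Longrightarrow> cterm Y (Suc n) (\<lambda>e. f (\<lambda>i. e (Suc i)))" by (simp add: cterm_def cfun_shift trm_shift)
  show "cpred Y n (\<lambda>e. f e = g e)" if "cterm Y n f" "cterm Y n g"
    unfolding cpred_def
  proof (intro conjI exI allI)
    show "d0 (\<lambda>e. f e = g e)" using that by (simp add: cterm_def d0_eq)
    show "cfun Y n (\<lambda>e. (f e - g e) + (g e - f e))"
      using that by (simp add: cterm_def cfun_plus cfun_diff)
    show "(f e - g e) + (g e - f e) = 0 \<longleftrightarrow> f e = g e" for e
      by (auto simp: diff_eq_0_iff add_eq_0_iff_both_eq_0)
  qed
  show "cpred Y n (\<lambda>e. f e < g e)" if "cterm Y n f" "cterm Y n g"
    unfolding cpred_def
  proof (intro conjI exI allI)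
    show "d0 (\<lambda>e. f e < g e)" using that by (simp add: cterm_def d0_less)
    show "cfun Y n (\<lambda>e. f e + 1 - g e)"
      using that by (simp add: cterm_def cfun_plus cfun_diff cfun_one)
    show "f e + 1 - g e = 0 \<longleftrightarrow> f e < g e" for e
      by (simp add: diff_eq_0_iff Suc_le_iff_less)
  qed
  show "cpred Y n (\<lambda>e. False)"
    unfolding cpred_def using d0_False cfun_one[of Y n] by (intro conjI exI[of _ "\<lambda>e. 1"]) simp_all
  show "cpred Y n (\<lambda>e. A e \<longrightarrow> B e)" if AB: "cpred Y n A" "cpred Y n B"
  proof -
    obtain u w where *: "cfun Y n u" "\<And>e. u e = 0 \<longleftrightarrow> A e" "cfun Y n w" "\<And>e. w e = 0 \<longleftrightarrow> B e" "d0 A" "d0 B"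
      using AB unfolding cpred_def by blast
    \<comment> \<open>With 0 for truth, \<open>1 - u e\<close> vanishes exactly when
      \<open>A e\<close> fails.\<close>
    have "cfun Y n (\<lambda>e. (1 - u e) * w e)" by (intro cfun_times cfun_diff cfun_one *)
    moreover have "(1 - u e) * w e = 0 \<longleftrightarrow> (A e \<longrightarrow> B e)" for e by (auto simp: one_diff_eq_0 *)
    moreover have "d0 (\<lambda>e. A e \<longrightarrow> B e)" by (intro d0_imp *)
    ultimately show ?thesis unfolding cpred_def by blast
  qed
  show "cpred Y n (\<lambda>e. \<forall>x<f e. C x e)"
    if "cpred Y (Suc n) (\<lambda>e. C (e 0) (\<lambda>i. e (Suc i)))" "cterm Y n f" for C
    by (rule cpred_ball[OF that])
qed

section \<open>Jumps decide bounded parts of $\Sigma_1$ sets\<close>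

text \<open>The index \<open>self_ix a x\<close> contains the parameter \<open>x\<close>, which need not be standard, and the function
  can read it off when applied to its own index: \<open>e\<close> is first mapped to \<open>(e, 0)\<close>, at which the primitive recursion
  ignores \<open>x\<close> and applies \<open>a\<close> to \<open>e\<close>.\<close>

definition self_ix :: "'a::rca0 \<Rightarrow> 'a \<Rightarrow> 'a"
  where "self_ix a x = ix 6 (pair (ix 8 (pair a x)) (ix 7 (pair (ix 2 0) (ix 0 0))))"

lemma ev_self: "ev Y v a (self_ix a x) y \<Longrightarrow> ev Y v (self_ix a x) (self_ix a x) y"
  by (subst (1) self_ix_def) (intro ev_comp[OF ev_pair[OF ev_id ev_zero]] ev_rec_0)

text \<open>The converse of \<open>ev_self\<close>: determinacy forces the intermediate value to be
  \<open>(e, 0)\<close>, so any computation of the diagonal value contains one of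
  \<open>a\<close>.\<close>

lemma self_ix_value:
  assumes OK: "OK Y (dec d)" and "tri (self_ix a x) (self_ix a x) y \<in> dec d"
  shows "tri a (self_ix a x) y \<in> dec d"
proof -
  have J: "tri e x y \<in> dec d \<Longrightarrow> J Y (dec d) e x y" for e x y using OK unfolding OK_def by blast
  have "J Y (dec d) (ix 6 (pair (ix 8 (pair a x)) (ix 7 (pair (ix 2 0) (ix 0 0))))) (self_ix a x) y"
    using J[OF assms(2)] by (subst (asm) (1) self_ix_def)
  then obtain z where z: "tri (ix 7 (pair (ix 2 0) (ix 0 0))) (self_ix a x) z \<in> dec d"
    "tri (ix 8 (pair a x)) z y \<in> dec d" unfolding J_simps by blast
  have "z = pair (self_ix a x) 0" using ev_determinate[OF ev_pair[OF ev_id ev_zero] OK z(1)] .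
  then have "J Y (dec d) (ix 8 (pair a x)) (pair (self_ix a x) 0) y" using J[OF z(2)] by simp
  then show ?thesis unfolding J_simps by auto
qed

text \<open>A property that is Sigma_1 in \<open>Y\<close> becomes membership of an index in the
  jump, uniformly in the possibly nonstandard \<open>x\<close>. The function \<open>ix 9 q\<close>
  searches for a suitable \<open>Z = pair z H\<close>. Minimizing \<open>chk\<close> finds the least
  \<open>i\<close> that reaches \<open>z\<close> or at which \<open>H\<close> and the oracle
  disagree; \<open>H\<close> is correct below \<open>z\<close> exactly if this \<open>i\<close> is
  not below \<open>z\<close>. Testing \<open>Z\<close> queries the oracle only up to
  \<open>Z\<close>, so a coded piece of \<open>Y\<close> suffices.\<close>

theorem universal:
  fixes Y :: "'a::rca0 set"
  assumes Y: "regular Y"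
    and B: "\<And>n i j k. i < n \<Longrightarrow> j < n \<Longrightarrow> k < n \<Longrightarrow> cpred Y n (\<lambda>e. B (e i) (e j) (e k))"
  shows "\<exists>a. \<forall>x. (\<exists>y. PhiM Y (self_ix a x) (self_ix a x) y) \<longleftrightarrow> (\<exists>z H. agree z (dec H) Y \<and> B x z H)"
proof -
  \<comment> \<open>\<open>A i Z o'\<close>: position \<open>i\<close> is within the claimed segment
    and the oracle answer \<open>o'\<close> confirms it. \<open>C\<close> is evaluated at the first
    position where this fails; it reads \<open>x\<close> off the index \<open>E\<close>.\<close>
  define A where "A i Z o' \<longleftrightarrow> (\<exists>z<Z + 1. (\<exists>H<Z + 1. Z = pair z H \<and> i < z \<and> (o' = 1 \<longleftrightarrow> i \<in> dec H)))" for i Z o' :: 'a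
  define C where "C i E Z \<longleftrightarrow> (\<exists>z<Z + 1. (\<exists>H<Z + 1. Z = pair z H \<and> \<not> i < z \<and>
    (\<exists>x<E + 1. (\<exists>a<E + 1. (\<exists>w<E + 1. E = ix 6 (pair (ix 8 (pair a x)) w) \<and> B x z H)))))" for i E Z :: 'a
  have "cpred Y 4 (\<lambda>e. \<not> A (e 0) (e 2) (e 3))"
    unfolding A_def by (intro c.basic c.P_dec) simp_all
  then obtain FA EA where EA: "\<And>e. ev Y 0 EA (enc 4 e) (FA e)" and FA: "\<And>e. FA e = 0 \<longleftrightarrow> \<not> A (e 0) (e 2) (e 3)"
    unfolding cpred_def cfun_def by blast
  have "cpred Y 3 (\<lambda>e. C (e 0) (e 1) (e 2))"
    unfolding C_def by (intro c.basic c.T_of_nat B) simp_all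
  then obtain FC EC where EC: "\<And>e. ev Y 0 EC (enc 3 e) (FC e)" and FC: "\<And>e. FC e = 0 \<longleftrightarrow> C (e 0) (e 1) (e 2)"
    unfolding cpred_def cfun_def by blast
  define env :: "'a list \<Rightarrow> nat \<Rightarrow> 'a" where "env xs i = xs ! i" for xs i
  define bit where "bit i = (if i \<in> Y then 1 else 0 :: 'a)" for i
  \<comment> \<open>At \<open>((E, Z), i)\<close> this assembles the arguments of \<open>EA\<close>,
    and its only oracle query is at \<open>i\<close>.\<close>
  define chk where "chk = ix 6 (pair EA (ix 7 (pair (ix 4 0) (ix 7 (pair (ix 6 (pair (ix 3 0) (ix 3 0)))
    (ix 7 (pair (ix 6 (pair (ix 4 0) (ix 3 0))) (ix 7 (pair (ix 6 (pair (ix 5 0) (ix 4 0))) (ix 0 0))))))))))"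
  have chk: "ev Y v chk (pair (pair E Z) i) (FA (env [i, E, Z, bit i]))" if "i < v" for v E Z i
  proof -
    have "ev Y v EA (pair i (pair E (pair Z (pair (bit i) 0)))) (FA (env [i, E, Z, bit i]))"
      using ev_mono[OF EA[of "env [i, E, Z, bit i]"], of v] by (simp add: eval_nat_numeral env_def)
    from ev_comp[OF ev_pair[OF ev_snd ev_pair[OF ev_comp[OF ev_fst ev_fst] ev_pair[OF ev_comp[OF ev_fst ev_snd]
      ev_pair[OF ev_comp[OF ev_snd ev_oracle[OF that]] ev_zero]]]] this[unfolded bit_def]]
    show ?thesis unfolding chk_def bit_def .
  qed
  define q where "q = ix 6 (pair EC (ix 7 (pair (ix 9 chk) (ix 7 (pair (ix 3 0) (ix 7 (pair (ix 4 0) (ix 0 0))))))))"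
  define good where "good E Z \<longleftrightarrow> (\<exists>z H x a w. Z = pair z H \<and> agree z (dec H) Y \<and>
    E = ix 6 (pair (ix 8 (pair a x)) w) \<and> B x z H)" for E Z
  have q: "\<exists>r. ev Y (Z + 1) q (pair E Z) r \<and> (r = 0 \<longleftrightarrow> good E Z)" for E Z
  proof -
    obtain h where h: "agree (Z + 1) (dec h) Y" using Y unfolding regular_def by blast
    define D where "D i \<longleftrightarrow> \<not> A i Z (bit i)" for i
    have "D Z" unfolding D_def A_def using fst_le_pair leD by blast
    \<comment> \<open>The least number principle applies to bounded formulas only, so the oracle is
      replaced by its code \<open>h\<close>; up to \<open>Z\<close> this changes nothing.\<close>
    let ?D' = "\<lambda>i. Z < i \<or> \<not> (\<exists>z<Z + 1. (\<exists>H<Z + 1. Z = pair z H \<and> i < z \<and> (i \<in> dec h \<longleftrightarrow> i \<in> dec H)))"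
    have d0_D': "d0 (\<lambda>e. ?D' (e 0))" by (intro d0_intros d0_dec)
    have D': "?D' i \<longleftrightarrow> D i" if "i \<le> Z" for i
      using that h[unfolded agree_def less_Suc_iff_le] unfolding D_def A_def bit_def by auto
    have "?D' Z" using D'[of Z] \<open>D Z\<close> by simp
    from delta0_least[of ?D', OF d0_D' this]
    obtain i where least: "?D' i" "\<And>j. j < i \<Longrightarrow> \<not> ?D' j" by blast
    have "i \<le> Z" using least(2)[of Z] \<open>?D' Z\<close> by (meson not_less)
    then have i: "D i" "\<And>j. j < i \<Longrightarrow> \<not> D j" "i \<le> Z"
      using least D' by (meson less_imp_le order.trans)+
    have "ev Y (Z + 1) (ix 9 chk) (pair E Z) i"
    proof (rule ev_min[OF h])
      have "FA (env [i, E, Z, bit i]) = 0" using i(1) by (simp add: FA D_def env_def eval_nat_numeral)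
      then show "ev Y (Z + 1) chk (pair (pair E Z) i) 0"
        using chk[of i "Z + 1" E Z] i(3) by (simp add: less_Suc_iff_le)
      fix j assume "j < i"
      then have "FA (env [j, E, Z, bit j]) \<noteq> 0" using i(2) by (simp add: FA D_def env_def eval_nat_numeral)
      moreover have "j < Z + 1" using \<open>j < i\<close> i(3) by (simp add: less_Suc_iff_le)
      ultimately show "\<exists>r. ev Y (Z + 1) chk (pair (pair E Z) j) (r + 1)"
        using chk[of j "Z + 1" E Z] not_0_obtain by metis
    qed
    moreover have "ev Y (Z + 1) EC (pair i (pair E (pair Z 0))) (FC (env [i, E, Z]))"
      using ev_mono[OF EC[of "env [i, E, Z]"], of "Z + 1"] by (simp add: eval_nat_numeral env_def)
    ultimately have "ev Y (Z + 1) q (pair E Z) (FC (env [i, E, Z]))"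
      unfolding q_def by (rule ev_comp[OF ev_pair[OF _ ev_pair[OF ev_fst ev_pair[OF ev_snd ev_zero]]]])
    moreover have "FC (env [i, E, Z]) = 0 \<longleftrightarrow> C i E Z" by (simp add: FC env_def eval_nat_numeral)
    moreover have "C i E Z \<longleftrightarrow> good E Z"
    proof
      assume "C i E Z"
      then obtain z H x a w where *: "Z = pair z H" "\<not> i < z" "E = ix 6 (pair (ix 8 (pair a x)) w)" "B x z H"
        unfolding C_def by blast
      have "j \<in> dec H \<longleftrightarrow> j \<in> Y" if "j < z" for j
      proof -
        have "A j Z (bit j)" using i(2)[of j] that *(2) unfolding D_def by (metis leI less_le_trans)
        then show ?thesis unfolding A_def bit_def *(1) by (auto split: if_splits)
      qed
      then show "good E Z" unfolding good_def agree_def using * by blast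
    next
      assume "good E Z"
      then obtain z H x a w where *: "Z = pair z H" "agree z (dec H) Y" "E = ix 6 (pair (ix 8 (pair a x)) w)" "B x z H"
        unfolding good_def by blast
      have bd: "z < Z + 1" "H < Z + 1" unfolding *(1) less_Suc_iff_le by (rule fst_le_pair snd_le_pair)+
      have "\<not> i < z"
      proof
        assume "i < z"
        then have "A i Z (bit i)" unfolding A_def bit_def using *(1,2) bd unfolding agree_def by auto
        then show False using i(1) unfolding D_def by blast
      qed
      moreover have "x < E + 1" "a < E + 1" "w < E + 1" unfolding *(3) less_Suc_iff_le
        using fst_le_pair snd_le_pair by (meson order.trans)+
      ultimately show "C i E Z" unfolding C_def using * bd by blast
    qed
    ultimately show ?thesis by blast
  qed
  have self: "good (self_ix (ix 9 q) x) Z \<longleftrightarrow> (\<exists>z H. Z = pair z H \<and> agree z (dec H) Y \<and> B x z H)" for x Z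
    unfolding good_def self_ix_def by auto
  have B0: "d0 (\<lambda>e. B (f1 e) (f2 e) (f3 e))" if "trm f1" "trm f2" "trm f3" for f1 f2 f3
    by (rule d0.P_subst3[of B]) (use that B in \<open>auto simp: cpred_def\<close>)
  have "(\<exists>y. PhiM Y (self_ix (ix 9 q) x) (self_ix (ix 9 q) x) y) \<longleftrightarrow> (\<exists>z H. agree z (dec H) Y \<and> B x z H)" for x
  proof
    let ?e = "self_ix (ix 9 q) x"
    assume "\<exists>y. PhiM Y ?e ?e y"
    then obtain d y where d: "OK Y (dec d)" "tri ?e ?e y \<in> dec d" unfolding PhiM_iff[OF Y] by blast
    from self_ix_value[OF this] have "tri (ix 9 q) ?e y \<in> dec d" .
    then have "J Y (dec d) (ix 9 q) ?e y" using d(1) unfolding OK_def by blast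
    then have "tri q (pair ?e y) 0 \<in> dec d" unfolding J_simps by blast
    then have "good ?e y" using q[of y ?e] ev_determinate[OF _ d(1)] by metis
    then show "\<exists>z H. agree z (dec H) Y \<and> B x z H" unfolding self by blast
  next
    let ?e = "self_ix (ix 9 q) x"
    assume "\<exists>z H. agree z (dec H) Y \<and> B x z H"
    then obtain Z where Z: "good ?e Z" unfolding self by blast
    obtain h where h: "agree (Z + 1) (dec h) Y" using Y unfolding regular_def by blast
    \<comment> \<open>Again \<open>h\<close> replaces the oracle to obtain a bounded formula that
      agrees with \<open>good\<close> up to \<open>Z\<close>.\<close>
    let ?G = "\<lambda>Z'. \<exists>z<Z' + 1. (\<exists>H<Z' + 1. Z' = pair z H \<and> (\<forall>i<z. (i \<in> dec H \<longleftrightarrow> i \<in> dec h)) \<and> B x z H)"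
    have G: "?G Z' \<longleftrightarrow> good ?e Z'" if "Z' \<le> Z" for Z'
    proof -
      have "(\<forall>i<z. (i \<in> dec H \<longleftrightarrow> i \<in> dec h)) \<longleftrightarrow> agree z (dec H) Y" if "Z' = pair z H" for z H
      proof -
        have "z \<le> Z" using \<open>Z' \<le> Z\<close> fst_le_pair[of z H] that by simp
        then have "agree z (dec h) Y" by (intro agree_le[OF h]) (simp add: add_increasing2)
        then show ?thesis unfolding agree_def by blast
      qed
      moreover have "z < Z' + 1" "H < Z' + 1" if "Z' = pair z H" for z H
        unfolding that less_Suc_iff_le by (rule fst_le_pair snd_le_pair)+
      ultimately show ?thesis unfolding self by blast
    qed
    have d0_G: "d0 (\<lambda>e. ?G (e 0))" by (intro d0_intros d0_dec B0)
    have GZ: "?G Z" using G Z by blast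
    from delta0_least[of ?G, OF d0_G this]
    obtain Z0 where Z0: "?G Z0" "\<And>Z'. Z' < Z0 \<Longrightarrow> \<not> ?G Z'" by blast
    have "\<not> Z < Z0" using Z0(2) GZ by blast
    then have "Z0 \<le> Z" by simp
    have "ev Y (Z + 1) (ix 9 q) ?e Z0"
    proof (rule ev_min[OF h])
      have "good ?e Z0" using Z0(1) G[OF \<open>Z0 \<le> Z\<close>] by blast
      then have "ev Y (Z0 + 1) q (pair ?e Z0) 0" using q by metis
      then show "ev Y (Z + 1) q (pair ?e Z0) 0" by (rule ev_mono) (simp add: \<open>Z0 \<le> Z\<close>)
      fix i assume "i < Z0"
      then have "i \<le> Z" using \<open>Z0 \<le> Z\<close> by simp
      then have "\<not> good ?e i" using Z0(2)[OF \<open>i < Z0\<close>] G by blast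
      then obtain r where "ev Y (i + 1) q (pair ?e i) (r + 1)" using q[of i ?e] not_0_obtain by metis
      then show "\<exists>r. ev Y (Z + 1) q (pair ?e i) (r + 1)" using ev_mono \<open>i \<le> Z\<close> by (metis add_le_cancel_right)
    qed
    then show "\<exists>y. PhiM Y ?e ?e y" using ev_self ev_PhiM[OF Y] by blast
  qed
  then show ?thesis by blast
qed

text \<open>Convergence on the diagonal by stage \<open>u\<close>. The single bound covers all
  witnesses, the value and the part of the oracle that is consulted, which makes \<open>W\<close>
  monotone in \<open>u\<close> and dependent on the oracle below \<open>u\<close> only.\<close>

definition W :: "'a::rca0 set \<Rightarrow> 'a \<Rightarrow> 'a \<Rightarrow> 'a \<Rightarrow> bool" where
  "W Y e u y \<longleftrightarrow> (\<exists>s<u. (\<exists>h<u. (\<exists>d. d < u \<and>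
    (\<forall>i<s. (i \<in> dec h \<longleftrightarrow> i \<in> Y)) \<and> d < s \<and> Comput h d \<and> tri e e y \<in> dec d)))"

lemma PhiM_W: "PhiM Y e e y \<longleftrightarrow> (\<exists>u. W Y e u y)"
proof
  assume "PhiM Y e e y"
  then obtain s h d where *: "\<forall>i<s. (i \<in> dec h \<longleftrightarrow> i \<in> Y)" "d < s" "Comput h d" "tri e e y \<in> dec d"
    unfolding PhiM_def by blast
  have "s < s + h + 1" "h < s + h + 1" by (simp_all only: less_Suc_iff_le) simp_all
  moreover have "d < s + h + 1" using *(2) calculation(1) by simp
  ultimately show "\<exists>u. W Y e u y" unfolding W_def using * by blast
qed (auto simp: W_def PhiM_def)

lemma W_mono: "W Y e u y \<Longrightarrow> u \<le> u' \<Longrightarrow> W Y e u' y"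
  unfolding W_def by (meson less_le_trans)

lemma W_agree: "agree u Y Y' \<Longrightarrow> W Y e u y \<Longrightarrow> W Y' e u y"
  unfolding W_def agree_def by (meson less_trans)

lemma W_less: "W Y e u y \<Longrightarrow> y < u"
  unfolding W_def using tri_mem_less(3) less_trans by meson

text \<open>Let \<open>g\<close> code the jump below \<open>b\<close>. That all members of
  \<open>g\<close> below \<open>c\<close> converge by a common stage \<open>z\<close>, relative to a
  correct code \<open>H\<close> of the oracle, is Sigma_1 in \<open>Y\<close>; by
  \<open>universal\<close> it says that \<open>self_ix a (pair g c)\<close> is in the jump. A code
  \<open>G\<close> of a longer segment of the jump makes this a bounded formula in \<open>c\<close>,
  on which induction is possible.\<close>

theorem jump_bounding:
  fixes Y :: "'a::rca0 set"
  assumes Y: "regular Y" and Y': "regular (Jump 1 Y)"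
  shows "\<exists>u. \<forall>t<b. t \<in> Jump 1 Y \<longrightarrow> (\<exists>y. W Y t u y)"
proof -
  have jump: "t \<in> Jump 1 Y \<longleftrightarrow> (\<exists>y. PhiM Y t t y)" for t by simp
  obtain g where g: "agree b (dec g) (Jump 1 Y)" using Y' unfolding regular_def by blast
  \<comment> \<open>The two parameters \<open>g\<close> and \<open>c\<close> are packed into the
    single parameter that \<open>universal\<close> allows.\<close>
  define B where "B x z H \<longleftrightarrow> (\<exists>g<x + 1. (\<exists>c<x + 1. x = pair g c \<and>
    (\<forall>t<c. t \<in> dec g \<longrightarrow> (\<exists>y<z. W (dec H) t z y))))" for x z H :: 'a
  have B: "cpred Y n (\<lambda>e. B (e i) (e j) (e k))" if "i < n" "j < n" "k < n" for n i j k
    unfolding B_def W_def using that by (intro c.basic c.P_dec c.P_Comput) simp_all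
  have "\<exists>a. \<forall>x. (\<exists>y. PhiM Y (self_ix a x) (self_ix a x) y) \<longleftrightarrow> (\<exists>z H. agree z (dec H) Y \<and> B x z H)"
    by (rule universal[OF Y]) (rule B)
  then obtain a where a: "\<And>x. self_ix a x \<in> Jump 1 Y \<longleftrightarrow> (\<exists>z H. agree z (dec H) Y \<and> B x z H)"
    unfolding jump by blast
  \<comment> \<open>\<open>self_ix\<close> is monotone in its parameter, so this length covers the
    indices for all \<open>c \<le> b\<close>.\<close>
  let ?s = "self_ix a (pair g b) + 1"
  obtain G where G: "agree ?s (dec G) (Jump 1 Y)" using Y' unfolding regular_def by blast
  have B_iff: "B (pair g c) z H \<longleftrightarrow> (\<forall>t<c. t \<in> dec g \<longrightarrow> (\<exists>y. W (dec H) t z y))" for c z H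
  proof -
    have "(\<exists>y<z. W (dec H) t z y) \<longleftrightarrow> (\<exists>y. W (dec H) t z y)" for t using W_less by blast
    then show ?thesis unfolding B_def less_Suc_iff_le using fst_le_pair[of g c] snd_le_pair[of c g] by auto
  qed
  have C: "self_ix a (pair g c) \<in> dec G \<longleftrightarrow>
    (\<exists>z H. agree z (dec H) Y \<and> (\<forall>t<c. t \<in> dec g \<longrightarrow> (\<exists>y. W (dec H) t z y)))" if "c \<le> b" for c
  proof -
    have "self_ix a (pair g c) \<le> self_ix a (pair g b)"
      unfolding self_ix_def by (intro pair_mono order_refl that)
    then have "self_ix a (pair g c) \<in> dec G \<longleftrightarrow> self_ix a (pair g c) \<in> Jump 1 Y"
      using G unfolding agree_def less_Suc_iff_le by blast
    then show ?thesis unfolding a B_iff .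
  qed
  have "c \<le> b \<longrightarrow> self_ix a (pair g c) \<in> dec G" for c
  proof (rule delta0_induct[where P = "\<lambda>c. c \<le> b \<longrightarrow> self_ix a (pair g c) \<in> dec G"])
    show "d0 (\<lambda>e. e 0 \<le> b \<longrightarrow> self_ix a (pair g (e 0)) \<in> dec G)"
      unfolding self_ix_def by (intro d0_intros d0_dec)
    have "agree 0 (dec 0) Y" by (simp add: agree_def)
    then show "0 \<le> b \<longrightarrow> self_ix a (pair g 0) \<in> dec G" using C[of 0] by auto
  next
    fix c assume IH: "c \<le> b \<longrightarrow> self_ix a (pair g c) \<in> dec G"
    show "c + 1 \<le> b \<longrightarrow> self_ix a (pair g (c + 1)) \<in> dec G"
    proof
      assume le: "c + 1 \<le> b"
      then have "c < b" by (simp add: Suc_le_iff_less)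
      then obtain z H where zH: "agree z (dec H) Y" "\<And>t. t < c \<Longrightarrow> t \<in> dec g \<Longrightarrow> \<exists>y. W (dec H) t z y"
        using IH C[of c] by (meson less_imp_le)
      obtain u where u: "c \<in> dec g \<Longrightarrow> \<exists>y. W Y c u y"
        using g \<open>c < b\<close> jump PhiM_W unfolding agree_def by metis
      obtain H' where H': "agree (max z u) (dec H') Y" using Y unfolding regular_def by blast
      \<comment> \<open>Earlier computations survive the passage to the longer code because
        \<open>H\<close> and \<open>H'\<close> both agree with \<open>Y\<close> where those
        computations look.\<close>
      have "\<exists>y. W (dec H') t (max z u) y" if t: "t < c + 1" "t \<in> dec g" for t
      proof (cases "t < c")
        case True
        then obtain y where "W (dec H) t z y" using zH(2) t by blast
        then have "W Y t z y" using zH(1) W_agree by blast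
        then have "W Y t (max z u) y" by (rule W_mono) simp
        then show ?thesis using H' W_agree agree_sym by blast
      next
        case False
        then have "t = c" using t by (simp add: pre_less_Suc)
        then obtain y where "W Y t u y" using u t by blast
        then have "W Y t (max z u) y" by (rule W_mono) simp
        then show ?thesis using H' W_agree agree_sym by blast
      qed
      then show "self_ix a (pair g (c + 1)) \<in> dec G" using C[OF le] H' by blast
    qed
  qed
  then obtain z H where "agree z (dec H) Y" "\<And>t. t < b \<Longrightarrow> t \<in> dec g \<Longrightarrow> \<exists>y. W (dec H) t z y"
    using C[of b] by auto
  then have "t < b \<longrightarrow> t \<in> Jump 1 Y \<longrightarrow> (\<exists>y. W Y t z y)" for t
    using g W_agree unfolding agree_def by meson
  then show ?thesis by blast
qed

section \<open>Semantics of the principles\<close>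

fun tup :: "'a::rca0 list \<Rightarrow> 'a" where
  "tup [] = 0"
| "tup [x] = x"
| "tup (x # y # xs) = pair x (tup (y # xs))"

fun inc :: "'a::ord list \<Rightarrow> bool" where
  "inc (x # y # xs) \<longleftrightarrow> x < y \<and> inc (y # xs)"
| "inc _ \<longleftrightarrow> True"

text \<open>The first element of the list ends up at the largest new index, in accordance with the
  order of variables in \<open>tuple\<close>.\<close>

primrec ext :: "'a list \<Rightarrow> (nat \<Rightarrow> 'a) \<Rightarrow> nat \<Rightarrow> 'a" where
  "ext [] e = e"
| "ext (x # xs) e = ext xs (case_nat x e)"

lemma ext_length: "ext xs e (length xs) = e 0" "ext xs e (length xs + i) = e i"
proof -
  show *: "ext xs e (length xs + i) = e i" for i
  proof (induction xs arbitrary: e i)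
    case (Cons x xs)
    show ?case using Cons[of "case_nat x e" "Suc i"] by simp
  qed simp
  show "ext xs e (length xs) = e 0" using *[of 0] by simp
qed

lemma sat_Foralls: "sat M e S ((Forall ^^ n) \<phi>) \<longleftrightarrow> (\<forall>xs. length xs = n \<longrightarrow> sat M (ext xs e) S \<phi>)"
proof (induction n arbitrary: e)
  case (Suc n)
  have "(\<forall>x. \<forall>xs. length xs = n \<longrightarrow> sat M (ext xs (case_nat x e)) S \<phi>) \<longleftrightarrow>
    (\<forall>xs. length xs = Suc n \<longrightarrow> sat M (ext xs e) S \<phi>)"
    by (metis (no_types, lifting) ext.simps(2) length_Suc_conv)
  then show ?case by (simp add: Suc)
qed simp

lemma sat_Existss: "sat M e S ((Exists ^^ n) \<phi>) \<longleftrightarrow> (\<exists>xs. length xs = n \<and> sat M (ext xs e) S \<phi>)"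
proof (induction n arbitrary: e)
  case (Suc n)
  have "(\<exists>x. \<exists>xs. length xs = n \<and> sat M (ext xs (case_nat x e)) S \<phi>) \<longleftrightarrow>
    (\<exists>xs. length xs = Suc n \<and> sat M (ext xs e) S \<phi>)"
    by (metis (no_types, lifting) ext.simps(2) length_Suc_conv)
  then show ?case by (simp add: Suc)
qed simp

lemma val_tuple: "val std (ext xs e) (tuple (length xs)) = tup xs"
proof (induction xs arbitrary: e rule: tup.induct)
  case (3 x y xs)
  have "ext (x # y # xs) e (Suc (length xs)) = x" using ext_length(1)[of "y # xs" "case_nat x e"] by simp
  then show ?case using 3[of "case_nat x e"] by simp
qed simp_all

lemma sat_increasing: "sat std (ext xs e) S (increasing (length xs)) \<longleftrightarrow> inc xs"
proof (induction xs arbitrary: e rule: inc.induct)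
  case (1 x y xs)
  have "ext (x # y # xs) e (Suc (length xs)) = x" using ext_length(1)[of "y # xs" "case_nat x e"] by simp
  moreover have "ext (x # y # xs) e (length xs) = y" using ext_length(1)[of "xs" "case_nat y (case_nat x e)"] by simp
  ultimately show ?case using 1[of "case_nat x e"] by simp
qed simp_all

lemma sat_all_in: "sat std (ext xs e) S (all_in (length xs) A) \<longleftrightarrow> set xs \<subseteq> S A"
proof (induction xs arbitrary: e)
  case (Cons x xs)
  show ?case using ext_length(1)[of xs "case_nat x e"] Cons[of "case_nat x e"] by simp
qed simp

definition isfun :: "nat \<Rightarrow> 'a::rca0 set \<Rightarrow> bool" where
  "isfun k F \<longleftrightarrow> (\<forall>z\<in>F. \<exists>xs. length xs = k \<and> inc xs \<and> (\<exists>y. z = pair (tup xs) y)) \<and>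
    (\<forall>xs. length xs = k \<longrightarrow> inc xs \<longrightarrow> (\<exists>y. pair (tup xs) y \<in> F \<and> (\<forall>y'. pair (tup xs) y' \<in> F \<longrightarrow> y' = y)))"

lemma case_nat_lift: "(\<lambda>i. case_nat x e (i + 1)) = e" "(\<lambda>i. case_nat x (case_nat y e) (i + 2)) = e"
  by (simp_all add: fun_eq_iff)

lemma sat_is_function: "sat std e S (is_function k F) \<longleftrightarrow> isfun k (S F)"
proof -
  have "sat std (ext xs e') S (increasing k) \<longleftrightarrow> inc xs" "val std (ext xs e') (tuple k) = tup xs"
    "ext xs e' k = e' 0" if "length xs = k" for xs and e' :: "nat \<Rightarrow> 'a"
    using sat_increasing[of xs e' S] val_tuple[of xs e'] ext_length(1)[of xs e'] unfolding that by blast+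
  note * = this
  have 1: "sat std e S (Forall (Var 0 \<^bold>\<in> F \<^bold>\<longrightarrow>
        (Exists ^^ k) (increasing k \<^bold>\<and> Exists (Var (k + 1) \<^bold>= pr (tuple k \<up> 1) (Var 0))))) \<longleftrightarrow>
    (\<forall>z\<in>S F. \<exists>xs. length xs = k \<and> inc xs \<and> (\<exists>y. z = pair (tup xs) y))"
    unfolding sat.simps sat_Existss sat_And sat_Exists val_pr val_lift val.simps case_nat_lift
    using * by (auto cong: conj_cong)
  have 2: "sat std e S ((Forall ^^ k) (increasing k \<^bold>\<longrightarrow>
        Exists (pr (tuple k \<up> 1) (Var 0) \<^bold>\<in> F
          \<^bold>\<and> Forall (pr (tuple k \<up> 2) (Var 0) \<^bold>\<in> F \<^bold>\<longrightarrow> Var 0 \<^bold>= Var 1)))) \<longleftrightarrow>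
    (\<forall>xs. length xs = k \<longrightarrow> inc xs \<longrightarrow> (\<exists>y. pair (tup xs) y \<in> S F \<and> (\<forall>y'. pair (tup xs) y' \<in> S F \<longrightarrow> y' = y)))"
    unfolding sat.simps sat_Foralls sat_And sat_Exists val_pr val_lift val.simps case_nat_lift
    using * by (auto cong: conj_cong)
  show ?thesis unfolding is_function_def sat_And 1 2 isfun_def ..
qed

definition unbounded :: "'a::ord set \<Rightarrow> bool"
  where "unbounded A \<longleftrightarrow> (\<forall>b. \<exists>x. b < x \<and> x \<in> A)"

definition TSM :: "nat \<Rightarrow> 'a::rca0 itself \<Rightarrow> bool" where
  "TSM k _ \<longleftrightarrow> (\<forall>F\<in>(sets :: 'a set set). isfun k F \<longrightarrow> (\<exists>A\<in>sets. unbounded A \<and>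
    (\<exists>c. \<forall>xs. length xs = k \<longrightarrow> inc xs \<and> set xs \<subseteq> A \<longrightarrow> pair (tup xs) c \<notin> F)))"

lemma sat_TS: "sat (std :: 'a::rca0 interp) e S (TS k) \<longleftrightarrow> TSM k TYPE('a)"
proof -
  have "sat std (ext xs e') S' (increasing k) \<longleftrightarrow> inc xs" "val std (ext xs e') (tuple k) = tup xs"
    "ext xs e' k = e' 0" "sat std (ext xs e') S' (all_in k 0) \<longleftrightarrow> set xs \<subseteq> S' 0"
    if "length xs = k" for xs S' and e' :: "nat \<Rightarrow> 'a"
    using sat_increasing[of xs e' S'] val_tuple[of xs e'] ext_length(1)[of xs e'] sat_all_in[of xs e' S' 0]
    unfolding that by blast+
  note * = this
  have "sat (std :: 'a interp) e S' (thin k 1 0) \<longleftrightarrow>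
    (\<exists>c. \<forall>xs. length xs = k \<longrightarrow> inc xs \<and> set xs \<subseteq> S' 0 \<longrightarrow> pair (tup xs) c \<notin> S' 1)" for S'
    unfolding thin_def sat_Exists sat_Foralls sat.simps sat_And sat_Neg val_pr val.simps
    by (intro iff_exI iff_allI imp_cong refl) (simp_all add: * del: One_nat_def)
  then show ?thesis
    unfolding TS_def TSM_def infinite_set_def by (simp add: sat_is_function unbounded_def)
qed

definition DNRM :: "nat \<Rightarrow> 'a::rca0 set \<Rightarrow> bool" where
  "DNRM k X \<longleftrightarrow> (\<exists>G\<in>sets. isfun 1 G \<and> (\<forall>e y. pair e y \<in> G \<longrightarrow> \<not> PhiM (Jump k X) e e y))"

lemma sat_Phi_jump: "sat std v S (Phi (jump k X) e x y) \<longleftrightarrow>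
    PhiM (Jump k (S X)) (val std v e) (val std v x) (val std v y)"
  by (rule sat_Phi) (rule sat_jump)

lemma sat_DNR: "sat (std :: 'a::rca0 interp) e S (DNR_jump k) \<longleftrightarrow> (\<forall>X\<in>(sets :: 'a set set). DNRM k X)"
  unfolding DNR_jump_def DNRM_def dnc_def
  by (simp add: sat_is_function sat_Phi_jump del: One_nat_def) simp

section \<open>Approximating jumps\<close>

text \<open>The head bounds the stage for the outermost jump and the tail approximates its oracle.
  In an increasing tuple the tail is chosen after the head, so it can be correct as far as the head
  looks.\<close>

fun appr :: "'a::rca0 set \<Rightarrow> nat \<Rightarrow> 'a list \<Rightarrow> 'a set" where
  "appr T (Suc j) (x # xs) = {t. \<exists>y. W (appr T j xs) t x y}"
| "appr T _ _ = T"

lemma d0_W: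
  assumes B: "B \<in> sets" and f: "trm f" and g: "trm g" and h: "trm h" and k: "trm k"
  shows "d0 (\<lambda>e. W {i. pair i (f e) \<in> B} (g e) (h e) (k e))"
proof -
  note sh = trm_shift trm_shift[OF trm_shift] trm_shift[OF trm_shift[OF trm_shift]]
    trm_shift[OF trm_shift[OF trm_shift[OF trm_shift]]]
  show ?thesis unfolding W_def mem_Collect_eq
    by (intro d0_intros d0_dec d0_Comput d0_mem[OF _ B] f g h k sh[OF f] sh[OF g] sh[OF h] sh[OF k])
qed

text \<open>One set holds the approximations for all tuples, with the code of the tuple as a
  parameter. The recursion on \<open>j\<close> takes place outside the model, where \<open>j\<close>
  is standard, so each level may be a new set.\<close>

lemma appr_definable:
  assumes "T \<in> sets" "j \<le> n" "n \<noteq> 0"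
  shows "\<exists>B\<in>sets. \<forall>xs. length xs = n \<longrightarrow> {t. pair t (tup xs) \<in> B} = appr T j xs"
  using assms(2,3)
proof (induction j arbitrary: n)
  case 0
  let ?A = "\<lambda>z. \<exists>t<z + 1. (\<exists>p<z + 1. z = pair t p \<and> t \<in> T)"
  have "{z. ?A z} \<in> sets" by (rule delta0_comprehension) (intro d0_intros d0_mem[OF _ \<open>T \<in> sets\<close>])
  moreover have "?A (pair t p) \<longleftrightarrow> t \<in> T" for t p
    using fst_le_pair snd_le_pair by (auto simp: less_Suc_iff_le)
  ultimately show ?case by (intro bexI[of _ "{z. ?A z}"]) simp_all
next
  case (Suc j)
  show ?case
  proof (cases "n = 1")
    case True
    then have j: "j = 0" using Suc.prems by simp
    \<comment> \<open>A tuple of length 1 is its element and not a pair. The oracle \<open>T\<close>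
      is brought into the form that \<open>d0_W\<close> expects by means of the dummy parameter
      0.\<close>
    define B where "B = {z. \<exists>t<z + 1. (\<exists>p<z + 1. z = pair t p \<and> t \<in> T)}"
    have B: "B \<in> sets" unfolding B_def
      by (rule delta0_comprehension) (intro d0_intros d0_mem[OF _ \<open>T \<in> sets\<close>])
    have B': "{i. pair i 0 \<in> B} = T"
      unfolding B_def using fst_le_pair snd_le_pair by (auto simp: less_Suc_iff_le)
    let ?A = "\<lambda>z. \<exists>t<z + 1. (\<exists>x<z + 1. z = pair t x \<and> (\<exists>y<x. W T t x y))"
    have "d0 (\<lambda>e. \<exists>t<e 0 + 1. (\<exists>x<e 0 + 1. e 0 = pair t x \<and>
        (\<exists>y<x. W {i. pair i 0 \<in> B} t x y)))"
      by (intro d0_intros d0_W[OF B])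
    then have "d0 (\<lambda>e. ?A (e 0))" unfolding B' .
    then have "{z. ?A z} \<in> sets" by (rule delta0_comprehension)
    moreover have A: "?A (pair t x) \<longleftrightarrow> (\<exists>y. W T t x y)" for t x
    proof -
      have "(\<exists>y<x. W T t x y) \<longleftrightarrow> (\<exists>y. W T t x y)" using W_less by blast
      then show ?thesis using fst_le_pair[of t x] snd_le_pair[of x t] by (auto simp: less_Suc_iff_le)
    qed
    moreover have "{t. pair t (tup xs) \<in> {z. ?A z}} = appr T (Suc j) xs" if "length xs = n" for xs
    proof -
      obtain x where "xs = [x]" using \<open>length xs = n\<close> True by (auto simp: length_Suc_conv)
      then show ?thesis using j by (simp only: tup.simps appr.simps mem_Collect_eq A)
    qed
    ultimately show ?thesis by blast
  next
    case False
    then obtain m where m: "n = Suc m" "m \<noteq> 0" "j \<le> m" using Suc.prems by (cases n) auto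
    obtain B where B: "B \<in> sets" "\<And>xs. length xs = m \<Longrightarrow> {t. pair t (tup xs) \<in> B} = appr T j xs"
      using Suc.IH[OF m(3,2)] by blast
    let ?A = "\<lambda>z. \<exists>t<z + 1. (\<exists>x<z + 1. (\<exists>q<z + 1. z = pair t (pair x q) \<and>
      (\<exists>y<x. W {i. pair i q \<in> B} t x y)))"
    have "d0 (\<lambda>e. ?A (e 0))" by (intro d0_intros d0_W[OF B(1)])
    then have "{z. ?A z} \<in> sets" by (rule delta0_comprehension)
    moreover have A: "?A (pair t (pair x q)) \<longleftrightarrow> (\<exists>y. W {i. pair i q \<in> B} t x y)" for t x q
    proof -
      have "t \<le> pair t (pair x q)" by (rule fst_le_pair)
      moreover have "x \<le> pair t (pair x q)" using fst_le_pair snd_le_pair by (rule order.trans)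
      moreover have "q \<le> pair t (pair x q)" using snd_le_pair snd_le_pair by (rule order.trans)
      moreover have "(\<exists>y<x. W {i. pair i q \<in> B} t x y) \<longleftrightarrow> (\<exists>y. W {i. pair i q \<in> B} t x y)"
        using W_less by blast
      ultimately show ?thesis by (auto simp: less_Suc_iff_le)
    qed
    moreover have "{t. pair t (tup xs) \<in> {z. ?A z}} = appr T (Suc j) xs" if "length xs = n" for xs
    proof -
      obtain x y ys where xs: "xs = x # y # ys" "length (y # ys) = m"
        using \<open>length xs = n\<close> m by (metis length_Suc_conv not0_implies_Suc)
      show ?thesis using B(2)[OF xs(2)] by (simp only: xs(1) tup.simps appr.simps mem_Collect_eq A)
    qed
    ultimately show ?thesis by blast
  qed
qed

primrec limiting :: "nat \<Rightarrow> ('a::ord list \<Rightarrow> bool) \<Rightarrow> bool" where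
  "limiting 0 P \<longleftrightarrow> P []"
| "limiting (Suc n) P \<longleftrightarrow> (\<exists>b. \<forall>x. b < x \<longrightarrow> limiting n (\<lambda>xs. P (x # xs)))"

lemma limiting_mono: "limiting n P \<Longrightarrow> (\<And>xs. length xs = n \<Longrightarrow> P xs \<Longrightarrow> Q xs) \<Longrightarrow> limiting n Q"
proof (induction n arbitrary: P Q)
  case (Suc n)
  then obtain b where b: "\<And>x. b < x \<Longrightarrow> limiting n (\<lambda>xs. P (x # xs))" by auto
  have "limiting n (\<lambda>xs. Q (x # xs))" if "b < x" for x
    by (rule Suc.IH[OF b[OF that]]) (simp add: Suc.prems)
  then show ?case by auto
qed simp

lemma limiting_const: "limiting n (\<lambda>xs. True)"
  by (induction n) simp_all

text \<open>Each entry is chosen in \<open>A\<close> beyond both the previous entry and the bound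
  that belongs to the current position.\<close>

lemma limiting_pick:
  fixes A :: "'a::linorder set"
  assumes "unbounded A"
  shows "limiting n P \<Longrightarrow> \<exists>xs. length xs = n \<and> set xs \<subseteq> A \<and> inc (b # xs) \<and> P xs"
proof (induction n arbitrary: P b)
  case (Suc n)
  then obtain c where c: "\<And>x. c < x \<Longrightarrow> limiting n (\<lambda>xs. P (x # xs))" by auto
  obtain x where x: "max b c < x" "x \<in> A" using assms unfolding unbounded_def by blast
  then have "limiting n (\<lambda>xs. P (x # xs))" by (intro c) simp
  from Suc.IH[OF this, of x] obtain xs where "length xs = n" "set xs \<subseteq> A" "inc (x # xs)" "P (x # xs)" by blast
  then show ?case using x by (intro exI[of _ "x # xs"]) simp
qed (use assms in auto)

text \<open>Let \<open>u\<close> be a stage by which all members of the jump below \<open>b\<close>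
  have converged. For \<open>x > u\<close> the approximation is correct below \<open>b\<close> once
  the inner one is correct below \<open>x\<close>, as stage \<open>x\<close> reads the oracle only
  there. The induction hypothesis is applied with \<open>x\<close> in place of
  \<open>b\<close>.\<close>

lemma limiting_appr:
  assumes "\<And>i b. i < j \<Longrightarrow> \<exists>u. \<forall>t<b. t \<in> Jump (Suc i) T \<longrightarrow> (\<exists>y. W (Jump i T) t u y)" and "j \<le> n"
  shows "limiting n (\<lambda>xs. agree b (appr T j xs) (Jump j T))"
  using assms
proof (induction j arbitrary: n b)
  case 0
  have "appr T 0 xs = T" for xs by simp
  then show ?case by (intro limiting_mono[OF limiting_const]) (simp add: agree_def)
next
  case (Suc j)
  then obtain m where m: "n = Suc m" "j \<le> m" by (cases n) auto
  obtain u where u: "\<And>t. t < b \<Longrightarrow> t \<in> Jump (Suc j) T \<Longrightarrow> \<exists>y. W (Jump j T) t u y" using Suc.prems(1)[of j b] by blast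
  have "limiting m (\<lambda>xs. agree b (appr T (Suc j) (x # xs)) (Jump (Suc j) T))" if "u < x" for x
  proof (rule limiting_mono)
    show "limiting m (\<lambda>xs. agree x (appr T j xs) (Jump j T))" using Suc.IH[OF _ m(2)] Suc.prems(1) by simp
    fix xs assume *: "agree x (appr T j xs) (Jump j T)"
    then have W: "W (appr T j xs) t x y \<longleftrightarrow> W (Jump j T) t x y" for t y
      using W_agree agree_sym by blast
    have "(\<exists>y. W (Jump j T) t x y) \<longleftrightarrow> t \<in> Jump (Suc j) T" if "t < b" for t
      using u[OF that] W_mono[of "Jump j T" t u _ x] \<open>u < x\<close> PhiM_W by fastforce
    then show "agree b (appr T (Suc j) (x # xs)) (Jump (Suc j) T)"
      unfolding agree_def appr.simps mem_Collect_eq W by blast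
  qed
  then show ?case unfolding m by auto
qed

section \<open>Sequences and the pigeonhole principle\<close>

text \<open>A sequence is a finite set of pairs of a position and a value. The positions 0 to
  \<open>n\<close> are filled, so there are \<open>n + 1\<close> of them, and no two positions share
  a value.\<close>

definition Seq :: "'a::rca0 \<Rightarrow> 'a \<Rightarrow> bool" where
  "Seq y n \<longleftrightarrow> (\<forall>j<n + 1. (\<exists>x<y. pair j x \<in> dec y)) \<and>
    (\<forall>j<y. (\<forall>j'<y. (\<forall>x<y. pair j x \<in> dec y \<longrightarrow> pair j' x \<in> dec y \<longrightarrow> j = j')))"

lemma pair_mem_less: "pair j x \<in> dec y \<Longrightarrow> j < y" "pair j x \<in> dec y \<Longrightarrow> x < y"
  using dec_less fst_le_pair snd_le_pair le_less_trans by metis+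

lemma ball_dec: "(\<forall>j<z. (\<forall>x<z. pair j x \<in> dec z \<longrightarrow> R j x)) \<longleftrightarrow> (\<forall>j x. pair j x \<in> dec z \<longrightarrow> R j x)"
  using pair_mem_less by blast

lemma ball_dec1: "(\<forall>j<z. pair j x \<in> dec z \<longrightarrow> R j) \<longleftrightarrow> (\<forall>j. pair j x \<in> dec z \<longrightarrow> R j)"
  using pair_mem_less by blast

lemma bex_dec1: "(\<exists>j<z. pair j x \<in> dec z) \<longleftrightarrow> (\<exists>j. pair j x \<in> dec z)"
  using pair_mem_less by blast

lemma bex_dec2: "(\<exists>x<z. pair j x \<in> dec z) \<longleftrightarrow> (\<exists>x. pair j x \<in> dec z)"
  using pair_mem_less by blast

lemma Seq_iff: "Seq y n \<longleftrightarrow> (\<forall>j. j \<le> n \<longrightarrow> (\<exists>x. pair j x \<in> dec y)) \<and>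
    (\<forall>j j' x. pair j x \<in> dec y \<longrightarrow> pair j' x \<in> dec y \<longrightarrow> j = j')"
  unfolding Seq_def less_Suc_iff_le by (meson pair_mem_less)

lemma d0_Seq: "trm f \<Longrightarrow> trm g \<Longrightarrow> d0 (\<lambda>e. Seq (f e) (g e))"
  by (rule d0.P_subst2) (unfold Seq_def, intro d0_intros d0_dec)

lemma add_Suc_le: "j + (a + 1) \<le> m \<Longrightarrow> j + a \<le> m \<and> (j + 1) + a \<le> m" for j a m :: "'a::rca0"
proof
  assume *: "j + (a + 1) \<le> m"
  show "(j + 1) + a \<le> m" using * by (simp only: ac_simps)
  have "(j + a) + 1 \<le> m" using * by (simp only: add.assoc)
  then show "j + a \<le> m" unfolding Suc_le_iff_less by (rule less_imp_le)
qed

text \<open>The induction removes the values occupied by \<open>r = 0, 1, \<dots>\<close> from the sequence, one at a time.\<close>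

lemma free_value:
  fixes y m c :: "'a::rca0"
  assumes seq: "Seq y m" and fn: "\<And>r x x'. pair r x \<in> dec c \<Longrightarrow> pair r x' \<in> dec c \<Longrightarrow> x = x'"
    and dom: "\<And>r x. pair r x \<in> dec c \<Longrightarrow> r < m"
  shows "\<exists>j x. pair j x \<in> dec y \<and> (\<forall>r. pair r x \<notin> dec c)"
proof -
  \<comment> \<open>After \<open>a\<close> rounds \<open>z\<close> still fills the positions
    \<open>j\<close> with \<open>j + a \<le> m\<close>, by values of \<open>y\<close> that no
    \<open>r < a\<close> occupies. \<open>P\<close> has the bounds that Sigma_1 induction requires,
    \<open>Q\<close> is the same without them.\<close>
  define P where "P z a \<longleftrightarrow> (a \<le> m \<longrightarrow> (\<forall>j<m + 1. j + a \<le> m \<longrightarrow> (\<exists>x<z. pair j x \<in> dec z)) \<and>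
    (\<forall>j<z. (\<forall>x<z. pair j x \<in> dec z \<longrightarrow>
      (\<forall>j'<z. pair j' x \<in> dec z \<longrightarrow> j = j') \<and> (\<exists>j'<y. pair j' x \<in> dec y) \<and>
      (\<forall>r<a. pair r x \<notin> dec c))))" for z a
  define Q where "Q z a \<longleftrightarrow> (a \<le> m \<longrightarrow> (\<forall>j. j + a \<le> m \<longrightarrow> (\<exists>x. pair j x \<in> dec z)) \<and>
    (\<forall>j x. pair j x \<in> dec z \<longrightarrow> (\<forall>j'. pair j' x \<in> dec z \<longrightarrow> j = j') \<and> (\<exists>j'. pair j' x \<in> dec y) \<and>
      (\<forall>r<a. pair r x \<notin> dec c)))" for z a
  have P_iff: "P z a \<longleftrightarrow> Q z a" for z a
  proof -
    have "j + a \<le> m \<Longrightarrow> j \<le> m" for j using le_add_same_cancel1[of j a] order.trans by (metis zero_le)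
    then have "(\<forall>j. j \<le> m \<longrightarrow> j + a \<le> m \<longrightarrow> R j) \<longleftrightarrow> (\<forall>j. j + a \<le> m \<longrightarrow> R j)" for R by blast
    then show ?thesis unfolding P_def Q_def ball_dec ball_dec1 bex_dec1 bex_dec2 less_Suc_iff_le by simp
  qed
  have "\<exists>z. P z m"
  proof (rule sigma1_induct[where P = P])
    show "d0 (\<lambda>e. P (e 0) (e 1))" unfolding P_def by (intro d0_intros d0_dec)
    have "Q y 0" using seq unfolding Q_def Seq_iff by auto
    then show "\<exists>z. P z 0" using P_iff by blast
  next
    fix a assume "\<exists>z. P z a"
    then obtain z where z: "Q z a" using P_iff by blast
    have "\<exists>z'. Q z' (a + 1)"
    proof (cases "\<exists>x j. a \<le> m \<and> pair a x \<in> dec c \<and> pair j x \<in> dec z")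
      case False
      have "Q z (a + 1)"
        unfolding Q_def
      proof
        assume "a + 1 \<le> m"
        then have "a \<le> m" by (simp add: Suc_le_iff_less less_imp_le)
        note z' = z[unfolded Q_def, rule_format, OF this]
        have "j + a \<le> m" if "j + (a + 1) \<le> m" for j
          using add_Suc_le[OF that] by blast
        then show "(\<forall>j. j + (a + 1) \<le> m \<longrightarrow> (\<exists>x. pair j x \<in> dec z)) \<and>
          (\<forall>j x. pair j x \<in> dec z \<longrightarrow> (\<forall>j'. pair j' x \<in> dec z \<longrightarrow> j = j') \<and> (\<exists>j'. pair j' x \<in> dec y) \<and>
          (\<forall>r<a + 1. pair r x \<notin> dec c))"
          using z' False \<open>a \<le> m\<close> unfolding pre_less_Suc by blast
      qed
      then show ?thesis by blast
    next
      case True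
      then obtain x0 j0 where x0: "a \<le> m" "pair a x0 \<in> dec c" "pair j0 x0 \<in> dec z" by blast
      have total: "\<And>j. j + a \<le> m \<Longrightarrow> \<exists>x. pair j x \<in> dec z"
        and inj: "\<And>j j' x. pair j x \<in> dec z \<Longrightarrow> pair j' x \<in> dec z \<Longrightarrow> j = j'"
        and val: "\<And>j x. pair j x \<in> dec z \<Longrightarrow> \<exists>j'. pair j' x \<in> dec y"
        and free: "\<And>j x r. pair j x \<in> dec z \<Longrightarrow> r < a \<Longrightarrow> pair r x \<notin> dec c"
        using z x0(1) unfolding Q_def by blast+
      \<comment> \<open>Position \<open>j0\<close>, which holds the occupied value
        \<open>x0\<close>, is dropped and the later positions move down by one. The restriction
        \<open>w < z\<close> loses nothing because pairing is monotone.\<close>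
      have "\<exists>z'. dec z' = {w. w < z \<and> (\<exists>j<w + 1. (\<exists>x<w + 1. w = pair j x \<and>
        (j < j0 \<and> pair j x \<in> dec z \<or> j0 \<le> j \<and> pair (j + 1) x \<in> dec z)))}"
        by (rule code_exists) (intro d0_intros d0_dec)
      then obtain z' where z': "dec z' = {w. w < z \<and> (\<exists>j<w + 1. (\<exists>x<w + 1. w = pair j x \<and>
        (j < j0 \<and> pair j x \<in> dec z \<or> j0 \<le> j \<and> pair (j + 1) x \<in> dec z)))}" by blast
      have mem: "pair j x \<in> dec z' \<longleftrightarrow> (j < j0 \<and> pair j x \<in> dec z \<or> j0 \<le> j \<and> pair (j + 1) x \<in> dec z)" for j x
      proof -
        have "pair j x < z" if "pair (j + 1) x \<in> dec z"
          using dec_less[OF that] pair_mono[of j "j + 1" x x] by (auto intro: le_less_trans)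
        then show ?thesis unfolding z' less_Suc_iff_le using fst_le_pair[of j x] snd_le_pair[of x j] dec_less by auto
      qed
      have "Q z' (a + 1)"
        unfolding Q_def
      proof (intro impI conjI allI)
        fix j assume "a + 1 \<le> m" "j + (a + 1) \<le> m"
        then have "j + a \<le> m" "(j + 1) + a \<le> m" using add_Suc_le[of j a m] by blast+
        then show "\<exists>x. pair j x \<in> dec z'" unfolding mem using total[of j] total[of "j + 1"] not_less by blast
      next
        fix j x j' assume "pair j x \<in> dec z'" "pair j' x \<in> dec z'"
        then consider "j < j0" "pair j x \<in> dec z" "j' < j0" "pair j' x \<in> dec z"
          | "j < j0" "pair j x \<in> dec z" "j0 \<le> j'" "pair (j' + 1) x \<in> dec z"
          | "j' < j0" "pair j' x \<in> dec z" "j0 \<le> j" "pair (j + 1) x \<in> dec z"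
          | "pair (j + 1) x \<in> dec z" "pair (j' + 1) x \<in> dec z" unfolding mem by blast
        then show "j = j'"
        proof cases
          case 1 then show ?thesis using inj by blast
        next
          case 2
          then have "j = j' + 1" "j < j' + 1" using inj[OF 2(2,4)] by (simp_all only: less_Suc_iff_le)
          then show ?thesis by simp
        next
          case 3
          then have "j' = j + 1" "j' < j + 1" using inj[OF 3(2,4)] by (simp_all only: less_Suc_iff_le)
          then show ?thesis by simp
        next
          case 4 then show ?thesis using inj by (metis add_right_cancel)
        qed
      next
        fix j x assume "pair j x \<in> dec z'"
        then show "\<exists>j'. pair j' x \<in> dec y" unfolding mem using val by blast
      next
        fix j x r assume jx: "pair j x \<in> dec z'" and "r < a + 1"
        then consider "r < a" | "r = a" unfolding pre_less_Suc by blast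
        then show "pair r x \<notin> dec c"
        proof cases
          case 1 then show ?thesis using jx free unfolding mem by blast
        next
          case 2
          show ?thesis
          proof
            assume "pair r x \<in> dec c"
            then have "x = x0" using fn x0(2) 2 by blast
            then have "j < j0 \<and> j = j0 \<or> j0 \<le> j \<and> j + 1 = j0" using jx inj x0(3) unfolding mem by metis
            then show False by (metis less_irrefl less_Suc_iff_le not_less order_refl)
          qed
        qed
      qed
      then show ?thesis by blast
    qed
    then show "\<exists>z. P z (a + 1)" using P_iff by blast
  qed
  then obtain z where z: "Q z m" using P_iff by blast
  note z' = z[unfolded Q_def, rule_format, OF order_refl]
  have "\<exists>x. pair 0 x \<in> dec z" using z' by simp
  then obtain x where "pair 0 x \<in> dec z" ..
  then have "\<exists>j'. pair j' x \<in> dec y" "\<And>r. r < m \<Longrightarrow> pair r x \<notin> dec c" using z' by blast+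
  then show ?thesis using dom by blast
qed

lemma Seq_exists:
  fixes A :: "'a::rca0 set"
  assumes A: "A \<in> sets" "unbounded A"
  shows "\<exists>y. Seq y n \<and> (\<forall>j x. pair j x \<in> dec y \<longrightarrow> x \<in> A)"
proof -
  let ?A = "\<lambda>y. \<forall>j<y. (\<forall>x<y. pair j x \<in> dec y \<longrightarrow> x \<in> A)"
  have A_iff: "?A y \<longleftrightarrow> (\<forall>j x. pair j x \<in> dec y \<longrightarrow> x \<in> A)" for y
    using pair_mem_less by blast
  have "\<exists>y. Seq y n \<and> ?A y"
  proof (rule sigma1_induct[where P = "\<lambda>y n. Seq y n \<and> ?A y"])
    show "d0 (\<lambda>e. Seq (e 0) (e 1) \<and> ?A (e 0))" by (intro d0_intros d0_Seq d0_dec d0_mem[OF _ A(1)])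
    obtain a where "a \<in> A" using A(2) unfolding unbounded_def by blast
    moreover obtain y where "dec y = insert (pair 0 a) (dec 0)" using code_insert by blast
    ultimately have "Seq y 0 \<and> (\<forall>j x. pair j x \<in> dec y \<longrightarrow> x \<in> A)" unfolding Seq_iff by (auto simp: code_empty)
    then show "\<exists>y. Seq y 0 \<and> ?A y" using A_iff by blast
  next
    fix n assume "\<exists>y. Seq y n \<and> ?A y"
    then obtain y where y: "Seq y n" "\<And>j x. pair j x \<in> dec y \<Longrightarrow> x \<in> A" using A_iff by blast
    \<comment> \<open>An element above the code \<open>y\<close> differs from all values in
      it.\<close>
    obtain a where a: "y < a" "a \<in> A" using A(2) unfolding unbounded_def by blast
    obtain y' where y': "dec y' = insert (pair (n + 1) a) (dec y)" using code_insert by blast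
    have "pair j a \<notin> dec y" for j using a(1) pair_mem_less(2) less_asym by blast
    moreover have "j \<le> n + 1 \<longleftrightarrow> j \<le> n \<or> j = n + 1" for j
      using less_Suc_iff_le[of j n] by (auto simp: le_iff)
    ultimately have "Seq y' (n + 1)" using y(1) unfolding Seq_iff y' by auto
    moreover have "\<forall>j x. pair j x \<in> dec y' \<longrightarrow> x \<in> A" using y(2) a(2) unfolding y' by auto
    ultimately show "\<exists>y. Seq y (n + 1) \<and> ?A y" using A_iff by blast
  qed
  then show ?thesis using A_iff by blast
qed

section \<open>The coloring\<close>

lemma W_unique: "W Y e u y \<Longrightarrow> W Y e u' y' \<Longrightarrow> y = y'"
proof -
  have *: "\<exists>d. OK Y (dec d) \<and> tri e e y \<in> dec d" if W: "W Y e u y" for u y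
  proof -
    obtain s h d where "agree s (dec h) Y" "d < s" "OK (dec h) (dec d)" "tri e e y \<in> dec d"
      using W unfolding W_def Comput_iff agree_def by blast
    then show ?thesis using OK_agree_code[of s "dec h" Y d] by (auto simp: less_imp_le)
  qed
  assume "W Y e u y" "W Y e u' y'"
  then show ?thesis using *[of u y] *[of u' y'] determinate by blast
qed

text \<open>The requirement \<open>r = (e, i)\<close> wants some value of the sequence computed by \<open>e\<close> to get the color \<open>i\<close>.\<close>

definition request :: "'a::rca0 set \<Rightarrow> 'a \<Rightarrow> 'a \<Rightarrow> 'a \<Rightarrow> bool" where
  "request Y x r y \<longleftrightarrow> (\<exists>e<r + 1. (\<exists>i<r + 1. r = pair e i \<and> W Y e x y)) \<and> Seq y r"

lemma request_unique: "request Y x r y \<Longrightarrow> request Y x r y' \<Longrightarrow> y = y'"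
  unfolding request_def using W_unique by auto

lemma request_less: "request Y x r y \<Longrightarrow> y < x"
  unfolding request_def using W_less by blast

text \<open>\<open>c\<close> is a matching between requirements below \<open>m\<close> and values:
  every such requirement with a request gets a value from its sequence, and no value serves two
  requirements, so that colors do not conflict.\<close>

definition picks :: "'a::rca0 set \<Rightarrow> 'a \<Rightarrow> 'a \<Rightarrow> 'a \<Rightarrow> bool" where
  "picks Y x c m \<longleftrightarrow>
    (\<forall>r<m. (\<forall>y<x. request Y x r y \<longrightarrow> (\<exists>z<c. pair r z \<in> dec c \<and> (\<exists>j<y. pair j z \<in> dec y)))) \<and>
    (\<forall>r<c. (\<forall>z<c. pair r z \<in> dec c \<longrightarrow> r < m \<and>
      (\<forall>r'<c. pair r' z \<in> dec c \<longrightarrow> r = r') \<and> (\<forall>z'<c. pair r z' \<in> dec c \<longrightarrow> z = z')))"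

lemma ball_dec2: "(\<forall>x<z. pair j x \<in> dec z \<longrightarrow> R x) \<longleftrightarrow> (\<forall>x. pair j x \<in> dec z \<longrightarrow> R x)"
  using pair_mem_less by blast

lemma picks_iff: "picks Y x c m \<longleftrightarrow>
    (\<forall>r y. r < m \<longrightarrow> request Y x r y \<longrightarrow> (\<exists>z. pair r z \<in> dec c \<and> (\<exists>j. pair j z \<in> dec y))) \<and>
    (\<forall>r z. pair r z \<in> dec c \<longrightarrow> r < m \<and> (\<forall>r'. pair r' z \<in> dec c \<longrightarrow> r = r') \<and> (\<forall>z'. pair r z' \<in> dec c \<longrightarrow> z = z'))"
proof -
  have 1: "(\<exists>z<c. pair r z \<in> dec c \<and> (\<exists>j<y. pair j z \<in> dec y)) \<longleftrightarrow>
    (\<exists>z. pair r z \<in> dec c \<and> (\<exists>j. pair j z \<in> dec y))" for r y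
    using pair_mem_less by blast
  have 2: "(\<forall>y<x. request Y x r y \<longrightarrow> R y) \<longleftrightarrow> (\<forall>y. request Y x r y \<longrightarrow> R y)" for r R
    using request_less by blast
  show ?thesis unfolding picks_def ball_dec unfolding 1 2 ball_dec1 ball_dec2 by blast
qed

lemma d0_request:
  assumes B: "B \<in> sets" and f: "trm f" and g: "trm g" and h: "trm h" and k: "trm k"
  shows "d0 (\<lambda>e. request {i. pair i (f e) \<in> B} (g e) (h e) (k e))"
proof -
  note sh = trm_shift trm_shift[OF trm_shift]
  show ?thesis unfolding request_def
    by (intro d0_intros d0_Seq d0_W[OF B] f g h k sh[OF f] sh[OF g] sh[OF h] sh[OF k])
qed

lemma d0_picks:
  assumes B: "B \<in> sets" and f: "trm f" and g: "trm g" and h: "trm h" and k: "trm k"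
  shows "d0 (\<lambda>e. picks {i. pair i (f e) \<in> B} (g e) (h e) (k e))"
proof -
  note sh = trm_shift trm_shift[OF trm_shift] trm_shift[OF trm_shift[OF trm_shift]]
    trm_shift[OF trm_shift[OF trm_shift[OF trm_shift]]]
  show ?thesis unfolding picks_def
    by (intro d0_intros d0_dec d0_request[OF B] f g h k sh[OF f] sh[OF g] sh[OF h] sh[OF k])
qed

text \<open>Earlier choices are kept. When requirement \<open>m\<close> is served, at most
  \<open>m\<close> values are occupied while its sequence has \<open>m + 1\<close> positions, so
  \<open>free_value\<close> provides a new one.\<close>

lemma picks_exists:
  fixes q :: "'a::rca0"
  assumes B: "B \<in> sets"
  shows "\<exists>c. picks {i. pair i q \<in> B} x c m"
proof (rule sigma1_induct[where P = "\<lambda>c m. picks {i. pair i q \<in> B} x c m"])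
  show "d0 (\<lambda>e. picks {i. pair i q \<in> B} x (e 0) (e 1))" by (intro d0_picks[OF B] d0_intros)
  show "\<exists>c. picks {i. pair i q \<in> B} x c 0"
    by (rule exI[of _ 0]) (simp add: picks_iff code_empty)
next
  let ?Y = "{i. pair i q \<in> B}"
  fix m assume "\<exists>c. picks ?Y x c m"
  then obtain c where c: "\<And>r y. r < m \<Longrightarrow> request ?Y x r y \<Longrightarrow> \<exists>z. pair r z \<in> dec c \<and> (\<exists>j. pair j z \<in> dec y)"
    "\<And>r z. pair r z \<in> dec c \<Longrightarrow> r < m" "\<And>r r' z. pair r z \<in> dec c \<Longrightarrow> pair r' z \<in> dec c \<Longrightarrow> r = r'"
    "\<And>r z z'. pair r z \<in> dec c \<Longrightarrow> pair r z' \<in> dec c \<Longrightarrow> z = z'"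
    unfolding picks_iff by blast
  show "\<exists>c. picks ?Y x c (m + 1)"
  proof (cases "\<exists>y. request ?Y x m y")
    case False
    then have "picks ?Y x c (m + 1)" unfolding picks_iff pre_less_Suc using c by blast
    then show ?thesis ..
  next
    case True
    then obtain y where y: "request ?Y x m y" ..
    then have "Seq y m" unfolding request_def by blast
    then have "\<exists>j z. pair j z \<in> dec y \<and> (\<forall>r. pair r z \<notin> dec c)"
      by (rule free_value) (erule (1) c(4), erule c(2))
    then obtain j z where z: "pair j z \<in> dec y" "\<And>r. pair r z \<notin> dec c" by blast
    obtain c' where c': "dec c' = insert (pair m z) (dec c)" using code_insert by blast
    have mem: "pair r w \<in> dec c' \<longleftrightarrow> r = m \<and> w = z \<or> pair r w \<in> dec c" for r w unfolding c' by simp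
    have "picks ?Y x c' (m + 1)"
      unfolding picks_iff mem
    proof (intro conjI allI impI)
      fix r y' assume r: "r < m + 1" and y': "request ?Y x r y'"
      show "\<exists>z'. (r = m \<and> z' = z \<or> pair r z' \<in> dec c) \<and> (\<exists>j. pair j z' \<in> dec y')"
      proof (cases "r = m")
        case True
        then have "y' = y" using request_unique y y' by blast
        then show ?thesis using True z(1) by blast
      next
        case False
        then show ?thesis using c(1) y' r unfolding pre_less_Suc by blast
      qed
    next
      fix r w assume "r = m \<and> w = z \<or> pair r w \<in> dec c"
      then show "r < m + 1" unfolding pre_less_Suc using c(2) by blast
    next
      fix r w r' assume "r = m \<and> w = z \<or> pair r w \<in> dec c" "r' = m \<and> w = z \<or> pair r' w \<in> dec c"
      then show "r = r'" using c(3) z(2) by blast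
    next
      fix r w w' assume "r = m \<and> w = z \<or> pair r w \<in> dec c" "r = m \<and> w' = z \<or> pair r w' \<in> dec c"
      then show "w = w'" using c(2,4) by (metis less_irrefl)
    qed
    then show ?thesis ..
  qed
qed

text \<open>The least matching is a canonical choice, which makes the color unique. Only
  requirements below \<open>x\<close> are served.\<close>

definition least_picks :: "'a::rca0 set \<Rightarrow> 'a \<Rightarrow> 'a \<Rightarrow> bool"
  where "least_picks Y x c \<longleftrightarrow> picks Y x c x \<and> (\<forall>c'<c. \<not> picks Y x c' x)"

lemma least_picks_exists: "B \<in> sets \<Longrightarrow> \<exists>c. least_picks {i. pair i q \<in> B} x c"
proof -
  assume B: "B \<in> sets"
  obtain c where "picks {i. pair i q \<in> B} x c x" using picks_exists[OF B] by blast
  moreover have "d0 (\<lambda>e. picks {i. pair i q \<in> B} x (e 0) x)" by (intro d0_picks[OF B] d0_intros)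
  ultimately show ?thesis unfolding least_picks_def
    by (intro delta0_least[of "\<lambda>c. picks {i. pair i q \<in> B} x c x"])
qed

lemma least_picks_unique: "least_picks Y x c \<Longrightarrow> least_picks Y x c' \<Longrightarrow> c = c'"
  unfolding least_picks_def by (meson linorder_less_linear)

text \<open>A value matched with requirement \<open>(e, i)\<close> gets the color \<open>i\<close>;
  the default color of unmatched values is 0.\<close>

definition col :: "'a::rca0 \<Rightarrow> 'a \<Rightarrow> 'a \<Rightarrow> bool" where
  "col c a y \<longleftrightarrow> (\<exists>e<c. pair (pair e y) a \<in> dec c) \<or>
    y = 0 \<and> \<not> (\<exists>e<c. (\<exists>i<c. pair (pair e i) a \<in> dec c))"

lemma col_iff: "col c a y \<longleftrightarrow> (\<exists>e. pair (pair e y) a \<in> dec c) \<or>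
    y = 0 \<and> \<not> (\<exists>e i. pair (pair e i) a \<in> dec c)"
proof -
  have "e < c \<and> i < c" if "pair (pair e i) a \<in> dec c" for e i
    using pair_mem_less(1)[OF that] fst_le_pair[of e i] snd_le_pair[of i e] by (meson le_less_trans)
  then show ?thesis unfolding col_def by blast
qed

lemma col_unique: "picks Y x c m \<Longrightarrow> \<exists>y. col c a y \<and> (\<forall>y'. col c a y' \<longrightarrow> y' = y)"
proof -
  assume "picks Y x c m"
  then have *: "\<And>r r' z. pair r z \<in> dec c \<Longrightarrow> pair r' z \<in> dec c \<Longrightarrow> r = r'" unfolding picks_iff by blast
  show ?thesis
  proof (cases "\<exists>e i. pair (pair e i) a \<in> dec c")
    case True
    then obtain e i where ei: "pair (pair e i) a \<in> dec c" by blast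
    have "y' = i" if y': "col c a y'" for y'
    proof -
      obtain e' where "pair (pair e' y') a \<in> dec c" using y' True unfolding col_iff by blast
      from *[OF this ei] show ?thesis by simp
    qed
    then show ?thesis using ei unfolding col_iff by blast
  qed (simp add: col_iff)
qed

text \<open>Lists exist only outside the model. The recursion in \<open>Tup_Suc\<close> shows that,
  for each standard length, the codes of increasing tuples are recognized by a bounded
  formula.\<close>

definition Tup :: "nat \<Rightarrow> 'a::rca0 \<Rightarrow> 'a \<Rightarrow> 'a \<Rightarrow> bool"
  where "Tup k a p x \<longleftrightarrow> (\<exists>xs. length xs = k \<and> tup xs = p \<and> inc (a # xs) \<and> hd xs = x)"

lemma tup_Cons: "xs \<noteq> [] \<Longrightarrow> tup (x # xs) = pair x (tup xs)"
  by (cases xs) simp_all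

lemma hd_le_tup: "xs \<noteq> [] \<Longrightarrow> hd xs \<le> tup xs"
  by (cases xs rule: tup.cases) (simp_all add: fst_le_pair)

lemma tup_inject: "length xs = length ys \<Longrightarrow> tup xs = tup ys \<Longrightarrow> xs = ys"
proof (induction xs arbitrary: ys rule: tup.induct)
  case (2 x)
  then show ?case by (cases ys rule: tup.cases) simp_all
next
  case (3 x y xs)
  then obtain x' y' ys' where ys: "ys = x' # y' # ys'" by (metis length_Suc_conv)
  then have "y # xs = y' # ys'" using 3 by (intro 3(1)) simp_all
  then show ?case using 3(3) unfolding ys by simp
qed simp

lemma Tup_1: "Tup (Suc 0) a p x \<longleftrightarrow> p = x \<and> a < x"
  unfolding Tup_def by (auto simp: length_Suc_conv intro: exI[of _ "[x]"])

lemma Tup_Suc: "Tup (Suc (Suc k)) a p x \<longleftrightarrow>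
    (\<exists>q<p + 1. (\<exists>x'<p + 1. p = pair x q \<and> a < x \<and> Tup (Suc k) x q x'))"
proof
  assume "Tup (Suc (Suc k)) a p x"
  then obtain x' ys where ys: "length (x' # ys) = Suc k" "tup (x # x' # ys) = p" "inc (a # x # x' # ys)"
    unfolding Tup_def by (metis length_Suc_conv list.sel(1))
  have "x' \<le> tup (x' # ys)" using hd_le_tup[of "x' # ys"] by simp
  moreover have "tup (x' # ys) \<le> p" using ys(2) snd_le_pair by auto
  moreover have "Tup (Suc k) x (tup (x' # ys)) x'" unfolding Tup_def using ys by (intro exI[of _ "x' # ys"]) simp
  ultimately show "\<exists>q<p + 1. (\<exists>x'<p + 1. p = pair x q \<and> a < x \<and> Tup (Suc k) x q x')"
    unfolding less_Suc_iff_le using ys(2,3) by (intro exI[of _ "tup (x' # ys)"] conjI exI[of _ x']) auto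
next
  assume "\<exists>q<p + 1. (\<exists>x'<p + 1. p = pair x q \<and> a < x \<and> Tup (Suc k) x q x')"
  then obtain q x' xs where "p = pair x q" "a < x" "length xs = Suc k" "tup xs = q" "inc (x # xs)"
    unfolding Tup_def by blast
  then show "Tup (Suc (Suc k)) a p x" unfolding Tup_def
    using tup_Cons[of xs x] by (intro exI[of _ "x # xs"]) force
qed

lemma d0_Tup: "trm f \<Longrightarrow> trm g \<Longrightarrow> trm h \<Longrightarrow> d0 (\<lambda>e. Tup (Suc k) (f e) (g e) (h e))"
proof (induction k arbitrary: f g h)
  case 0
  then show ?case unfolding Tup_1 by (intro d0_intros)
next
  case (Suc k)
  note sh = trm_shift trm_shift[OF trm_shift]
  show ?case unfolding Tup_Suc
    by (intro d0_intros Suc.IH Suc.prems sh[OF Suc.prems(1)] sh[OF Suc.prems(2)] sh[OF Suc.prems(3)])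
qed

lemma d0_col: "trm f \<Longrightarrow> trm g \<Longrightarrow> trm h \<Longrightarrow> d0 (\<lambda>e. col (f e) (g e) (h e))"
  by (rule d0.P_subst3) (unfold col_def, intro d0_intros d0_dec)

lemma d0_least_picks:
  assumes B: "B \<in> sets" and f: "trm f" and g: "trm g" and h: "trm h"
  shows "d0 (\<lambda>e. least_picks {i. pair i (f e) \<in> B} (g e) (h e))"
  unfolding least_picks_def
  by (intro d0_intros d0_picks[OF B] f g h trm_shift[OF f] trm_shift[OF g] trm_shift[OF h])

text \<open>No bound for the least matching is at hand, so the coloring is obtained by Delta_1
  comprehension: \<open>R\<close> says that some least matching gives the color, \<open>R'\<close>
  that every one does, and these agree because there is exactly one.\<close>

lemma coloring:
  fixes T :: "'a::rca0 set"
  assumes "T \<in> sets" "j \<le> k" "k \<noteq> 0"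
  obtains F where "F \<in> sets" "isfun (k + 1) F"
    "\<And>xs e i y. length xs = k \<Longrightarrow> inc xs \<Longrightarrow> pair e i < hd xs \<Longrightarrow> request (appr T j xs) (hd xs) (pair e i) y \<Longrightarrow>
      \<exists>l z. pair l z \<in> dec y \<and> pair (tup (z # xs)) i \<in> F"
proof -
  obtain k' where k': "k = Suc k'" using assms(3) not0_implies_Suc by blast
  obtain B where B: "B \<in> sets" "\<And>xs. length xs = k \<Longrightarrow> {t. pair t (tup xs) \<in> B} = appr T j xs"
    using appr_definable[OF assms] by blast
  let ?Y = "\<lambda>p. {i. pair i p \<in> B}"
  define R where "R c w \<longleftrightarrow> (\<exists>a<w + 1. (\<exists>p<w + 1. (\<exists>y<w + 1. (\<exists>x. x < w + 1 \<and>
    w = pair (pair a p) y \<and> Tup k a p x \<and> least_picks (?Y p) x c \<and> col c a y))))" for c w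
  define R' where "R' c w \<longleftrightarrow> (\<exists>a<w + 1. (\<exists>p<w + 1. (\<exists>y<w + 1. (\<exists>x. x < w + 1 \<and>
    w = pair (pair a p) y \<and> Tup k a p x \<and> (least_picks (?Y p) x c \<longrightarrow> col c a y)))))" for c w
  have collapse: "(\<exists>a'<w + 1. (\<exists>p'<w + 1. (\<exists>y'<w + 1. (\<exists>x. x < w + 1 \<and>
      w = pair (pair a' p') y' \<and> C a' p' y' x)))) \<longleftrightarrow> (\<exists>x. C a p y x)"
    if w: "w = pair (pair a p) y" and C: "\<And>x. C a p y x \<Longrightarrow> x \<le> p" for C and a p y w :: 'a
  proof
    assume "\<exists>x. C a p y x"
    then obtain x where x: "C a p y x" ..
    have "a \<le> w" "p \<le> w" "y \<le> w" unfolding w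
      by (rule order.trans[OF fst_le_pair fst_le_pair], rule order.trans[OF snd_le_pair fst_le_pair], rule snd_le_pair)
    moreover from this(2) have "x \<le> w" using C[OF x] by simp
    ultimately show "\<exists>a'<w + 1. (\<exists>p'<w + 1. (\<exists>y'<w + 1. (\<exists>x. x < w + 1 \<and>
      w = pair (pair a' p') y' \<and> C a' p' y' x)))"
      unfolding less_Suc_iff_le using w x by blast
  qed (use w in auto)
  have Tup_le: "x \<le> p" if "Tup k a p x" for a p x
  proof -
    obtain xs where "length xs = k" "tup xs = p" "hd xs = x" using \<open>Tup k a p x\<close> unfolding Tup_def by blast
    then show ?thesis using hd_le_tup[of xs] assms(3) by auto
  qed
  have Tup_fun: "x = x'" if "Tup k a p x" "Tup k a p x'" for a p x x'
    using that tup_inject unfolding Tup_def by metis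
  have R: "R c (pair (pair a p) y) \<longleftrightarrow> (\<exists>x. Tup k a p x \<and> least_picks (?Y p) x c \<and> col c a y)" for c a p y
    unfolding R_def by (rule collapse[OF refl]) (use Tup_le in blast)
  have R': "R' c (pair (pair a p) y) \<longleftrightarrow> (\<exists>x. Tup k a p x \<and> (least_picks (?Y p) x c \<longrightarrow> col c a y))" for c a p y
    unfolding R'_def by (rule collapse[OF refl]) (use Tup_le in blast)
  have RR': "(\<exists>c. R c w) \<longleftrightarrow> (\<forall>c. R' c w)" for w
  proof (cases "\<exists>a p y x. w = pair (pair a p) y \<and> Tup k a p x")
    case True
    then obtain a p y x where w: "w = pair (pair a p) y" "Tup k a p x" by blast
    obtain c where c: "least_picks (?Y p) x c" using least_picks_exists[OF B(1)] by blast
    have "(\<exists>c. R c w) \<longleftrightarrow> col c a y" unfolding w(1) R using c w(2) Tup_fun least_picks_unique by blast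
    moreover have "(\<forall>c. R' c w) \<longleftrightarrow> col c a y" unfolding w(1) R' using c w(2) Tup_fun least_picks_unique by blast
    ultimately show ?thesis by simp
  qed (auto simp: R_def R'_def)
  define F where "F = {w. \<exists>c. R c w}"
  have "d0 (\<lambda>e. R (e 0) (e 1))" unfolding R_def k' by (intro d0_intros d0_Tup d0_least_picks[OF B(1)] d0_col)
  moreover have "d0 (\<lambda>e. R' (e 0) (e 1))" unfolding R'_def k' by (intro d0_intros d0_Tup d0_least_picks[OF B(1)] d0_col)
  ultimately have "F \<in> sets" unfolding F_def by (rule delta1_comprehension) (rule RR')
  have F: "pair (tup (a # xs)) y \<in> F \<longleftrightarrow> (\<exists>c. least_picks (appr T j xs) (hd xs) c \<and> col c a y)"
    if "length xs = k" "inc (a # xs)" for a xs y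
  proof -
    have "xs \<noteq> []" using that assms(3) by auto
    have T: "Tup k a (tup xs) (hd xs)" using that unfolding Tup_def by blast
    have "(\<exists>x. Tup k a (tup xs) x \<and> C x) \<longleftrightarrow> C (hd xs)" for C using T Tup_fun by blast
    then show ?thesis
      unfolding F_def mem_Collect_eq tup_Cons[OF \<open>xs \<noteq> []\<close>] R B(2)[OF that(1)] by simp
  qed
  have ex: "\<exists>c. least_picks (appr T j xs) (hd xs) c" if "length xs = k" for xs
    using least_picks_exists[OF B(1), of "tup xs" "hd xs"] unfolding B(2)[OF that] .
  have "isfun (k + 1) F"
    unfolding isfun_def
  proof (intro conjI ballI allI impI)
    fix w assume "w \<in> F"
    then obtain c a p y x where "w = pair (pair a p) y" "Tup k a p x" unfolding F_def R_def by blast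
    then obtain xs where "w = pair (pair a (tup xs)) y" "length xs = k" "inc (a # xs)" unfolding Tup_def by blast
    then show "\<exists>xs. length xs = k + 1 \<and> inc xs \<and> (\<exists>y. w = pair (tup xs) y)"
      using assms(3) by (intro exI[of _ "a # xs"]) (auto simp: tup_Cons)
  next
    fix xs :: "'a list" assume "length xs = k + 1" "inc xs"
    then obtain a ys where xs: "xs = a # ys" "length ys = k" by (auto simp: length_Suc_conv)
    obtain c where c: "least_picks (appr T j ys) (hd ys) c" using ex[OF xs(2)] ..
    have "pair (tup xs) y \<in> F \<longleftrightarrow> col c a y" for y
      using F[OF xs(2)] \<open>inc xs\<close> c least_picks_unique unfolding xs(1) by blast
    then show "\<exists>y. pair (tup xs) y \<in> F \<and> (\<forall>y'. pair (tup xs) y' \<in> F \<longrightarrow> y' = y)"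
      using col_unique c unfolding least_picks_def by metis
  qed
  moreover have "\<exists>l z. pair l z \<in> dec y \<and> pair (tup (z # xs)) i \<in> F"
    if xs: "length xs = k" "inc xs" and r: "pair e i < hd xs" "request (appr T j xs) (hd xs) (pair e i) y" for xs e i y
  proof -
    obtain c where c: "least_picks (appr T j xs) (hd xs) c" using ex[OF xs(1)] ..
    then obtain z l where z: "pair (pair e i) z \<in> dec c" "pair l z \<in> dec y"
      using r unfolding least_picks_def picks_iff by blast
    \<comment> \<open>A value is smaller than the code of its sequence, which is smaller than the
      stage \<open>hd xs\<close>; hence the colored tuple is increasing.\<close>
    have "z < hd xs" using pair_mem_less(2)[OF z(2)] request_less[OF r(2)] by (rule less_trans)
    then have "inc (z # xs)" using xs assms(3) by (cases xs) simp_all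
    moreover have "col c z i" unfolding col_iff using z(1) by blast
    ultimately show ?thesis using F[OF xs(1)] c z(2) by blast
  qed
  ultimately show ?thesis using that \<open>F \<in> sets\<close> by blast
qed

section \<open>Diagonally non-computable functions from thin sets\<close>

lemma isfun_1:
  assumes "\<And>z. z \<in> G \<Longrightarrow> \<exists>x y. z = pair x y" "\<And>x. \<exists>y. pair x y \<in> G \<and> (\<forall>y'. pair x y' \<in> G \<longrightarrow> y' = y)"
  shows "isfun 1 G"
  unfolding isfun_def
proof (intro conjI ballI allI impI)
  fix z assume "z \<in> G"
  then obtain x y where "z = pair x y" using assms(1) by blast
  then show "\<exists>xs. length xs = 1 \<and> inc xs \<and> (\<exists>y. z = pair (tup xs) y)" by (intro exI[of _ "[x]"]) simp
next
  fix xs :: "'a list" assume "length xs = 1"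
  then obtain x where "xs = [x]" by (auto simp: length_Suc_conv)
  then show "\<exists>y. pair (tup xs) y \<in> G \<and> (\<forall>y'. pair (tup xs) y' \<in> G \<longrightarrow> y' = y)" using assms(2)[of x] by simp
qed

lemma DNRM_of_thin:
  fixes T :: "'a::rca0 set"
  assumes "TSM (k + 1) TYPE('a)" and T: "T \<in> sets" and j: "j \<le> k" and k: "k \<noteq> 0"
    and bounding: "\<And>i b. i < j \<Longrightarrow> \<exists>u. \<forall>t<b. t \<in> Jump (Suc i) T \<longrightarrow> (\<exists>y. W (Jump i T) t u y)"
  shows "DNRM j T"
proof -
  obtain F where F: "F \<in> sets" "isfun (k + 1) F"
    "\<And>xs e i y. length xs = k \<Longrightarrow> inc xs \<Longrightarrow> pair e i < hd xs \<Longrightarrow> request (appr T j xs) (hd xs) (pair e i) y \<Longrightarrow>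
      \<exists>l z. pair l z \<in> dec y \<and> pair (tup (z # xs)) i \<in> F"
    using coloring[OF T j k] by blast
  from assms(1)[unfolded TSM_def, rule_format, OF F(1,2)]
  obtain A i where A: "A \<in> sets" "unbounded A"
    and thin: "\<forall>xs. length xs = k + 1 \<longrightarrow> inc xs \<and> set xs \<subseteq> A \<longrightarrow> pair (tup xs) i \<notin> F"
    by (elim bexE conjE exE)
  define Q where "Q e y \<longleftrightarrow> Seq y (pair e i) \<and> (\<forall>l<y. (\<forall>x<y. pair l x \<in> dec y \<longrightarrow> x \<in> A))" for e y
  have Q: "Q e y \<longleftrightarrow> Seq y (pair e i) \<and> (\<forall>l x. pair l x \<in> dec y \<longrightarrow> x \<in> A)" for e y
    unfolding Q_def ball_dec ..
  have d0_Q: "d0 (\<lambda>e. Q (f e) (g e))" if f: "trm f" and g: "trm g" for f g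
    unfolding Q_def
    by (intro d0_intros d0_Seq d0_dec d0_mem[OF _ A(1)] f g trm_shift[OF g] trm_shift[OF trm_shift[OF g]])
  define G where "G = {w. \<exists>e<w + 1. (\<exists>y<w + 1. w = pair e y \<and> Q e y \<and> (\<forall>y'<y. \<not> Q e y'))}"
  have "G \<in> sets" unfolding G_def by (rule delta0_comprehension) (intro d0_intros d0_Q)
  have G: "pair e y \<in> G \<longleftrightarrow> Q e y \<and> (\<forall>y'<y. \<not> Q e y')" for e y
    unfolding G_def less_Suc_iff_le using fst_le_pair[of e y] snd_le_pair[of y e] by auto
  have "isfun 1 G"
  proof (rule isfun_1)
    show "\<exists>x y. z = pair x y" if "z \<in> G" for z using that unfolding G_def by blast
    fix e
    obtain y0 where "Q e y0" using Seq_exists[OF A] unfolding Q by blast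
    from delta0_least[of "Q e", OF d0_Q this] obtain y where "Q e y" "\<And>y'. y' < y \<Longrightarrow> \<not> Q e y'"
      using d0_intros by blast
    then show "\<exists>y. pair e y \<in> G \<and> (\<forall>y'. pair e y' \<in> G \<longrightarrow> y' = y)"
      unfolding G by (meson linorder_less_linear)
  qed
  moreover have "\<not> PhiM (Jump j T) e e y" if "pair e y \<in> G" for e y
  proof
    assume "PhiM (Jump j T) e e y"
    then obtain u where u: "W (Jump j T) e u y" unfolding PhiM_W ..
    have "Q e y" using that G by blast
    have "limiting k (\<lambda>xs. agree u (appr T j xs) (Jump j T))" by (rule limiting_appr[OF bounding j])
    \<comment> \<open>Beyond \<open>u\<close> the computation has converged and its values are
      smaller than all entries of \<open>xs\<close>. Beyond \<open>pair e i\<close> the requirement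
      is among those that are served.\<close>
    from limiting_pick[OF A(2) this, of "max u (pair e i)"] obtain xs where xs: "length xs = k" "set xs \<subseteq> A"
      "inc (max u (pair e i) # xs)" "agree u (appr T j xs) (Jump j T)" by blast
    obtain x ys where x: "xs = x # ys" using xs(1) k by (cases xs) auto
    have "inc xs" "u < x" "pair e i < x" using xs(3) unfolding x by auto
    have "W (appr T j xs) e u y" using u xs(4) W_agree agree_sym by blast
    then have "W (appr T j xs) e (hd xs) y" by (rule W_mono) (simp add: x \<open>u < x\<close> less_imp_le)
    then have "request (appr T j xs) (hd xs) (pair e i) y"
      unfolding request_def less_Suc_iff_le using \<open>Q e y\<close> fst_le_pair snd_le_pair unfolding Q by blast
    from F(3)[OF xs(1) \<open>inc xs\<close> _ this] obtain l z where z: "pair l z \<in> dec y" "pair (tup (z # xs)) i \<in> F"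
      using \<open>pair e i < x\<close> x by auto
    have "z < u" using pair_mem_less(2)[OF z(1)] W_less[OF u] by (rule less_trans)
    then have "inc (z # xs)" using \<open>inc xs\<close> \<open>u < x\<close> unfolding x by auto
    moreover have "z \<in> A" using \<open>Q e y\<close> z(1) unfolding Q by blast
    ultimately show False using thin[rule_format, of "z # xs"] xs(1,2) z(2) by simp
  qed
  ultimately show ?thesis unfolding DNRM_def using \<open>G \<in> sets\<close> by blast
qed

text \<open>If some jump is not coded on an initial segment then the next one is bounded, hence finite. So a jump all of
  whose initial segments are coded is an iterated jump of a set with all intermediate jumps of this kind.\<close>

lemma regular_jump:
  assumes "regular (Jump k X)" "X \<in> sets"
  shows "\<exists>T\<in>sets. \<exists>j\<le>k. Jump k X = Jump j T \<and> (\<forall>i\<le>j. regular (Jump i T))"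
  using assms(1)
proof (induction k)
  case 0
  then show ?case using assms(2) by (intro bexI[of _ X] exI[of _ 0]) simp_all
next
  case (Suc k)
  show ?case
  proof (cases "regular (Jump k X)")
    case True
    then obtain T j where T: "T \<in> sets" "j \<le> k" "Jump k X = Jump j T" "\<And>i. i \<le> j \<Longrightarrow> regular (Jump i T)"
      using Suc.IH by blast
    have eq: "Jump (Suc k) X = Jump (Suc j) T" using T(3) by simp
    have "regular (Jump i T)" if "i \<le> Suc j" for i
      using T(4) Suc.prems that unfolding eq by (cases "i = Suc j") auto
    then show ?thesis using T(1,2) eq by (intro bexI[of _ T] exI[of _ "Suc j"]) auto
  next
    case False
    then obtain b where b: "\<And>h. \<not> agree b (dec h) (Jump k X)" unfolding regular_def by blast
    have bound: "t < b" if t: "t \<in> Jump (Suc k) X" for t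
    proof -
      obtain y where "PhiM (Jump k X) t t y" using t by auto
      then obtain s h d where *: "agree s (dec h) (Jump k X)" "d < s" "tri t t y \<in> dec d"
        unfolding PhiM_def agree_def by blast
      have "\<not> b \<le> s" using b agree_le[OF *(1)] by blast
      then show ?thesis using tri_mem_less(1)[OF *(3)] *(2) by (meson less_trans not_le)
    qed
    obtain h where h: "agree b (dec h) (Jump (Suc k) X)" using Suc.prems unfolding regular_def by blast
    \<comment> \<open>The bounded jump is decoded from a single code, so it is a set of the model
      and becomes the new \<open>T\<close>, with \<open>j = 0\<close>.\<close>
    have "{t. t < b \<and> t \<in> dec h} \<in> sets" by (rule delta0_comprehension) (intro d0_intros d0_dec)
    moreover have "{t. t < b \<and> t \<in> dec h} = Jump (Suc k) X"
      using h bound unfolding agree_def by blast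
    ultimately show ?thesis using Suc.prems by (intro bexI[of _ "Jump (Suc k) X"] exI[of _ 0]) auto
  qed
qed

theorem TSM_DNRM:
  fixes X :: "'a::rca0 set"
  assumes "TSM (k + 1) TYPE('a)" "k \<noteq> 0" "X \<in> sets"
  shows "DNRM k X"
proof (cases "regular (Jump k X)")
  case True
  then obtain T j where T: "T \<in> sets" "j \<le> k" "Jump k X = Jump j T" "\<And>i. i \<le> j \<Longrightarrow> regular (Jump i T)"
    using regular_jump \<open>X \<in> sets\<close> by blast
  have "\<exists>u. \<forall>t<b. t \<in> Jump (Suc i) T \<longrightarrow> (\<exists>y. W (Jump i T) t u y)" if "i < j" for i b
  proof -
    have eq: "Jump 1 (Jump i T) = Jump (Suc i) T" by simp
    show ?thesis using jump_bounding[of "Jump i T" b] T(4)[of i] T(4)[of "Suc i"] that unfolding eq by simp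
  qed
  then have "DNRM j T" by (rule DNRM_of_thin[OF assms(1) T(1,2) assms(2)])
  then show ?thesis unfolding DNRM_def T(3) .
next
  case False
  then obtain b where b: "\<And>h. \<not> agree b (dec h) (Jump k X)" unfolding regular_def by blast
  define G where "G = {w. \<exists>e<w + 1. w = pair e b}"
  have "G \<in> sets" unfolding G_def by (rule delta0_comprehension) (intro d0_intros)
  have G: "pair e y \<in> G \<longleftrightarrow> y = b" for e y
    unfolding G_def less_Suc_iff_le using fst_le_pair by auto
  have "isfun 1 G" by (rule isfun_1) (use G in \<open>auto simp: G_def\<close>)
  moreover have "\<not> PhiM (Jump k X) e e b" for e
  proof
    assume "PhiM (Jump k X) e e b"
    then obtain s h d where *: "agree s (dec h) (Jump k X)" "d < s" "tri e e b \<in> dec d"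
      unfolding PhiM_def agree_def by blast
    then have "b \<le> s" using tri_mem_less(3)[OF *(3)] by simp
    then show False using agree_le[OF *(1)] b by blast
  qed
  ultimately show ?thesis unfolding DNRM_def using \<open>G \<in> sets\<close> G by (intro bexI[of _ G]) auto
qed

section \<open>From truth in all models to derivability\<close>

lemma val_cong: "(\<forall>i<bound_tm t. e i = e' i) \<Longrightarrow> val M e t = val M e' t"
  by (induction t) auto

lemma sat_cong:
  "(\<forall>i<bound \<phi>. e i = e' i) \<Longrightarrow> (\<forall>i<boundS \<phi>. S i = S' i) \<Longrightarrow> sat M e S \<phi> \<longleftrightarrow> sat M e' S' \<phi>"
proof (induction \<phi> arbitrary: e e' S S')
  case (Forall \<phi>)
  have "sat M (case_nat x e) S \<phi> \<longleftrightarrow> sat M (case_nat x e') S' \<phi>" for x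
    by (rule Forall.IH) (use Forall.prems in \<open>auto split: nat.split\<close>)
  then show ?case by simp
next
  case (ForallS \<phi>)
  have "sat M e (case_nat A S) \<phi> \<longleftrightarrow> sat M e' (case_nat A S') \<phi>" for A
    by (rule ForallS.IH) (use ForallS.prems in \<open>auto split: nat.split\<close>)
  then show ?case by simp
next
  case (Imp \<phi> \<psi>)
  have "sat M e S \<phi> \<longleftrightarrow> sat M e' S' \<phi>" by (rule Imp.IH(1)) (use Imp.prems in auto)
  moreover have "sat M e S \<psi> \<longleftrightarrow> sat M e' S' \<psi>" by (rule Imp.IH(2)) (use Imp.prems in auto)
  ultimately show ?case by simp
next
  case (Eq s t)
  then show ?case using val_cong[of s e e'] val_cong[of t e e'] by simp
next
  case (Lt s t)
  then show ?case using val_cong[of s e e'] val_cong[of t e e'] by simp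
next
  case (Mem t X)
  then show ?case using val_cong[of t e e'] by simp
qed simp

lemma RCA0_Suc_neq_Zero: "RCA0 \<turnstile> \<^bold>\<not> t \<^bold>+ \<^bold>1 \<^bold>= \<^bold>0"
proof -
  have "univ_closure (\<^bold>\<not> Var 0 \<^bold>+ \<^bold>1 \<^bold>= \<^bold>0) \<in> RCA0" unfolding RCA0_def basic_axioms_def by blast
  then have "RCA0 \<turnstile> Forall (\<^bold>\<not> Var 0 \<^bold>+ \<^bold>1 \<^bold>= \<^bold>0)" by (simp add: univ_closure_def proves.Assm)
  from proves.ForallE[OF this, of t] show ?thesis by (simp add: inst_def)
qed

lemma RCA0_Suc_inject: "RCA0 \<turnstile> s \<^bold>+ \<^bold>1 \<^bold>= t \<^bold>+ \<^bold>1 \<^bold>\<longrightarrow> s \<^bold>= t"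
proof -
  let ?\<phi> = "Var 1 \<^bold>+ \<^bold>1 \<^bold>= Var 0 \<^bold>+ \<^bold>1 \<^bold>\<longrightarrow> Var 1 \<^bold>= Var 0"
  have "univ_closure ?\<phi> \<in> RCA0" unfolding RCA0_def basic_axioms_def by blast
  then have "RCA0 \<turnstile> Forall (Forall ?\<phi>)" by (simp add: univ_closure_def proves.Assm eval_nat_numeral)
  from proves.ForallE[OF proves.ForallE[OF this, of s, unfolded inst_def subst.simps], of t]
  show ?thesis by (simp add: inst_def)
qed

theorem theorem4p14:
  fixes k :: nat
  assumes "k \<ge> 1"
  shows "RCA0 \<turnstile> TS (k + 1) \<^bold>\<longrightarrow> DNR_jump k"
proof (rule ccontr)
  let ?\<phi> = "TS (k + 1) \<^bold>\<longrightarrow> DNR_jump k"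
  assume "\<not> (RCA0 \<turnstile> ?\<phi>)"
  have closed: "bound \<psi> = 0 \<and> boundS \<psi> = 0" if "\<psi> \<in> RCA0" for \<psi>
    using that bound_univ_closure unfolding RCA0_def by auto
  obtain M :: "gm interp" and e S where M: "range S = isets M" "\<And>\<psi>. \<psi> \<in> RCA0 \<Longrightarrow> sat M e S \<psi>" "\<not> sat M e S ?\<phi>"
    using completeness[OF bij_Rep_gm \<open>\<not> (RCA0 \<turnstile> ?\<phi>)\<close> closed RCA0_Suc_neq_Zero RCA0_Suc_inject] by metis
  \<comment> \<open>The axioms are sentences, so the assignment that comes with the completeness
    theorem is immaterial.\<close>
  have "sat M e' S' \<psi>" if "\<psi> \<in> RCA0" for \<psi> e' S'
    using sat_cong[of \<psi> e e' S S'] closed[OF that] M(2)[OF that] by simp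
  then have "models M" unfolding models_def using M(1) by auto
  moreover have "counter M" unfolding counter_def valid_def using M(1,3) assms by blast
  ultimately have "counter gmodel" by (rule gmodel(2))
  \<comment> \<open>The failing \<open>k'\<close> may differ from \<open>k\<close>, since
    \<open>gmodel\<close> is fixed once for all exponents.\<close>
  then obtain k' where "k' \<ge> 1" "\<not> valid gmodel (TS (k' + 1) \<^bold>\<longrightarrow> DNR_jump k')" unfolding counter_def by blast
  then show False
    unfolding valid_def std_gm[symmetric] using TSM_DNRM[where 'a = gm, of k'] by (simp add: sat_TS sat_DNR)
qed

end
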